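(* Let $\gamma:\mathbb S^1\to\mathbb S^2$ be a smooth, simple, closed curve. Let $L$ be its length, let $A$ be the area of the domain enclosed by $\gamma$ whose induced boundary orientation agrees with that of $\gamma$, let $k_g$ be the geodesic curvature of $\gamma$ in $\mathbb S^2$, and let $k_E$ denote the curvature of $\gamma$ when regarded as a space curve in $\mathbb R^3$. Then $$L^2-A(4\pi-A)\le\left(\int_\gamma k_E\,ds\right)^2-4\pi^2.$$ In fact, $$L^2-A(4\pi-A)=\left(\int_\gamma k_E\,ds\right)^2-4\pi^2-\mathcal R(\gamma),$$ where $$\mathcal R(\gamma):=\iint_{\gamma\times\gamma}\frac{(k_g(s)-k_g(\sigma))^2}{\sqrt{(1+k_g(s)^2)(1+k_g(\sigma)^2)}+1+k_g(s)k_g(\sigma)}\,ds\,d\sigma\ge0.$$ Equality holds in the inequality if and only if $\gamma$ is a geodesic circle.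
   Context: $\mathbb S^2\subset\mathbb R^3$ is the unit sphere. Smooth curves are regular, and $s,\sigma$ denote arclength. The geodesic curvature is $k_g=\langle\overline\nabla_T\nu,T\rangle$, where $T$ is the unit tangent and $\nu$ is the unit normal along $\gamma$ (tangent to $\mathbb S^2$) pointing out of the domain of area $A$. Thus Gauss--Bonnet reads $\int_\gamma k_g\,ds+A=2\pi$. One has $k_E=\sqrt{1+k_g^2}$. A geodesic circle is the boundary of a geodesic ball of $\mathbb S^2$ (great circles included). *)

theory Defs
  imports "HOL-Analysis.Analysis"
begin

section \<open>Smooth closed curves\<close>

text \<open>A map from the circle \<open>\<real>/\<int>\<close> is a function on the real line of period 1; such a
  map is smooth on the circle iff it is smooth on the line.\<close>

definition smooth_curve :: "(real \<Rightarrow> 'a::real_normed_vector) \<Rightarrow> bool" where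
  "smooth_curve \<gamma> \<longleftrightarrow>
     (\<exists>D :: nat \<Rightarrow> real \<Rightarrow> 'a. D 0 = \<gamma> \<and>
        (\<forall>n t. (D n has_vector_derivative D (Suc n) t) (at t)))"

definition velocity :: "(real \<Rightarrow> 'a::real_normed_vector) \<Rightarrow> real \<Rightarrow> 'a" where
  "velocity \<gamma> t = vector_derivative \<gamma> (at t)"

definition speed :: "(real \<Rightarrow> 'a::real_normed_vector) \<Rightarrow> real \<Rightarrow> real" where
  "speed \<gamma> t = norm (velocity \<gamma> t)"

definition unit_tangent :: "(real \<Rightarrow> 'a::real_normed_vector) \<Rightarrow> real \<Rightarrow> 'a" where
  "unit_tangent \<gamma> t = velocity \<gamma> t /\<^sub>R speed \<gamma> t"

definition smooth_simple_closed_spherical_curve :: "(real \<Rightarrow> real^3) \<Rightarrow> bool" where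
  "smooth_simple_closed_spherical_curve \<gamma> \<longleftrightarrow>
     (\<forall>t. \<gamma> (t + 1) = \<gamma> t) \<and>
     smooth_curve \<gamma> \<and>
     (\<forall>t. velocity \<gamma> t \<noteq> 0) \<and>
     inj_on \<gamma> {0..<1} \<and>
     (\<forall>t. \<gamma> t \<in> sphere 0 1)"

text \<open>The integral \<open>\<integral>\<^sub>\<gamma> f ds\<close>, where \<open>f\<close> is given as a function of the parameter rather than
  of arclength.\<close>

definition arclength_integral :: "(real \<Rightarrow> 'a::real_normed_vector) \<Rightarrow> (real \<Rightarrow> real) \<Rightarrow> real" where
  "arclength_integral \<gamma> f = integral {0..1} (\<lambda>t. f t * speed \<gamma> t)"

definition curve_length :: "(real \<Rightarrow> 'a::real_normed_vector) \<Rightarrow> real" where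
  "curve_length \<gamma> = integral {0..1} (speed \<gamma>)"

text \<open>The curvature \<open>|dT/ds|\<close> of a curve in Euclidean space.\<close>

definition space_curvature :: "(real \<Rightarrow> 'a::real_normed_vector) \<Rightarrow> real \<Rightarrow> real" where
  "space_curvature \<gamma> t = norm (velocity (unit_tangent \<gamma>) t /\<^sub>R speed \<gamma> t)"


section \<open>Domains bounded by a spherical curve\<close>

text \<open>The curve \<open>h \<mapsto> cos h \<cdot> \<gamma> t + sin h \<cdot> \<nu> t\<close> is the unit speed geodesic of the sphere that
  leaves \<open>\<gamma> t\<close> in the direction \<open>\<nu> t\<close>.\<close>

definition outward_unit_normal ::
    "(real \<Rightarrow> real^3) \<Rightarrow> (real^3) set \<Rightarrow> (real \<Rightarrow> real^3) \<Rightarrow> bool" where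
  "outward_unit_normal \<gamma> \<Omega> \<nu> \<longleftrightarrow>
     (\<forall>t. norm (\<nu> t) = 1 \<and> \<nu> t \<bullet> \<gamma> t = 0 \<and> \<nu> t \<bullet> velocity \<gamma> t = 0 \<and>
        (\<forall>\<^sub>F h in at_right 0.
           cos h *\<^sub>R \<gamma> t - sin h *\<^sub>R \<nu> t \<in> \<Omega> \<and>
           cos h *\<^sub>R \<gamma> t + sin h *\<^sub>R \<nu> t \<notin> \<Omega>))"

text \<open>The sphere is oriented by its outer normal, which at the point \<open>p\<close> is \<open>p\<close> itself: a basis
  \<open>(v, w)\<close> of the tangent plane at \<open>p\<close> is positive iff \<open>det (p, v, w) > 0\<close>. The induced boundary
  orientation is the one for which (outward normal, tangent) is a positive basis.\<close>

definition induces_orientation :: "(real \<Rightarrow> real^3) \<Rightarrow> (real \<Rightarrow> real^3) \<Rightarrow> bool" where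
  "induces_orientation \<nu> \<gamma> \<longleftrightarrow> (\<forall>t. \<gamma> t \<bullet> cross3 (\<nu> t) (unit_tangent \<gamma> t) > 0)"

text \<open>The domains enclosed by \<open>\<gamma>\<close> are the two components of its complement in the sphere; the
  orientation of \<open>\<gamma>\<close> selects one of them.\<close>

definition positively_enclosed_domain ::
    "(real \<Rightarrow> real^3) \<Rightarrow> (real^3) set \<Rightarrow> (real \<Rightarrow> real^3) \<Rightarrow> bool" where
  "positively_enclosed_domain \<gamma> \<Omega> \<nu> \<longleftrightarrow>
     \<Omega> \<in> components (sphere 0 1 - range \<gamma>) \<and>
     outward_unit_normal \<gamma> \<Omega> \<nu> \<and> induces_orientation \<nu> \<gamma>"

text \<open>The covariant derivative \<open>\<nabla>\<^sub>T V\<close> on the sphere of a tangent field \<open>V\<close> along \<open>\<gamma>\<close>: the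
  tangential part of \<open>dV/ds\<close>.\<close>

definition covariant_derivative ::
    "(real \<Rightarrow> real^3) \<Rightarrow> (real \<Rightarrow> real^3) \<Rightarrow> real \<Rightarrow> real^3" where
  "covariant_derivative \<gamma> V t =
     (let V' = velocity V t /\<^sub>R speed \<gamma> t in V' - (V' \<bullet> \<gamma> t) *\<^sub>R \<gamma> t)"

definition geodesic_curvature ::
    "(real \<Rightarrow> real^3) \<Rightarrow> (real \<Rightarrow> real^3) \<Rightarrow> real \<Rightarrow> real" where
  "geodesic_curvature \<gamma> \<nu> t = covariant_derivative \<gamma> \<nu> t \<bullet> unit_tangent \<gamma> t"


section \<open>Area on the sphere\<close>

definition area_element :: "(real \<times> real \<Rightarrow> real^3) \<Rightarrow> real \<times> real \<Rightarrow> real" where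
  "area_element X = (\<lambda>(u, v). norm (cross3 (vector_derivative (\<lambda>a. X (a, v)) (at u))
                                           (vector_derivative (\<lambda>b. X (u, b)) (at v))))"

text \<open>Inverse stereographic projection from the north pole. It parametrizes the sphere minus one
  point, which has no area, so a single chart computes the area of every (Borel) set.\<close>

definition stereographic_chart :: "real \<times> real \<Rightarrow> real^3" where
  "stereographic_chart = (\<lambda>(u, v). (1 / (1 + u\<^sup>2 + v\<^sup>2)) *\<^sub>R vector [2 * u, 2 * v, u\<^sup>2 + v\<^sup>2 - 1])"

definition sphere_area :: "(real^3) set \<Rightarrow> real" where
  "sphere_area \<Omega> = (LINT w:stereographic_chart -` \<Omega>|lborel. area_element stereographic_chart w)"


section \<open>Geodesic circles\<close>

definition geodesic_ball :: "real^3 \<Rightarrow> real \<Rightarrow> (real^3) set" where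
  "geodesic_ball p r = {x \<in> sphere 0 1. arccos (p \<bullet> x) < r}"

text \<open>Balls of radius \<open>r \<ge> \<pi>\<close> are excluded: their boundary is a single point or empty.\<close>

definition geodesic_circle :: "(real^3) set \<Rightarrow> bool" where
  "geodesic_circle C \<longleftrightarrow>
     (\<exists>p r. p \<in> sphere 0 1 \<and> 0 < r \<and> r < pi \<and>
        C = (top_of_set (sphere 0 1)) frontier_of (geodesic_ball p r))"


section \<open>The deficit\<close>

definition curvature_deficit :: "(real \<Rightarrow> real^3) \<Rightarrow> (real \<Rightarrow> real) \<Rightarrow> real" where
  "curvature_deficit \<gamma> k =
     arclength_integral \<gamma> (\<lambda>s. arclength_integral \<gamma> (\<lambda>\<sigma>.
       (k s - k \<sigma>)\<^sup>2 / (sqrt ((1 + (k s)\<^sup>2) * (1 + (k \<sigma>)\<^sup>2)) + 1 + k s * k \<sigma>)))"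

end

theory Submission
  imports Defs "HOL-Probability.Sinc_Integral"
begin

text \<open>The integrand of \<open>R(\<gamma>)\<close> equals \<open>k\<^sub>E(s) k\<^sub>E(\<sigma>) - 1 - k\<^sub>g(s) k\<^sub>g(\<sigma>)\<close>, so
  \<open>R(\<gamma>) = (\<integral> k\<^sub>E)\<^sup>2 - L\<^sup>2 - (\<integral> k\<^sub>g)\<^sup>2\<close> and the claim amounts to Gauss--Bonnet, \<open>\<integral> k\<^sub>g + A = 2 \<pi>\<close>, together
  with the fact that curves of constant geodesic curvature are circles.

  For Gauss--Bonnet, let \<open>F(z) = \<integral> \<langle>z, \<nu>\<rangle> / (1 - \<langle>z, \<gamma>\<rangle>) ds\<close>, a double layer potential on the sphere.
  The form \<open>(k\<^sub>g + \<langle>z, \<nu>\<rangle> / (1 - \<langle>z, \<gamma>\<rangle>)) ds\<close> is the differential of the angle between \<open>\<gamma>\<close> and the circles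
  that leave \<open>z\<close> in a fixed direction. Hence \<open>\<integral> k\<^sub>g + F(z)\<close> is a multiple of \<open>2 \<pi>\<close> for \<open>z\<close> off the curve,
  and \<open>F\<close> is locally constant there. On the curve \<open>\<integral> k\<^sub>g + F(z) = 0\<close>, by Hopf's argument applied to the
  symmetric function that measures the angle at \<open>\<gamma> t\<close> between \<open>\<gamma>\<close> and the circle through \<open>\<gamma> t\<close> that
  touches \<open>\<gamma>\<close> at \<open>\<gamma> s\<close>. The jump relation of the double layer potential turns this into
  \<open>F = - \<integral> k\<^sub>g - 2 \<pi>\<close> in the domain and \<open>F = - \<integral> k\<^sub>g + 2 \<pi>\<close> outside. Since the kernel is odd under a
  reflection of the sphere, \<open>F\<close> has mean zero, which yields \<open>\<integral> k\<^sub>g = 2 \<pi> - A\<close>.\<close>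

section \<open>The moving frame of a spherical curve\<close>

text \<open>As a function of \<open>x\<close>, \<open>- ln (1 - z \<bullet> x)\<close> is a Green
  function of the sphere: its Laplacian is 1 away from \<open>z\<close>, with a point mass
  \<open>- 4 pi\<close> at \<open>z\<close>. The divergence theorem would thus predict that
  \<open>F\<close> equals \<open>A - 4 pi\<close> inside and \<open>A\<close> outside. The same
  values are reached here without integrating by parts over \<open>\<Omega>\<close>, which is given
  only as a component with a normal pointing out of it: all integrals run along the curve until
  \<open>A\<close> enters through the mean of a step function. The angle form also has a planar
  meaning. Stereographic projection from \<open>z\<close> turns the circles that leave
  \<open>z\<close> in one direction into parallel lines and scales lengths by
  \<open>1 / (1 - z \<bullet> x)\<close>; by the conformal change of geodesic curvature the form is
  the curvature form of the planar image, and its integral is 2 pi times a turning number. The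
  averaging is done over the unit ball, with the kernel constant along rays, so that it rests on
  Lebesgue measure and its orthogonal invariance. Area is then three times the volume of the cone
  over \<open>\<Omega>\<close>, and only this last identity involves the stereographic
  chart.\<close>

locale spherical_frame =
  fixes \<gamma> \<nu> T :: "real \<Rightarrow> real^3" and v k :: "real \<Rightarrow> real"
  assumes deriv_curve: "(\<gamma> has_vector_derivative v t *\<^sub>R T t) (at t)"
    and deriv_tangent: "(T has_vector_derivative v t *\<^sub>R (- \<gamma> t - k t *\<^sub>R \<nu> t)) (at t)"
    and deriv_normal: "(\<nu> has_vector_derivative (v t * k t) *\<^sub>R T t) (at t)"
    and speed_pos: "v t > 0"
    and continuous_speed: "continuous_on UNIV v"
    and continuous_curvature: "continuous_on UNIV k"
    and orthonormal: "\<gamma> t \<bullet> \<gamma> t = 1" "\<nu> t \<bullet> \<nu> t = 1" "T t \<bullet> T t = 1"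
      "\<gamma> t \<bullet> \<nu> t = 0" "\<gamma> t \<bullet> T t = 0" "\<nu> t \<bullet> T t = 0"
    and positive: "cross3 (\<nu> t) (T t) = \<gamma> t"
    and periodic: "\<gamma> (t + 1) = \<gamma> t" "\<nu> (t + 1) = \<nu> t" "T (t + 1) = T t"
      "v (t + 1) = v t" "k (t + 1) = k t"
    and simple: "\<gamma> s = \<gamma> t \<Longrightarrow> s - t \<in> \<int>"

section \<open>Vector calculus and orthonormal frames in three-space\<close>

lemma has_vector_derivative_cross3:
  assumes "(f has_vector_derivative f') (at t)" "(g has_vector_derivative g') (at t)"
  shows "((\<lambda>x. cross3 (f x) (g x)) has_vector_derivative (cross3 (f t) g' + cross3 f' (g t))) (at t)"
  using bounded_bilinear.has_vector_derivative[OF _ assms] bilinear_cross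
    bilinear_conv_bounded_bilinear by blast

lemma periodic_vector_derivative:
  fixes f :: "real \<Rightarrow> 'a::real_normed_vector"
  assumes "\<And>t. f (t + 1) = f t" "(f has_vector_derivative d1) (at (t + 1))"
    "(f has_vector_derivative d2) (at t)"
  shows "d1 = d2"
proof -
  have "((\<lambda>x. f (x + 1)) has_vector_derivative d1) (at t)"
    using vector_diff_chain_at[OF has_vector_derivative_add[OF has_vector_derivative_id
        has_vector_derivative_const] assms(2)] by (simp add: o_def id_def)
  then show ?thesis
    using assms(1,3) vector_derivative_unique_at by simp
qed

lemma periodic_add_int:
  fixes t :: real and n :: int
  assumes "\<And>t. f (t + 1) = f t"
  shows "f (t + n) = f t"
proof -
  have A: "f (t + real m) = f t" for m :: nat and t
  proof (induction m)
    case (Suc m)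
    have "f (t + real (Suc m)) = f ((t + real m) + 1)"
      by (simp add: algebra_simps)
    then show ?case using Suc assms by simp
  qed simp
  show ?thesis
  proof (cases "n \<ge> 0")
    case True
    then show ?thesis using A[of t "nat n"] by simp
  next
    case False
    then show ?thesis using A[of "t + n" "nat (-n)"] by simp
  qed
qed

lemma has_vector_derivative_normalize:
  fixes f :: "real \<Rightarrow> 'a::real_inner"
  assumes "(f has_vector_derivative f') (at t)" "f t \<noteq> 0"
  shows "((\<lambda>x. f x /\<^sub>R norm (f x)) has_vector_derivative
    f' /\<^sub>R norm (f t) - ((f t \<bullet> f') / norm (f t) ^ 3) *\<^sub>R f t) (at t)"
proof -
  have "((\<lambda>x. norm (f x)) has_derivative (\<lambda>h. (h *\<^sub>R f') \<bullet> sgn (f t))) (at t)"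
    using has_derivative_compose[OF assms(1)[unfolded has_vector_derivative_def]
        has_derivative_norm[OF assms(2)]] by simp
  then have n: "((\<lambda>x. norm (f x)) has_real_derivative (f t \<bullet> f') / norm (f t)) (at t)"
    unfolding has_field_derivative_def
    by (rule has_derivative_eq_rhs) (auto simp: sgn_div_norm inner_commute divide_inverse)
  have "((\<lambda>x. inverse (norm (f x))) has_real_derivative
      - ((f t \<bullet> f') / norm (f t) ^ 3)) (at t)"
    using DERIV_inverse'[OF n] assms(2) by (simp add: field_simps power3_eq_cube)
  then show ?thesis
    using has_vector_derivative_scaleR[OF _ assms(1)] by fastforce
qed

text \<open>Orthogonality makes \<open>n\<close> a unit vector parallel to
  \<open>cross3 u p\<close>, hence equal to it up to sign; the triple product decides the
  sign.\<close>

lemma cross3_perp_eq: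
  fixes p n u :: "real^3"
  assumes "norm p = 1" "norm u = 1" "norm n = 1" "p \<bullet> u = 0" "n \<bullet> p = 0" "n \<bullet> u = 0"
    "p \<bullet> cross3 n u > 0"
  shows "n = cross3 u p" "cross3 n u = p"
proof -
  have L: "p \<bullet> cross3 n u = n \<bullet> cross3 u p"
    using cross_triple[of u p n] cross_triple[of n u p] by (simp add: inner_commute)
  have up: "(norm (cross3 u p))\<^sup>2 = 1"
    using norm_cross[of u p] assms by (simp add: inner_commute)
  have pa: "cross3 n (cross3 u p) = 0"
    using Lagrange[of n u p] assms by simp
  have "(n \<bullet> cross3 u p)\<^sup>2 = 1"
    using norm_cross[of n "cross3 u p"] pa up assms(3) by simp
  then have one: "n \<bullet> cross3 u p = 1"
    using assms(7) L by (simp add: power2_eq_1_iff)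
  have "(n - cross3 u p) \<bullet> (n - cross3 u p) = 0"
    using one up assms(3) by (simp add: inner_diff inner_commute norm_eq_1 power2_norm_eq_inner)
  then show *: "n = cross3 u p" by simp
  show "cross3 n u = p"
    using Lagrange[of u u p] assms * cross_skew[of "cross3 u p" u] by (simp add: norm_eq_1 inner_commute)
qed

text \<open>The remainder \<open>y\<close> is orthogonal to \<open>n\<close> and \<open>u\<close>,
  so Lagrange's identity makes it parallel to \<open>cross3 n u = p\<close>; being orthogonal to
  \<open>p\<close> as well, it vanishes.\<close>

lemma orthonormal_frame_expansion:
  fixes p n u x :: "real^3"
  assumes "p \<bullet> p = 1" "u \<bullet> u = 1" "n \<bullet> n = 1" "p \<bullet> u = 0" "n \<bullet> p = 0" "n \<bullet> u = 0"
    "cross3 n u = p"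
  shows "x = (x \<bullet> p) *\<^sub>R p + (x \<bullet> n) *\<^sub>R n + (x \<bullet> u) *\<^sub>R u"
proof -
  define y where "y = x - ((x \<bullet> p) *\<^sub>R p + (x \<bullet> n) *\<^sub>R n + (x \<bullet> u) *\<^sub>R u)"
  have "u \<bullet> p = 0" "p \<bullet> n = 0" "u \<bullet> n = 0"
    using assms by (simp_all add: inner_commute)
  then have o: "y \<bullet> p = 0" "y \<bullet> n = 0" "y \<bullet> u = 0"
    using assms by (simp_all add: y_def inner_diff_left inner_add_left)
  have "cross3 y p = 0"
    using Lagrange[of y n u] o assms(7) by simp
  then have "y = 0 \<or> p = 0"
    using o(1) norm_and_cross_eq_0[of y p] by simp
  then have "y = 0" using assms(1) by auto
  then show ?thesis by (simp add: y_def)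
qed

lemma has_real_derivative_inner:
  fixes f g :: "real \<Rightarrow> 'a::real_inner"
  assumes "(f has_vector_derivative f') (at t)" "(g has_vector_derivative g') (at t)"
  shows "((\<lambda>x. f x \<bullet> g x) has_real_derivative (f t \<bullet> g' + f' \<bullet> g t)) (at t)"
  using bounded_bilinear.has_vector_derivative[OF bounded_bilinear_inner assms]
  by (simp add: has_real_derivative_iff_has_vector_derivative)

lemma inner_constant_derivative:
  fixes f g :: "real \<Rightarrow> 'a::real_inner"
  assumes "(f has_vector_derivative f') (at t)" "(g has_vector_derivative g') (at t)"
    "\<And>x. f x \<bullet> g x = c"
  shows "f t \<bullet> g' + f' \<bullet> g t = 0"
  using has_real_derivative_inner[OF assms(1,2)] assms(3) DERIV_unique[OF _ DERIV_const]
  by simp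

text \<open>\<open>outward_unit_normal\<close> says nothing about how \<open>\<nu>\<close> varies
  with \<open>t\<close>. Its differentiability comes from the orientation, which forces
  \<open>\<nu> = cross3 T \<gamma>\<close>; differentiating the orthonormality relations then gives
  the equations of the Darboux frame, with \<open>k\<close> as the only curvature coefficient. The
  curvature in space is the length of \<open>- \<gamma> - k \<nu>\<close>.\<close>

lemma spherical_frame_of_curve:
  assumes "smooth_simple_closed_spherical_curve \<gamma>" "outward_unit_normal \<gamma> \<Omega> \<nu>"
    "induces_orientation \<nu> \<gamma>"
  shows "spherical_frame \<gamma> \<nu> (unit_tangent \<gamma>) (speed \<gamma>) (geodesic_curvature \<gamma> \<nu>)"
    and "space_curvature \<gamma> t = sqrt (1 + (geodesic_curvature \<gamma> \<nu> t)\<^sup>2)"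
proof -
  define T v k where "T = unit_tangent \<gamma>" and "v = speed \<gamma>" and "k = geodesic_curvature \<gamma> \<nu>"
  from assms(1) obtain D where D0: "D 0 = \<gamma>"
    and D: "\<And>n t. (D n has_vector_derivative D (Suc n) t) (at t)"
    unfolding smooth_simple_closed_spherical_curve_def smooth_curve_def by blast
  have \<gamma>': "(\<gamma> has_vector_derivative D 1 t) (at t)" for t using D[of 0 t] D0 by simp
  have vel: "velocity \<gamma> t = D 1 t" for t
    unfolding velocity_def using vector_derivative_at[OF \<gamma>'] .
  have nz: "D 1 t \<noteq> 0" for t
    using assms(1) vel unfolding smooth_simple_closed_spherical_curve_def by metis
  have v: "v t = norm (D 1 t)" and T: "T t = D 1 t /\<^sub>R norm (D 1 t)" for t
    by (simp_all add: v_def T_def speed_def unit_tangent_def vel)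
  have v_pos: "v t > 0" for t using nz v by simp
  have vT: "D 1 t = v t *\<^sub>R T t" for t using nz by (simp add: v T)
  \<comment> \<open>\<open>U\<close> is the derivative of the unit tangent in terms of the first two
    derivatives of the curve. Continuity of \<open>k\<close> will be read off from that of
    \<open>U\<close>.\<close>
  define U where "U t = D 2 t /\<^sub>R norm (D 1 t) - ((D 1 t \<bullet> D 2 t) / norm (D 1 t) ^ 3) *\<^sub>R D 1 t" for t
  have T': "(T has_vector_derivative U t) (at t)" for t
    using has_vector_derivative_normalize[OF D[of 1 t] nz] unfolding U_def T[abs_def]
    by (simp add: numeral_2_eq_2)
  have contD: "continuous_on UNIV (D n)" for n
    using D by (meson continuous_at_imp_continuous_on has_vector_derivative_continuous)
  have contv: "continuous_on UNIV v"
    unfolding v[abs_def] by (intro continuous_intros contD)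
  have contU: "continuous_on UNIV U"
    unfolding U_def[abs_def] using nz by (intro continuous_intros contD) auto
  have g1: "norm (\<gamma> t) = 1" for t
    using assms(1) unfolding smooth_simple_closed_spherical_curve_def by simp
  have gg: "\<gamma> t \<bullet> \<gamma> t = 1" for t using g1 by (simp add: norm_eq_1)
  have T1: "norm (T t) = 1" for t using nz by (simp add: T)
  have TT: "T t \<bullet> T t = 1" for t using T1 by (simp add: norm_eq_1)
  have gT: "\<gamma> t \<bullet> T t = 0" for t
    using inner_constant_derivative[OF \<gamma>'[of t] \<gamma>'[of t] gg] v_pos[of t]
    by (simp add: vT inner_commute del: One_nat_def)
  have n1: "norm (\<nu> t) = 1" and ng: "\<nu> t \<bullet> \<gamma> t = 0" and "\<nu> t \<bullet> velocity \<gamma> t = 0" for t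
    using assms(2) unfolding outward_unit_normal_def by auto
  then have nT: "\<nu> t \<bullet> T t = 0" for t by (simp add: T vel del: One_nat_def)
  have nn: "\<nu> t \<bullet> \<nu> t = 1" for t using n1 by (simp add: norm_eq_1)
  have pos: "\<gamma> t \<bullet> cross3 (\<nu> t) (T t) > 0" for t
    using assms(3) unfolding induces_orientation_def T_def by blast
  have n_eq: "\<nu> t = cross3 (T t) (\<gamma> t)" and cr: "cross3 (\<nu> t) (T t) = \<gamma> t" for t
    using cross3_perp_eq[OF g1 T1 n1 gT ng nT pos] by auto
  have Ug: "U t \<bullet> \<gamma> t = - v t" for t
    using inner_constant_derivative[OF T'[of t] \<gamma>'[of t], of 0] gT TT
    by (simp add: vT inner_commute del: One_nat_def)
  have UT: "U t \<bullet> T t = 0" for t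
    using inner_constant_derivative[OF T'[of t] T'[of t] TT] by (simp add: inner_commute)
  have Uexp: "U t = - v t *\<^sub>R \<gamma> t + (U t \<bullet> \<nu> t) *\<^sub>R \<nu> t" for t
    using orthonormal_frame_expansion[OF gg[of t] TT nn gT ng nT cr, of "U t"] by (simp add: Ug UT)
  have ncg: "cross3 (\<nu> t) (\<gamma> t) = - T t" for t
    using Lagrange[of "\<gamma> t" "T t" "\<gamma> t"] gg gT cross_skew[of "\<nu> t" "\<gamma> t"]
    by (simp add: n_eq inner_commute)
  have "cross3 (U t) (\<gamma> t) = - (U t \<bullet> \<nu> t) *\<^sub>R T t" for t
    by (subst Uexp) (simp only: cross_add_left cross_mult_left ncg cross_refl, simp)
  moreover have "(\<nu> has_vector_derivative cross3 (U t) (\<gamma> t)) (at t)" for t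
    using has_vector_derivative_cross3[OF T'[of t] \<gamma>'[of t]] n_eq[abs_def]
    by (simp add: vT cross_mult_right del: One_nat_def)
  ultimately have nu': "(\<nu> has_vector_derivative - (U t \<bullet> \<nu> t) *\<^sub>R T t) (at t)" for t by metis
  have velnu: "velocity \<nu> t = - (U t \<bullet> \<nu> t) *\<^sub>R T t" for t
    unfolding velocity_def using vector_derivative_at[OF nu'] .
  have k: "k t = - (U t \<bullet> \<nu> t) / v t" for t
    using TT gT by (simp add: k_def geodesic_curvature_def covariant_derivative_def Let_def velnu
        inner_diff_left inner_commute divide_inverse mult.commute flip: T_def v_def)
  have vk: "U t \<bullet> \<nu> t = - (v t * k t)" for t using v_pos[of t] by (simp add: k)
  have contk: "continuous_on UNIV k"
  proof -
    have "continuous_on UNIV \<nu>"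
      using nu' by (meson continuous_at_imp_continuous_on has_vector_derivative_continuous)
    then show ?thesis unfolding k[abs_def] using v_pos
      by (intro continuous_intros contU contv) (auto simp: less_imp_neq[symmetric])
  qed
  have U: "U t = v t *\<^sub>R (- \<gamma> t - k t *\<^sub>R \<nu> t)" for t
    by (subst Uexp) (simp add: vk algebra_simps)
  have p1: "\<gamma> (t + 1) = \<gamma> t" for t
    using assms(1) unfolding smooth_simple_closed_spherical_curve_def by blast
  have pD: "D 1 (t + 1) = D 1 t" for t
    using periodic_vector_derivative[OF p1 \<gamma>' \<gamma>'] .
  have p2: "v (t + 1) = v t" and p3: "T (t + 1) = T t" for t
    by (simp_all add: v T pD del: One_nat_def)
  have p4: "\<nu> (t + 1) = \<nu> t" for t by (simp add: n_eq p1 p3)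
  have "velocity \<nu> (t + 1) = velocity \<nu> t" for t
    unfolding velnu using periodic_vector_derivative[OF p4 nu' nu'] .
  then have p5: "k (t + 1) = k t" for t
    using p1 p2 p3 by (simp add: k_def geodesic_curvature_def covariant_derivative_def Let_def
        flip: T_def v_def)
  have inj: "s - t \<in> \<int>" if "\<gamma> s = \<gamma> t" for s t
  proof -
    have fr: "\<gamma> (frac r) = \<gamma> r" for r
      using periodic_add_int[of \<gamma> r "- \<lfloor>r\<rfloor>"] p1 by (simp add: frac_def)
    have "inj_on \<gamma> {0..<1}"
      using assms(1) unfolding smooth_simple_closed_spherical_curve_def by blast
    then have "frac s = frac t"
      by (rule inj_onD) (use that fr frac_lt_1 in auto)
    then have "s - t = of_int (\<lfloor>s\<rfloor> - \<lfloor>t\<rfloor>)" by (simp add: frac_def)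
    then show ?thesis by (metis Ints_of_int)
  qed
  show "spherical_frame \<gamma> \<nu> (unit_tangent \<gamma>) (speed \<gamma>) (geodesic_curvature \<gamma> \<nu>)"
    unfolding T_def[symmetric] v_def[symmetric] k_def[symmetric]
  proof
    show "(\<gamma> has_vector_derivative v t *\<^sub>R T t) (at t)" for t using \<gamma>' by (simp only: vT)
    show "(T has_vector_derivative v t *\<^sub>R (- \<gamma> t - k t *\<^sub>R \<nu> t)) (at t)" for t
      using T' by (simp only: U)
    show "(\<nu> has_vector_derivative (v t * k t) *\<^sub>R T t) (at t)" for t
      using nu'[of t] by (simp add: vk)
  qed (use v_pos contv contk gg nn TT ng gT nT cr p1 p2 p3 p4 p5 inj in
      \<open>auto simp: inner_commute\<close>)
  have "velocity T t = U t" for t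
    unfolding velocity_def using vector_derivative_at[OF T'] .
  then have "space_curvature \<gamma> t = norm (- \<gamma> t - k t *\<^sub>R \<nu> t)"
    using v_pos[of t] by (simp add: space_curvature_def U flip: T_def v_def)
  also have "\<dots> = sqrt (1 + (k t)\<^sup>2)"
    using gg[of t] nn[of t] ng[of t]
    by (simp add: norm_eq_sqrt_inner inner_diff power2_eq_square inner_commute)
  finally show "space_curvature \<gamma> t = sqrt (1 + (geodesic_curvature \<gamma> \<nu> t)\<^sup>2)"
    by (simp add: k_def)
qed

section \<open>Angles with circles through a point\<close>

text \<open>The values of \<open>h\<close> are integer multiples of \<open>2 pi \<i>\<close>, so two
  different ones are at least \<open>2 pi\<close> apart. It serves twice: for the potential as a
  function of \<open>z\<close>, and for the increments of a logarithm under periods.\<close>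

lemma constant_of_exp_eq_1:
  fixes h :: "'a::topological_space \<Rightarrow> complex"
  assumes "connected S" "continuous_on S h" "\<And>x. x \<in> S \<Longrightarrow> exp (h x) = 1"
  shows "h constant_on S"
proof (rule continuous_discrete_range_constant[OF assms(1,2)])
  fix x assume x: "x \<in> S"
  have "2 * pi \<le> norm (h y - h x)" if y: "y \<in> S" "h y \<noteq> h x" for y
  proof -
    obtain m n :: int where "h x = complex_of_real (real_of_int (2 * m) * pi) * \<i>"
      "h y = complex_of_real (real_of_int (2 * n) * pi) * \<i>"
      using assms(3) x y(1) unfolding exp_eq_1 by (metis complex_eq add_0 mult.commute of_real_0)
    then have "h y - h x = complex_of_real (2 * pi * real_of_int (n - m)) * \<i>" and "n \<noteq> m"
      using y(2) by (auto simp: algebra_simps)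
    then have "norm (h y - h x) = 2 * pi * \<bar>real_of_int (n - m)\<bar>" "1 \<le> \<bar>n - m\<bar>"
      by (simp_all only: norm_mult norm_of_real) (auto simp: abs_mult)
    moreover have "1 \<le> \<bar>real_of_int (n - m)\<bar>"
      using \<open>1 \<le> \<bar>n - m\<bar>\<close> by linarith
    ultimately show ?thesis using mult_left_mono[of 1 _ "2 * pi"] by simp
  qed
  then show "\<exists>e>0. \<forall>y. y \<in> S \<and> h y \<noteq> h x \<longrightarrow> e \<le> norm (h y - h x)"
    by (intro exI[of _ "2 * pi"]) auto
qed

text \<open>Continuity keeps \<open>Im (h x - h t)\<close> between -pi and pi for \<open>x\<close>
  near \<open>t\<close>, where the principal logarithm inverts the exponential; so \<open>h\<close>
  is locally the logarithm of a differentiable function.\<close>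

lemma has_vector_derivative_continuous_log:
  fixes h :: "real \<Rightarrow> complex"
  assumes "isCont h t" "((\<lambda>x. exp (h x)) has_vector_derivative c * exp (h t)) (at t)"
  shows "(h has_vector_derivative c) (at t)"
proof -
  have 1: "((\<lambda>x. exp (h x - h t)) has_vector_derivative c) (at t)"
    using has_vector_derivative_mult_right[OF assms(2), of "exp (- h t)"]
    by (simp add: exp_diff exp_minus field_simps)
  have 2: "((\<lambda>x. Ln (exp (h x - h t)) + h t) has_vector_derivative c) (at t)"
  proof -
    have "(Ln has_field_derivative 1) (at (exp (h t - h t)))"
      using has_field_derivative_Ln[of 1] by simp
    from field_vector_diff_chain_at[OF 1 this] show ?thesis
      by (auto simp: o_def intro!: derivative_eq_intros)
  qed
  have "((\<lambda>x. Im (h x - h t)) \<longlongrightarrow> 0) (at t)"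
    using assms(1) unfolding isCont_def by (auto intro!: tendsto_eq_intros)
  then have "\<forall>\<^sub>F x in at t. \<bar>Im (h x - h t)\<bar> < pi"
    using order_tendstoD(2)[OF tendsto_rabs_zero, of _ "at t" pi] by simp
  then have "\<forall>\<^sub>F x in at t. Ln (exp (h x - h t)) + h t = h x"
    by eventually_elim (subst Ln_exp, auto simp: abs_less_iff)
  then show ?thesis
    using 2 unfolding has_vector_derivative_def
    by (elim has_derivative_transform_eventually) simp_all
qed

text \<open>Both endpoints of the chord move. Continuity of \<open>f'\<close> at \<open>a\<close>
  and the mean value inequality for \<open>f x - x f' a\<close> make the estimate uniform in them.
  This carries the secant angle across the diagonal.\<close>

lemma tendsto_difference_quotient:
  fixes f :: "real \<Rightarrow> 'a::real_normed_vector"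
  assumes "\<And>t. (f has_vector_derivative f' t) (at t)" "isCont f' a"
  shows "((\<lambda>(s, t). if s = t then f' s else (f t - f s) /\<^sub>R (t - s)) \<longlongrightarrow> f' a) (nhds (a, a))"
proof (rule tendstoI)
  fix e :: real assume "e > 0"
  then obtain d where d: "d > 0" "\<And>x. dist x a < d \<Longrightarrow> dist (f' x) (f' a) < e / 2"
    using assms(2) unfolding continuous_at_eps_delta by (meson half_gt_zero)
  have *: "norm (f t - f s - (t - s) *\<^sub>R f' a) \<le> e / 2 * \<bar>t - s\<bar>"
    if "s \<in> ball a d" "t \<in> ball a d" for s t
  proof -
    have "norm ((f t - t *\<^sub>R f' a) - (f s - s *\<^sub>R f' a)) \<le> e / 2 * norm (t - s)"
    proof (rule differentiable_bound[where S = "ball a d" and f' = "\<lambda>x h. h *\<^sub>R (f' x - f' a)"])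
      fix x assume x: "x \<in> ball a d"
      have "((\<lambda>x. f x - x *\<^sub>R f' a) has_vector_derivative f' x - f' a) (at x within ball a d)"
        by (auto intro!: derivative_eq_intros has_vector_derivative_at_within[OF assms(1)])
      then show "((\<lambda>x. f x - x *\<^sub>R f' a) has_derivative (\<lambda>h. h *\<^sub>R (f' x - f' a))) (at x within ball a d)"
        unfolding has_vector_derivative_def .
      have "norm (f' x - f' a) \<le> e / 2"
        using d(2)[of x] x by (simp add: dist_norm norm_minus_commute less_imp_le)
      then show "onorm (\<lambda>h. h *\<^sub>R (f' x - f' a)) \<le> e / 2"
        by (subst onorm_scaleR_left) (auto simp: onorm_id)
    qed (use that in auto)
    then show ?thesis by (simp add: algebra_simps)
  qed
  have "dist (if s = t then f' s else (f t - f s) /\<^sub>R (t - s)) (f' a) < e"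
    if "s \<in> ball a d" "t \<in> ball a d" for s t
  proof (cases "s = t")
    case True
    then show ?thesis using d(2)[of s] that \<open>e > 0\<close> by (simp add: dist_commute)
  next
    case False
    have "(f t - f s) /\<^sub>R (t - s) - f' a = (f t - f s - (t - s) *\<^sub>R f' a) /\<^sub>R (t - s)"
      using False by (simp add: scaleR_diff_right)
    then have "norm ((f t - f s) /\<^sub>R (t - s) - f' a) = norm (f t - f s - (t - s) *\<^sub>R f' a) / \<bar>t - s\<bar>"
      by (simp add: divide_inverse mult.commute)
    then have "norm ((f t - f s) /\<^sub>R (t - s) - f' a) \<le> e / 2"
      using *[OF that] False by (simp add: divide_le_eq)
    then show ?thesis using False \<open>e > 0\<close> by (simp add: dist_norm)
  qed
  moreover have "\<forall>\<^sub>F p in nhds (a, a). p \<in> ball a d \<times> ball a d"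
    using d(1) by (intro eventually_nhds_in_open open_Times) auto
  ultimately show "\<forall>\<^sub>F p in nhds (a, a). dist (case p of (s, t) \<Rightarrow>
      if s = t then f' s else (f t - f s) /\<^sub>R (t - s)) (f' a) < e"
    by (auto elim!: eventually_mono)
qed

lemma unit_vectors_eq:
  fixes x y :: "'a::real_inner"
  assumes "x \<bullet> x = 1" "y \<bullet> y = 1" "x \<bullet> y = 1"
  shows "x = y"
proof -
  have "(x - y) \<bullet> (x - y) = 0" using assms by (simp add: inner_diff inner_commute)
  then show ?thesis by simp
qed

context spherical_frame
begin

section \<open>Frame identities and the kernel off the curve\<close>

lemma cross_frame: "cross3 (\<gamma> t) (T t) = - \<nu> t" "cross3 (\<gamma> t) (\<nu> t) = T t"
proof -
  have "cross3 (T t) (\<gamma> t) = \<nu> t" "cross3 (\<nu> t) (\<gamma> t) = - T t"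
    using Lagrange[of "T t" "\<nu> t" "T t"] Lagrange[of "\<nu> t" "\<nu> t" "T t"] orthonormal[of t]
    by (simp_all add: inner_commute positive)
  then show "cross3 (\<gamma> t) (T t) = - \<nu> t" "cross3 (\<gamma> t) (\<nu> t) = T t"
    by (subst cross_skew, simp)+
qed

lemma frame_expansion: "x = (x \<bullet> \<gamma> t) *\<^sub>R \<gamma> t + (x \<bullet> \<nu> t) *\<^sub>R \<nu> t + (x \<bullet> T t) *\<^sub>R T t"
  by (rule orthonormal_frame_expansion)
    (simp_all add: orthonormal positive inner_commute[of "\<nu> t" "\<gamma> t"])

lemma inner_frame:
  "x \<bullet> y = (x \<bullet> \<gamma> t) * (y \<bullet> \<gamma> t) + (x \<bullet> \<nu> t) * (y \<bullet> \<nu> t) + (x \<bullet> T t) * (y \<bullet> T t)"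
proof -
  have "x \<bullet> y = ((x \<bullet> \<gamma> t) *\<^sub>R \<gamma> t + (x \<bullet> \<nu> t) *\<^sub>R \<nu> t + (x \<bullet> T t) *\<^sub>R T t) \<bullet> y"
    by (rule arg_cong[where f = "\<lambda>x. x \<bullet> y", OF frame_expansion])
  also have "\<dots> = (x \<bullet> \<gamma> t) * (\<gamma> t \<bullet> y) + (x \<bullet> \<nu> t) * (\<nu> t \<bullet> y) + (x \<bullet> T t) * (T t \<bullet> y)"
    by (simp only: inner_add_left inner_scaleR_left)
  finally show ?thesis by (simp add: inner_commute)
qed

lemma continuous_frame: "continuous_on S \<gamma>" "continuous_on S \<nu>" "continuous_on S T"
  "continuous_on S v" "continuous_on S k"
proof -
  have c: "continuous_on S f" if "\<And>t. (f has_vector_derivative f' t) (at t)"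
    for f f' :: "real \<Rightarrow> real^3"
    using that by (meson continuous_at_imp_continuous_on has_vector_derivative_continuous)
  show "continuous_on S \<gamma>" "continuous_on S \<nu>" "continuous_on S T"
    by (rule c[OF deriv_curve], rule c[OF deriv_normal], rule c[OF deriv_tangent])
  show "continuous_on S v" "continuous_on S k"
    using continuous_speed continuous_curvature by (auto intro: continuous_on_subset)
qed

lemma isCont_frame: "isCont \<gamma> t" "isCont \<nu> t" "isCont T t" "isCont v t" "isCont k t"
  using continuous_frame[of UNIV] by (simp_all add: continuous_on_eq_continuous_at)

lemma derivs_inner:
  "((\<lambda>t. z \<bullet> \<gamma> t) has_real_derivative v t * (z \<bullet> T t)) (at t)"
  "((\<lambda>t. z \<bullet> \<nu> t) has_real_derivative v t * k t * (z \<bullet> T t)) (at t)"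
  "((\<lambda>t. z \<bullet> T t) has_real_derivative v t * (- (z \<bullet> \<gamma> t) - k t * (z \<bullet> \<nu> t))) (at t)"
  using has_real_derivative_inner[OF has_vector_derivative_const deriv_curve]
    has_real_derivative_inner[OF has_vector_derivative_const deriv_normal]
    has_real_derivative_inner[OF has_vector_derivative_const deriv_tangent]
  by (simp_all add: inner_diff_right)

lemma inner_eq_1_iff: "z \<bullet> z = 1 \<Longrightarrow> z \<bullet> \<gamma> t = 1 \<longleftrightarrow> z = \<gamma> t"
  using unit_vectors_eq orthonormal(1) by metis

text \<open>The normal derivative of \<open>x \<mapsto> - ln (1 - z \<bullet> x)\<close>, times the speed. At \<open>z = \<gamma> t\<close> its value is 0 because
  \<open>x / 0 = 0\<close>.\<close>

definition kernel :: "real^3 \<Rightarrow> real \<Rightarrow> real" where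
  "kernel z t = v t * (z \<bullet> \<nu> t) / (1 - z \<bullet> \<gamma> t)"

text \<open>The components along \<open>T t\<close> and \<open>\<nu> t\<close> of the unit tangent at \<open>\<gamma> t\<close> of the circle through \<open>z\<close> and \<open>\<gamma> t\<close>
  that leaves \<open>z\<close> in the direction \<open>u\<close>: it is minus the image of \<open>u\<close> under the reflection that
  exchanges \<open>z\<close> and \<open>\<gamma> t\<close>.\<close>

definition circle_angle :: "real^3 \<Rightarrow> real^3 \<Rightarrow> real \<Rightarrow> complex" where
  "circle_angle z u t = Complex
     (- (u \<bullet> T t) - (u \<bullet> \<gamma> t) * (z \<bullet> T t) / (1 - z \<bullet> \<gamma> t))
     (- (u \<bullet> \<nu> t) - (u \<bullet> \<gamma> t) * (z \<bullet> \<nu> t) / (1 - z \<bullet> \<gamma> t))"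

text \<open>The vector encoded by \<open>circle_angle\<close> has length 1, so it can only rotate.
  The rate is algebra from the frame equations, \<open>r (1 - a) = 1\<close>, and the relations
  \<open>u \<bullet> z = 0\<close> and \<open>z \<bullet> z = 1\<close> written in the frame at
  \<open>t\<close>.\<close>

lemma has_vector_derivative_circle_angle:
  assumes "z \<bullet> z = 1" "u \<bullet> z = 0" "z \<noteq> \<gamma> t"
  shows "(circle_angle z u has_vector_derivative
    (\<i> * (v t * k t + kernel z t)) * circle_angle z u t) (at t)"
proof -
  define \<alpha> \<beta> \<delta> a b c where "\<alpha> = u \<bullet> \<gamma> t" and "\<beta> = u \<bullet> \<nu> t" and "\<delta> = u \<bullet> T t"
    and "a = z \<bullet> \<gamma> t" and "b = z \<bullet> \<nu> t" and "c = z \<bullet> T t"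
  note d = \<alpha>_def \<beta>_def \<delta>_def a_def b_def c_def
  have a1: "1 - a \<noteq> 0" using inner_eq_1_iff[OF assms(1)] assms(3) by (simp add: a_def)
  define r where "r = 1 / (1 - a)"
  have r: "r * (1 - a) = 1" using a1 by (simp add: r_def)
  have orth: "\<alpha> * a + \<beta> * b + \<delta> * c = 0" "a * a + b * b + c * c = 1"
    using assms(1,2) inner_frame[of u z t] inner_frame[of z z t] by (simp_all add: d)
  have dr: "((\<lambda>t. 1 / (1 - z \<bullet> \<gamma> t)) has_real_derivative v t * c * r * r) (at t)"
    using a1 by (auto intro!: derivative_eq_intros derivs_inner simp: d r_def)
  have re: "((\<lambda>t. - (u \<bullet> T t) - (u \<bullet> \<gamma> t) * (z \<bullet> T t) * (1 / (1 - z \<bullet> \<gamma> t))) has_real_derivative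
      - (v t * k t + v t * b * r) * (- \<beta> - \<alpha> * b * r)) (at t)"
  proof -
    have "- (v t * (- \<alpha> - k t * \<beta>)) -
       ((v t * \<delta> * c + v t * (- a - k t * b) * \<alpha>) * r + v t * c * r * r * (\<alpha> * c)) =
       - (v t * k t + v t * b * r) * (- \<beta> - \<alpha> * b * r)"
      using r orth by algebra
    with DERIV_diff[OF DERIV_minus[OF derivs_inner(3)[of u]]
        DERIV_mult[OF DERIV_mult[OF derivs_inner(1)[of u] derivs_inner(3)[of z]] dr]]
    show ?thesis
      by (auto elim!: DERIV_cong simp only: d[symmetric] r_def[symmetric])
  qed
  have im: "((\<lambda>t. - (u \<bullet> \<nu> t) - (u \<bullet> \<gamma> t) * (z \<bullet> \<nu> t) * (1 / (1 - z \<bullet> \<gamma> t))) has_real_derivative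
      (v t * k t + v t * b * r) * (- \<delta> - \<alpha> * c * r)) (at t)"
  proof -
    have "- (v t * k t * \<delta>) -
       ((v t * \<delta> * b + v t * k t * c * \<alpha>) * r + v t * c * r * r * (\<alpha> * b)) =
       (v t * k t + v t * b * r) * (- \<delta> - \<alpha> * c * r)"
      by (simp add: algebra_simps)
    with DERIV_diff[OF DERIV_minus[OF derivs_inner(2)[of u]]
        DERIV_mult[OF DERIV_mult[OF derivs_inner(1)[of u] derivs_inner(2)[of z]] dr]]
    show ?thesis
      by (auto elim!: DERIV_cong simp only: d[symmetric] r_def[symmetric])
  qed
  have "(circle_angle z u has_vector_derivative
     Complex (- (v t * k t + v t * b * r) * (- \<beta> - \<alpha> * b * r))
       ((v t * k t + v t * b * r) * (- \<delta> - \<alpha> * c * r))) (at t)"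
    using re im
    by (simp add: has_vector_derivative_complex_iff circle_angle_def[abs_def])
  moreover have *: "kernel z t = v t * b * r"
    "circle_angle z u t = Complex (- \<delta> - \<alpha> * c * r) (- \<beta> - \<alpha> * b * r)"
    by (simp_all add: circle_angle_def kernel_def d r_def)
  ultimately show ?thesis
    by (elim has_vector_derivative_eq_rhs) (simp only: *, simp add: complex_eq_iff algebra_simps)
qed

text \<open>The reflection sends the unit vector \<open>u\<close>, orthogonal to \<open>z\<close>,
  to a unit vector orthogonal to \<open>\<gamma> t\<close>; its components along \<open>T t\<close>
  and \<open>\<nu> t\<close> therefore have square sum 1.\<close>

lemma circle_angle_nonzero:
  assumes "z \<bullet> z = 1" "u \<bullet> u = 1" "u \<bullet> z = 0" "z \<noteq> \<gamma> t"
  shows "circle_angle z u t \<noteq> 0"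
proof
  assume 0: "circle_angle z u t = 0"
  define \<alpha> \<beta> \<delta> a b c where "\<alpha> = u \<bullet> \<gamma> t" and "\<beta> = u \<bullet> \<nu> t" and "\<delta> = u \<bullet> T t"
    and "a = z \<bullet> \<gamma> t" and "b = z \<bullet> \<nu> t" and "c = z \<bullet> T t"
  note d = \<alpha>_def \<beta>_def \<delta>_def a_def b_def c_def
  have a1: "1 - a \<noteq> 0" using inner_eq_1_iff[OF assms(1)] assms(4) by (simp add: a_def)
  define r where "r = 1 / (1 - a)"
  have r: "r * (1 - a) = 1" using a1 by (simp add: r_def)
  have orth: "\<alpha> * a + \<beta> * b + \<delta> * c = 0" "a * a + b * b + c * c = 1" "\<alpha> * \<alpha> + \<beta> * \<beta> + \<delta> * \<delta> = 1"
    using assms(1,2,3) inner_frame[of u z t] inner_frame[of z z t] inner_frame[of u u t]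
    by (simp_all add: d)
  have "- \<delta> - \<alpha> * c * r = 0" "- \<beta> - \<alpha> * b * r = 0"
    using 0 by (simp_all add: circle_angle_def complex_eq_iff d r_def)
  moreover have "(- \<delta> - \<alpha> * c * r)\<^sup>2 + (- \<beta> - \<alpha> * b * r)\<^sup>2 = 1"
    using r orth by algebra
  ultimately show False by simp
qed

lemma continuous_kernel:
  "continuous_on ({z. z \<bullet> z = 1 \<and> z \<notin> range \<gamma>} \<times> S) (\<lambda>(z, t). kernel z t)"
  unfolding kernel_def case_prod_beta
  by (intro continuous_intros continuous_on_compose2[OF continuous_frame(1)[of UNIV]]
      continuous_on_compose2[OF continuous_frame(2)[of UNIV]]
      continuous_on_compose2[OF continuous_frame(4)[of UNIV]])
    (use inner_eq_1_iff in \<open>auto simp: mem_Times_iff\<close>)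

lemma continuous_kernel_snd:
  assumes "z \<bullet> z = 1" "z \<notin> range \<gamma>"
  shows "continuous_on S (kernel z)"
proof -
  have "continuous_on S (\<lambda>t. (\<lambda>(z, t). kernel z t) (z, t))"
    by (rule continuous_on_compose2[OF continuous_kernel[of S]])
      (intro continuous_intros, use assms in auto)
  then show ?thesis by simp
qed

lemma kernel_periodic: "kernel z (t + 1) = kernel z t"
  by (simp add: kernel_def periodic)

text \<open>Any unit vector \<open>u\<close> orthogonal to \<open>z\<close> serves as the fixed
  direction. Undoing the accumulated rotation makes \<open>circle_angle z u\<close> constant, and
  since that angle has period 1, the rotation over a period is a whole number of turns.\<close>

lemma total_angle_off_curve:
  assumes z: "z \<bullet> z = 1" "z \<notin> range \<gamma>"
  shows "exp (\<i> * integral {0..1} (\<lambda>t. v t * k t + kernel z t)) = 1"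
proof -
  obtain w where w: "w \<noteq> 0" "orthogonal z w"
    using orthogonal_to_vector_exists[of z] by auto
  define u where "u = w /\<^sub>R norm w"
  have u: "u \<bullet> u = 1" "u \<bullet> z = 0"
    using w by (simp_all add: u_def orthogonal_def inner_commute dot_square_norm power2_eq_square)
  define f where "f t = v t * k t + kernel z t" for t
  define I where "I t = integral {0..t} f" for t
  have cf: "continuous_on {0..1} f"
    unfolding f_def by (intro continuous_intros continuous_frame continuous_kernel_snd z)
  have I': "(I has_vector_derivative f t) (at t within {0..1})" if "t \<in> {0..1}" for t
    unfolding I_def using integral_has_vector_derivative[OF cf that] .
  define G where "G t = circle_angle z u t * exp (- (\<i> * I t))" for t
  have "(G has_vector_derivative 0) (at t within {0..1})" if t: "t \<in> {0..1}" for t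
  proof -
    have "((\<lambda>t. exp (- (\<i> * I t))) has_vector_derivative - (\<i> * f t) * exp (- (\<i> * I t)))
        (at t within {0..1})"
      using field_vector_diff_chain_within[OF has_vector_derivative_minus[OF
          has_vector_derivative_mult_right[OF has_vector_derivative_of_real[OF I'[OF t, folded
            has_real_derivative_iff_has_vector_derivative]], of \<i>]]
          DERIV_subset[OF DERIV_exp]]
      by (simp add: o_def)
    from has_vector_derivative_mult[OF has_vector_derivative_at_within[OF
          has_vector_derivative_circle_angle[OF z(1) u(2)]] this]
    show ?thesis using z(2) unfolding G_def f_def by (auto simp: algebra_simps)
  qed
  then have "G 1 = G 0"
    using has_vector_derivative_zero_constant[of "{0..1}" G] by (metis atLeastAtMost_iff
        convex_closed_interval atLeastAtMost_iff cbox_interval convex_box(1) order_refl zero_le_one)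
  moreover have "circle_angle z u 1 = circle_angle z u 0"
    using periodic[of 0] by (simp add: circle_angle_def)
  moreover have "circle_angle z u 0 \<noteq> 0"
    using circle_angle_nonzero[OF z(1) u] z(2) by blast
  ultimately have "exp (- (\<i> * I 1)) = 1"
    by (simp add: G_def I_def)
  then show ?thesis
    unfolding I_def f_def by (simp add: exp_minus)
qed

text \<open>The circle that touches the curve at \<open>\<gamma> s\<close> and passes through
  \<open>\<gamma> t\<close> plays the part of Hopf's secant. The value 1 at integer differences is
  the limit: as \<open>t\<close> tends to \<open>s\<close>, the circle becomes tangent to the curve
  at \<open>\<gamma> t\<close> too.\<close>

definition secant_angle :: "real \<Rightarrow> real \<Rightarrow> complex" where
  "secant_angle s t = (if s - t \<in> \<int> then 1 else circle_angle (\<gamma> s) (T s) t)"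

lemma curve_neq: "s - t \<notin> \<int> \<Longrightarrow> \<gamma> s \<noteq> \<gamma> t"
  using simple by blast

lemma secant_angle_nonzero: "secant_angle s t \<noteq> 0"
  using circle_angle_nonzero[of "\<gamma> s" "T s" t] orthonormal[of s] curve_neq[of s t]
  by (simp add: secant_angle_def inner_commute)

lemma Ints_shift_iff:
  fixes s t :: real
  shows "s - (t + 1) \<in> \<int> \<longleftrightarrow> s - t \<in> \<int>" "s + 1 - t \<in> \<int> \<longleftrightarrow> s - t \<in> \<int>" "t - s \<in> \<int> \<longleftrightarrow> s - t \<in> \<int>"
proof -
  have *: "x - 1 \<in> \<int> \<longleftrightarrow> x \<in> \<int>" for x :: real
    by (metis Ints_1 Ints_add Ints_diff diff_add_cancel)
  show "s - (t + 1) \<in> \<int> \<longleftrightarrow> s - t \<in> \<int>" using *[of "s - t"] by (simp add: diff_diff_eq)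
  have "s + 1 - t - 1 = s - t" by simp
  then show "s + 1 - t \<in> \<int> \<longleftrightarrow> s - t \<in> \<int>" using *[of "s + 1 - t"] by metis
  show "t - s \<in> \<int> \<longleftrightarrow> s - t \<in> \<int>" by (metis minus_diff_eq Ints_minus)
qed

lemma secant_angle_periodic:
  "secant_angle s (t + 1) = secant_angle s t" "secant_angle (s + 1) t = secant_angle s t"
  by (simp_all add: secant_angle_def Ints_shift_iff circle_angle_def periodic)

text \<open>The circle tangent to the curve at one point and passing through another one makes the same
  angle with the curve at both points.\<close>

lemma secant_angle_sym: "secant_angle s t = secant_angle t s"
proof (cases "s - t \<in> \<int>")
  case False
  then have "\<gamma> s \<bullet> \<gamma> t \<noteq> 1"
    using inner_eq_1_iff[of "\<gamma> s" t] orthonormal curve_neq by auto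
  \<comment> \<open>Multiplied by \<open>1 - \<gamma> s \<bullet> \<gamma> t\<close>, the imaginary
    part becomes \<open>- (T s \<bullet> \<nu> t) - (\<nu> s \<bullet> T t)\<close>, which is
    symmetric; the real part is symmetric as it stands.\<close>
  moreover have "(\<gamma> s \<bullet> \<gamma> t) * (T s \<bullet> \<nu> t) - (\<gamma> s \<bullet> \<nu> t) * (T s \<bullet> \<gamma> t) = - (\<nu> s \<bullet> T t)"
    "(\<gamma> t \<bullet> \<gamma> s) * (T t \<bullet> \<nu> s) - (\<gamma> t \<bullet> \<nu> s) * (T t \<bullet> \<gamma> s) = - (\<nu> t \<bullet> T s)"
    using dot_cross[of "\<gamma> s" "T s" "\<gamma> t" "\<nu> t"] dot_cross[of "\<gamma> t" "T t" "\<gamma> s" "\<nu> s"]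
    by (simp_all add: cross_frame inner_commute)
  ultimately show ?thesis
    using False by (simp add: secant_angle_def Ints_shift_iff(3) circle_angle_def field_simps
        inner_commute)
qed (simp add: secant_angle_def Ints_shift_iff(3))

text \<open>By orthonormality at both ends the inner products of \<open>T s\<close>,
  \<open>T t\<close> and \<open>\<nu> t\<close> with the opposite endpoint are, up to sign, those
  with the chord, and \<open>1 - \<gamma> s \<bullet> \<gamma> t\<close> is half the squared chord.
  Cancelling \<open>(t - s)^2\<close> leaves a formula in the difference quotient \<open>d\<close>
  that also makes sense at \<open>s = t\<close>.\<close>

lemma secant_angle_near_diagonal:
  assumes "\<bar>t - s\<bar> < 1"
  defines "d \<equiv> (if s = t then v s *\<^sub>R T s else (\<gamma> t - \<gamma> s) /\<^sub>R (t - s))"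
  shows "secant_angle s t = Complex
    (- (T s \<bullet> T t) + 2 * (T s \<bullet> d) * (d \<bullet> T t) / (d \<bullet> d))
    (- (T s \<bullet> \<nu> t) + 2 * (T s \<bullet> d) * (d \<bullet> \<nu> t) / (d \<bullet> d))"
proof (cases "s = t")
  case True
  then show ?thesis
    using orthonormal[of t] speed_pos[of t] by (simp add: secant_angle_def d_def complex_eq_iff inner_commute)
next
  case False
  have nI: "s - t \<notin> \<int>"
  proof
    assume "s - t \<in> \<int>"
    then obtain n where "s - t = of_int n" by (auto elim: Ints_cases)
    with assms(1) False show False
      by (smt (verit) of_int_le_1_iff of_int_0_less_iff of_int_minus of_int_1_le_iff of_int_0 zero_less_abs_iff of_int_abs abs_minus_commute)
  qed
  have q: "1 - \<gamma> s \<bullet> \<gamma> t \<noteq> 0"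
    using inner_eq_1_iff[of "\<gamma> s" t] orthonormal curve_neq[OF nI] by auto
  define e where "e = t - s"
  have e: "e \<noteq> 0" using False by (simp add: e_def)
  define q where "q = 1 - \<gamma> s \<bullet> \<gamma> t"
  have eqs: "d \<bullet> d = 2 * q / e\<^sup>2" "T s \<bullet> d = (T s \<bullet> \<gamma> t) / e"
    "d \<bullet> T t = - (\<gamma> s \<bullet> T t) / e" "d \<bullet> \<nu> t = - (\<gamma> s \<bullet> \<nu> t) / e"
    using False orthonormal[of s] orthonormal[of t] e
    by (simp_all add: d_def e_def[symmetric] q_def inner_diff inner_commute power2_eq_square field_simps)
  have "2 * (T s \<bullet> d) * (d \<bullet> T t) / (d \<bullet> d) = - (T s \<bullet> \<gamma> t) * (\<gamma> s \<bullet> T t) / q"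
    "2 * (T s \<bullet> d) * (d \<bullet> \<nu> t) / (d \<bullet> d) = - (T s \<bullet> \<gamma> t) * (\<gamma> s \<bullet> \<nu> t) / q"
    unfolding eqs using q e by (simp_all add: field_simps power2_eq_square q_def[symmetric])
  then show ?thesis
    using nI by (simp add: secant_angle_def circle_angle_def q_def)
qed

text \<open>On the diagonal the formula in \<open>d\<close> has a joint limit, since its denominator
  tends to the squared speed, which is positive. Other integer differences reduce to this case by
  periodicity, and elsewhere simplicity of the curve keeps
  \<open>1 - \<gamma> s \<bullet> \<gamma> t\<close> away from 0.\<close>

lemma continuous_secant_angle: "continuous_on UNIV (\<lambda>(s, t). secant_angle s t)"
proof -
  have diag: "isCont (\<lambda>(s, t). secant_angle s t) (a, a)" for a
  proof -
    define d where "d s t = (if s = t then v s *\<^sub>R T s else (\<gamma> t - \<gamma> s) /\<^sub>R (t - s))" for s t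
    have dd: "((\<lambda>p. d (fst p) (snd p)) \<longlongrightarrow> v a *\<^sub>R T a) (nhds (a, a))"
    proof -
      have "isCont (\<lambda>s. v s *\<^sub>R T s) a" by (intro continuous_intros isCont_frame)
      from tendsto_difference_quotient[OF deriv_curve this] show ?thesis
        by (simp add: d_def[abs_def] case_prod_beta')
    qed
    have cs: "((\<lambda>p. f (fst p)) \<longlongrightarrow> f a) (nhds (a, a))" "((\<lambda>p. f (snd p)) \<longlongrightarrow> f a) (nhds (a, a))"
      if "isCont f a" for f :: "real \<Rightarrow> real^3"
      using that unfolding tendsto_nhds_iff by (auto simp: o_def intro!: isCont_tendsto_compose[OF that] tendsto_eq_intros)
    have "v a *\<^sub>R T a \<bullet> v a *\<^sub>R T a \<noteq> 0" using speed_pos[of a] orthonormal[of a] by auto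
    let ?f = "\<lambda>p. Complex
      (- (T (fst p) \<bullet> T (snd p)) + 2 * (T (fst p) \<bullet> d (fst p) (snd p)) * (d (fst p) (snd p) \<bullet> T (snd p))
         / (d (fst p) (snd p) \<bullet> d (fst p) (snd p)))
      (- (T (fst p) \<bullet> \<nu> (snd p)) + 2 * (T (fst p) \<bullet> d (fst p) (snd p)) * (d (fst p) (snd p) \<bullet> \<nu> (snd p))
         / (d (fst p) (snd p) \<bullet> d (fst p) (snd p)))"
    let ?L = "Complex (- (T a \<bullet> T a) + 2 * (T a \<bullet> v a *\<^sub>R T a) * (v a *\<^sub>R T a \<bullet> T a) / (v a *\<^sub>R T a \<bullet> v a *\<^sub>R T a))
       (- (T a \<bullet> \<nu> a) + 2 * (T a \<bullet> v a *\<^sub>R T a) * (v a *\<^sub>R T a \<bullet> \<nu> a) / (v a *\<^sub>R T a \<bullet> v a *\<^sub>R T a))"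
    have lim: "(?f \<longlongrightarrow> ?L) (nhds (a, a))"
      using speed_pos[of a] orthonormal[of a]
      by (intro tendsto_intros dd cs isCont_frame) auto
    have L: "?L = secant_angle a a"
      using secant_angle_near_diagonal[of a a] by simp
    have "\<forall>\<^sub>F p in nhds (a, a). \<bar>snd p - fst p\<bar> < 1"
    proof -
      have "open {p :: real \<times> real. \<bar>snd p - fst p\<bar> < 1}"
        by (intro open_Collect_less continuous_intros)
      from eventually_nhds_in_open[OF this, of "(a, a)"] show ?thesis by simp
    qed
    then have "\<forall>\<^sub>F p in nhds (a, a). ?f p = (\<lambda>(s, t). secant_angle s t) p"
      by (rule eventually_mono) (simp only: case_prod_beta secant_angle_near_diagonal d_def)
    from Lim_transform_eventually[OF lim this]
    have "((\<lambda>(s, t). secant_angle s t) \<longlongrightarrow> secant_angle a a) (nhds (a, a))"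
      unfolding L .
    then show ?thesis
      using tendsto_at_iff_tendsto_nhds[of "\<lambda>(s, t). secant_angle s t" "(a, a)"]
      by (simp add: isCont_def)
  qed
  have "isCont (\<lambda>(s, t). secant_angle s t) (a, b)" for a b
  proof (cases "a - b \<in> \<int>")
    case True
    then obtain n where n: "a - b = of_int n" by (auto elim: Ints_cases)
    have "secant_angle s (t + of_int n) = secant_angle s t" for s t
      by (rule periodic_add_int[of "secant_angle s"]) (rule secant_angle_periodic)
    then have eq: "(\<lambda>(s, t). secant_angle s t) = (\<lambda>p. (\<lambda>(s, t). secant_angle s t) (fst p, snd p + of_int n))"
      by auto
    have "isCont (\<lambda>p. (fst p, snd p + of_int n :: real)) (a, b)"
      by (intro continuous_intros)
    moreover have "isCont (\<lambda>(s, t). secant_angle s t) (fst (a, b), snd (a, b) + of_int n)"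
      using diag[of a] n by (simp add: algebra_simps)
    ultimately show ?thesis
      by (subst eq) (rule isCont_o2)
  next
    case False
    let ?S = "{p :: real \<times> real. fst p - snd p \<notin> \<int>}"
    have "open ?S"
    proof -
      have "?S = (\<lambda>p. fst p - snd p) -` (- \<int>)" by auto
      then show ?thesis
        using open_vimage[of "- \<int>" "\<lambda>p::real\<times>real. fst p - snd p"] closed_Ints
        by (auto intro!: continuous_intros)
    qed
    moreover have "continuous_on ?S (\<lambda>p. secant_angle (fst p) (snd p))"
    proof -
      have ne: "1 - \<gamma> (fst p) \<bullet> \<gamma> (snd p) \<noteq> 0" if "p \<in> ?S" for p
        using inner_eq_1_iff[of "\<gamma> (fst p)" "snd p"] orthonormal curve_neq that by auto
      have "continuous_on ?S (\<lambda>p. circle_angle (\<gamma> (fst p)) (T (fst p)) (snd p))"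
        unfolding circle_angle_def Complex_eq using ne
        by (intro continuous_intros continuous_on_compose2[OF continuous_frame(1)[of UNIV]]
            continuous_on_compose2[OF continuous_frame(2)[of UNIV]]
            continuous_on_compose2[OF continuous_frame(3)[of UNIV]]) auto
      then show ?thesis by (rule continuous_on_eq) (simp add: secant_angle_def)
    qed
    ultimately show ?thesis
      using False by (auto simp: case_prod_beta' continuous_on_eq_continuous_at)
  qed
  then show ?thesis by (auto simp: continuous_on_eq_continuous_at)
qed

text \<open>Hopf's argument: the symmetry identifies the two generators of the fundamental group of the
  torus, whose sum is the diagonal, so that a secant angle constant on the diagonal has no
  monodromy.\<close>

lemma total_angle_on_curve: "((\<lambda>t. v t * k t + kernel (\<gamma> s) t) has_integral 0) {s..s + 1}"
proof -
  \<comment> \<open>The plane is contractible, so the nowhere vanishing secant angle has a global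
    continuous logarithm. The monodromy on the torus survives as the increments of \<open>g\<close>
    under the two periods.\<close>
  obtain g where g: "continuous_on UNIV g" "\<And>p. (\<lambda>(s, t). secant_angle s t) p = exp (g p)"
    using continuous_logarithm_on_contractible[OF continuous_secant_angle
        convex_imp_contractible[OF convex_UNIV]] secant_angle_nonzero
    by (metis (no_types, lifting) UNIV_I case_prod_beta)
  have E: "secant_angle s t = exp (g (s, t))" for s t using g(2)[of "(s, t)"] by simp
  have cg: "continuous_on S (\<lambda>x. g (p x, q x))" if "continuous_on S p" "continuous_on S q"
    for S :: "'b::topological_space set" and p q
    by (rule continuous_on_compose2[OF g(1)]) (intro continuous_intros that, simp)
  have const: "h x = h y" if "continuous_on UNIV h" "\<And>x. exp (h x) = 1"
    for h :: "'b::real_normed_vector \<Rightarrow> complex" and x y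
    using constant_of_exp_eq_1[OF connected_UNIV that(1)] that(2) unfolding constant_on_def by auto
  have E': "exp (g p) = secant_angle (fst p) (snd p)" for p using E[of "fst p" "snd p"] by simp
  have cont: "continuous_on UNIV (\<lambda>p. g (fst p, snd p + 1) - g (fst p, snd p))"
    "continuous_on UNIV (\<lambda>p. g (fst p + 1, snd p) - g (fst p, snd p))"
    "continuous_on UNIV (\<lambda>p. g (fst p, snd p) - g (snd p, fst p))"
    "continuous_on UNIV (\<lambda>t. g (t, t))"
    by (intro continuous_intros cg)+
  have c1: "g (0, 1) - g (0, 0) = g (s, t + 1) - g (s, t)" for s t
    using const[OF cont(1), of "(0, 0)" "(s, t)"]
    by (simp add: exp_diff E' secant_angle_periodic secant_angle_nonzero)
  have c2: "g (1, 0) - g (0, 0) = g (s + 1, t) - g (s, t)" for s t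
    using const[OF cont(2), of "(0, 0)" "(s, t)"]
    by (simp add: exp_diff E' secant_angle_periodic secant_angle_nonzero)
  \<comment> \<open>The secant angle is 1 along the diagonal, so \<open>g\<close> is constant
    there.\<close>
  have c3: "g (0, 0) = g (1, 1)"
    by (rule const[OF cont(4)]) (simp add: E' secant_angle_def)
  \<comment> \<open>By symmetry \<open>g (s, t) - g (t, s)\<close> is constant, and it vanishes for
    \<open>s = t\<close>.\<close>
  have c4: "g (0, 0) - g (0, 0) = g (1, 0) - g (0, 1)"
    using const[OF cont(3), of "(0, 0)" "(1, 0)"] secant_angle_sym secant_angle_nonzero
    by (simp add: exp_diff E')
  \<comment> \<open>By symmetry \<open>g\<close> has the same increment \<open>m\<close> under both
    periods, so passing from (0, 0) to (1, 1) adds \<open>2 m\<close>; this is 0 because both points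
    are on the diagonal.\<close>
  have "g (0, 1) - g (0, 0) = 0"
    using c1[of 1 0] c3 c4 c2[of 0 0] by (simp add: algebra_simps)
  then have 0: "g (s, s + 1) = g (s, s)" using c1[of s s] by simp
  have "((\<lambda>t. v t * k t + kernel (\<gamma> s) t) has_integral Im (g (s, s + 1)) - Im (g (s, s))) {s..s + 1}"
  \<comment> \<open>The differentiable formula for the angle holds only for
    \<open>s < t < s + 1\<close>; at the endpoints continuity of \<open>g\<close> takes
    over.\<close>
  proof (rule fundamental_theorem_of_calculus_interior)
    show "continuous_on {s..s + 1} (\<lambda>t. Im (g (s, t)))"
      by (intro continuous_intros cg)
    fix t assume t: "t \<in> {s<..<s + 1}"
    have nI: "s - t \<notin> \<int>"
    proof
      assume "s - t \<in> \<int>"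
      then obtain n where "s - t = of_int n" by (auto elim: Ints_cases)
      with t have "real_of_int (- 1) < real_of_int n" "real_of_int n < real_of_int 0" by auto
      then show False unfolding of_int_less_iff by simp
    qed
    have d: "(circle_angle (\<gamma> s) (T s) has_vector_derivative
        (\<i> * (v t * k t + kernel (\<gamma> s) t)) * circle_angle (\<gamma> s) (T s) t) (at t)"
      using orthonormal[of s] curve_neq[OF nI]
      by (intro has_vector_derivative_circle_angle) (auto simp: inner_commute)
    have ev: "\<forall>\<^sub>F x in nhds t. circle_angle (\<gamma> s) (T s) x = exp (g (s, x))"
    proof -
      have "open ((\<lambda>x::real. s - x) -` (- \<int>))"
        using open_vimage[of "- \<int>" "\<lambda>x::real. s - x"] closed_Ints by (auto intro!: continuous_intros)
      from eventually_nhds_in_open[OF this, of t] nI have "\<forall>\<^sub>F x in nhds t. s - x \<notin> \<int>"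
        by simp
      then show ?thesis
        by (rule eventually_mono) (simp add: E[symmetric] secant_angle_def)
    qed
    have ev': "\<forall>\<^sub>F x in at t. circle_angle (\<gamma> s) (T s) x = exp (g (s, x))"
      and val: "circle_angle (\<gamma> s) (T s) t = exp (g (s, t))"
      using ev by (simp_all add: eventually_nhds_conv_at)
    have de: "((\<lambda>x. exp (g (s, x))) has_vector_derivative
        (\<i> * (v t * k t + kernel (\<gamma> s) t)) * exp (g (s, t))) (at t)"
      using d unfolding has_vector_derivative_def val
      by (rule has_derivative_transform_eventually) (use ev' val in auto)
    have "isCont (\<lambda>x. g (s, x)) t"
      using cg[of UNIV "\<lambda>_. s" "\<lambda>x. x"] by (auto simp: continuous_on_eq_continuous_at intro!: continuous_intros)
    then have "((\<lambda>x. g (s, x)) has_vector_derivative \<i> * (v t * k t + kernel (\<gamma> s) t)) (at t)"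
      using de by (rule has_vector_derivative_continuous_log)
    then show "((\<lambda>t. Im (g (s, t))) has_vector_derivative v t * k t + kernel (\<gamma> s) t) (at t)"
      using bounded_linear.has_vector_derivative[OF bounded_linear_Im] by fastforce
  qed simp
  then show ?thesis using 0 by simp
qed

end

section \<open>The jump of the double layer potential\<close>

lemma has_integral_periodic:
  fixes f :: "real \<Rightarrow> real"
  assumes per: "\<And>t. f (t + 1) = f t" and int: "(f has_integral I) {a..a + 1}"
  shows "(f has_integral I) {b..b + 1}"
proof -
  have perz: "f (of_int n + t) = f t" for n :: int and t
    using periodic_add_int[of f t n] per by (simp add: add.commute)
  define n where "n = \<lfloor>b - a\<rfloor>"
  define c where "c = b - of_int n"
  have c: "a \<le> c" "c \<le> a + 1" unfolding c_def n_def by linarith+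
  have i: "f integrable_on {a..c}" "f integrable_on {c..a + 1}"
    using int c by (auto intro: integrable_on_subinterval has_integral_integrable)
  have "(f has_integral integral {a..c} f + integral {c..a + 1} f) {a..a + 1}"
    using c i by (intro has_integral_combine[of a c]) auto
  then have I: "I = integral {c..a + 1} f + integral {a..c} f"
    using has_integral_unique[OF int] by simp
  have "f \<circ> (+) 1 = f" using per by (auto simp: o_def add.commute)
  then have "(f has_integral integral {a..c} f) {a + 1..c + 1}"
    using has_integral_shift_Icc_real[of f 1 "integral {a..c} f" a c] i(1) by auto
  then have "(f has_integral I) {c..c + 1}"
    unfolding I using c i(2) by (intro has_integral_combine[of c "a + 1"]) auto
  moreover have "f \<circ> (+) (of_int n) = f" using perz by (auto simp: o_def)
  ultimately show ?thesis
    using has_integral_shift_Icc_real[of f "of_int n" I c "c + 1"] by (simp add: c_def algebra_simps)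
qed

lemma has_vector_derivative_imp_tendsto_quotient:
  fixes f :: "real \<Rightarrow> 'a::real_normed_vector"
  assumes "(f has_vector_derivative f') (at a)"
  shows "((\<lambda>x. (f x - f a) /\<^sub>R (x - a)) \<longlongrightarrow> f') (at a)"
proof -
  have "((\<lambda>x. ((f x - f a) - (x - a) *\<^sub>R f') /\<^sub>R norm (x - a)) \<longlongrightarrow> 0) (at a)"
    using assms unfolding has_vector_derivative_def has_derivative_at_within
    by (simp add: algebra_simps)
  then have "((\<lambda>x. norm (((f x - f a) - (x - a) *\<^sub>R f') /\<^sub>R norm (x - a))) \<longlongrightarrow> 0) (at a)"
    by (rule tendsto_norm_zero)
  moreover have "norm (((f x - f a) - (x - a) *\<^sub>R f') /\<^sub>R norm (x - a)) = norm ((f x - f a) /\<^sub>R (x - a) - f')"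
    if "x \<noteq> a" for x
  proof -
    have "(f x - f a) /\<^sub>R (x - a) - f' = ((f x - f a) - (x - a) *\<^sub>R f') /\<^sub>R (x - a)"
      using that by (simp add: scaleR_diff_right)
    then show ?thesis by simp
  qed
  then have "\<forall>\<^sub>F x in at a. norm (((f x - f a) - (x - a) *\<^sub>R f') /\<^sub>R norm (x - a)) = norm ((f x - f a) /\<^sub>R (x - a) - f')"
    by (auto simp: eventually_at_filter)
  ultimately have "((\<lambda>x. norm ((f x - f a) /\<^sub>R (x - a) - f')) \<longlongrightarrow> 0) (at a)"
    by (rule Lim_transform_eventually)
  then show ?thesis using tendsto_norm_zero_iff Lim_null by blast
qed

text \<open>The bound \<open>B\<close> is asked for only within distance
  \<open>\<bar>t - s\<bar>\<close> of \<open>s\<close>, so it may itself be proportional to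
  \<open>\<bar>t - s\<bar>\<close>. This is how a linear bound on a derivative becomes a quadratic
  bound on the function.\<close>

lemma abs_diff_le_of_derivative_bound:
  fixes f :: "real \<Rightarrow> real"
  assumes "\<And>x. x \<in> {s - 1/2..s + 1/2} \<Longrightarrow> (f has_real_derivative f' x) (at x)"
    and "\<And>x. \<bar>x - s\<bar> \<le> \<bar>t - s\<bar> \<Longrightarrow> \<bar>f' x\<bar> \<le> B" and "\<bar>t - s\<bar> \<le> 1/2"
  shows "\<bar>f t - f s\<bar> \<le> B * \<bar>t - s\<bar>"
proof -
  have "norm (f t - f s) \<le> B * norm (t - s)"
  proof (rule field_differentiable_bound[where S = "{s - \<bar>t - s\<bar>..s + \<bar>t - s\<bar>}"])
    fix x assume x: "x \<in> {s - \<bar>t - s\<bar>..s + \<bar>t - s\<bar>}"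
    have "x \<in> {s - 1/2..s + 1/2}"
      using x assms(3) unfolding atLeastAtMost_iff by linarith
    then show "(f has_field_derivative f' x) (at x within {s - \<bar>t - s\<bar>..s + \<bar>t - s\<bar>})"
      by (rule has_field_derivative_at_within[OF assms(1)])
    have "\<bar>x - s\<bar> \<le> \<bar>t - s\<bar>" using x unfolding atLeastAtMost_iff by linarith
    then show "norm (f' x) \<le> B" using assms(2)[of x] by simp
  next
    show "t \<in> {s - \<bar>t - s\<bar>..s + \<bar>t - s\<bar>}" "s \<in> {s - \<bar>t - s\<bar>..s + \<bar>t - s\<bar>}"
      unfolding atLeastAtMost_iff by linarith+
  qed (rule convex_real_interval)
  then show ?thesis by simp
qed

lemma half_le_cos:
  fixes y :: real
  assumes "\<bar>y\<bar> \<le> 1"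
  shows "1 / 2 \<le> cos y"
proof -
  have "\<bar>y\<bar> \<le> pi / 3" using assms pi_gt3 by linarith
  then have "cos (pi / 3) \<le> cos \<bar>y\<bar>" by (intro cos_monotone_0_pi_le) auto
  then show ?thesis by (simp add: cos_60)
qed

lemma half_le_sin:
  fixes x :: real
  assumes "0 \<le> x" "x \<le> 1"
  shows "x / 2 \<le> sin x"
proof -
  have "sin 0 - 0 / 2 \<le> sin x - x / 2"
  proof (rule DERIV_nonneg_imp_nondecreasing[OF assms(1)])
    fix y assume y: "0 \<le> y" "y \<le> x"
    have "((\<lambda>x. sin x - x / 2) has_real_derivative cos y - 1 / 2) (at y)"
      by (auto intro!: derivative_eq_intros)
    moreover have "0 \<le> cos y - 1 / 2" using half_le_cos[of y] y assms by simp
    ultimately show "\<exists>d. ((\<lambda>x. sin x - x / 2) has_real_derivative d) (at y) \<and> 0 \<le> d" by blast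
  qed
  then show ?thesis by simp
qed

lemma one_minus_cos_ge: "0 \<le> x \<Longrightarrow> x \<le> 1 \<Longrightarrow> x\<^sup>2 / 8 \<le> 1 - cos (x :: real)"
proof -
  assume x: "0 \<le> x" "x \<le> 1"
  have "(x / 4)\<^sup>2 \<le> (sin (x / 2))\<^sup>2"
    using half_le_sin[of "x / 2"] x by (intro power_mono) auto
  moreover have "1 - cos x = 2 * (sin (x / 2))\<^sup>2"
    using cos_double_sin[of "x / 2"] by simp
  ultimately show ?thesis by (simp add: power2_eq_square)
qed

lemma integral_inverse_one_plus_square:
  shows "integrable lborel (\<lambda>x :: real. inverse (1 + x\<^sup>2))"
    and "(\<integral>x. inverse (1 + x\<^sup>2) \<partial>lborel) = pi"
proof -
  have U: "einterval (- \<infinity>) \<infinity> = UNIV" by (auto simp: einterval_def)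
  show "integrable lborel (\<lambda>x :: real. inverse (1 + x\<^sup>2))"
    using integrable_inverse_1_plus_square unfolding U set_integrable_def by simp
  show "(\<integral>x. inverse (1 + x\<^sup>2) \<partial>lborel) = pi"
    using LBINT_inverse_1_plus_square
    unfolding interval_lebesgue_integral_def set_lebesgue_integral_def U by simp
qed

context spherical_frame
begin

text \<open>Small \<open>h > 0\<close> give points outside the domain for \<open>\<sigma> = 1\<close> and inside for \<open>\<sigma> = - 1\<close>.\<close>

definition pushed_point :: "real \<Rightarrow> real \<Rightarrow> real \<Rightarrow> real^3" where
  "pushed_point \<sigma> s h = cos h *\<^sub>R \<gamma> s + (\<sigma> * sin h) *\<^sub>R \<nu> s"

lemma pushed_point_unit: "\<sigma>\<^sup>2 = 1 \<Longrightarrow> pushed_point \<sigma> s h \<bullet> pushed_point \<sigma> s h = 1"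
proof -
  assume "\<sigma>\<^sup>2 = 1"
  then have "(\<sigma> * sin h)\<^sup>2 = (sin h)\<^sup>2"
    by (simp only: power_mult_distrib mult_1)
  moreover have "pushed_point \<sigma> s h \<bullet> pushed_point \<sigma> s h = (cos h)\<^sup>2 + (\<sigma> * sin h)\<^sup>2"
    using orthonormal[of s]
    by (simp add: pushed_point_def inner_add_left inner_add_right inner_commute power2_eq_square)
  ultimately show ?thesis by simp
qed

text \<open>Close to \<open>s\<close> the difference quotient is longer than \<open>v s / 2\<close>.
  On the rest of the period, a compact set, the chord is bounded away from 0 because the curve is
  simple.\<close>

lemma chord_lower_bound:
  obtains m where "m > 0" "\<And>t. \<bar>t - s\<bar> \<le> 1/2 \<Longrightarrow> m * \<bar>t - s\<bar> \<le> norm (\<gamma> t - \<gamma> s)"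
proof -
  have "((\<lambda>t. norm ((\<gamma> t - \<gamma> s) /\<^sub>R (t - s))) \<longlongrightarrow> norm (v s *\<^sub>R T s)) (at s)"
    by (intro tendsto_norm has_vector_derivative_imp_tendsto_quotient deriv_curve)
  moreover have "norm (v s *\<^sub>R T s) = v s"
    using speed_pos[of s] orthonormal[of s] by (simp add: norm_eq_1)
  ultimately have "\<forall>\<^sub>F t in at s. v s / 2 < norm ((\<gamma> t - \<gamma> s) /\<^sub>R (t - s))"
    using speed_pos[of s] by (intro order_tendstoD) auto
  then obtain d where d: "d > 0"
    "\<And>t. t \<noteq> s \<Longrightarrow> dist t s < d \<Longrightarrow> v s / 2 < norm ((\<gamma> t - \<gamma> s) /\<^sub>R (t - s))"
    unfolding eventually_at by auto
  let ?S = "{t. d \<le> \<bar>t - s\<bar> \<and> \<bar>t - s\<bar> \<le> 1/2}"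
  have "compact ?S"
  proof -
    have "closed ?S" by (intro closed_Collect_conj closed_Collect_le continuous_intros)
    moreover have "?S \<subseteq> cball s (1/2)" by (auto simp: dist_real_def abs_minus_commute)
    ultimately show ?thesis using compact_eq_bounded_closed bounded_subset bounded_cball by blast
  qed
  have "\<exists>e>0. \<forall>t\<in>?S. e \<le> norm (\<gamma> t - \<gamma> s)"
  proof (cases "?S = {}")
    case False
    have "continuous_on ?S (\<lambda>t. norm (\<gamma> t - \<gamma> s))"
      by (intro continuous_intros continuous_frame)
    from continuous_attains_inf[OF \<open>compact ?S\<close> False this]
    obtain t0 where t0: "t0 \<in> ?S" "\<And>t. t \<in> ?S \<Longrightarrow> norm (\<gamma> t0 - \<gamma> s) \<le> norm (\<gamma> t - \<gamma> s)"
      by blast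
    have "\<gamma> t0 \<noteq> \<gamma> s"
    proof
      assume "\<gamma> t0 = \<gamma> s"
      then obtain n where n: "t0 - s = of_int n" using simple by (metis Ints_cases)
      then have "0 < \<bar>real_of_int n\<bar>" "\<bar>real_of_int n\<bar> < 1" using t0(1) d(1) by auto
      then show False
        unfolding of_int_abs[symmetric] of_int_0_less_iff of_int_less_1_iff by linarith
    qed
    then show ?thesis using t0(2) by (intro exI[of _ "norm (\<gamma> t0 - \<gamma> s)"]) auto
  qed (auto intro: exI[of _ 1])
  then obtain e where e: "e > 0" "\<And>t. t \<in> ?S \<Longrightarrow> e \<le> norm (\<gamma> t - \<gamma> s)" by auto
  define m where "m = min (v s / 2) e"
  have m: "m \<le> v s / 2" "m \<le> e" "m > 0" using e(1) speed_pos[of s] by (auto simp: m_def)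
  show ?thesis
  proof
    show "m > 0" by fact
    fix t assume t: "\<bar>t - s\<bar> \<le> 1/2"
    consider "t = s" | "t \<noteq> s" "\<bar>t - s\<bar> < d" | "t \<in> ?S" using t by force
    then show "m * \<bar>t - s\<bar> \<le> norm (\<gamma> t - \<gamma> s)"
    proof cases
      case 2
      then have "m < norm ((\<gamma> t - \<gamma> s) /\<^sub>R (t - s))"
        using d(2)[of t] m(1) by (simp add: dist_real_def)
      also have "\<dots> = norm (\<gamma> t - \<gamma> s) / \<bar>t - s\<bar>"
        by (simp add: divide_inverse mult.commute)
      finally show ?thesis using 2(1) by (simp add: pos_less_divide_eq less_imp_le)
    next
      case 3
      have "m * \<bar>t - s\<bar> \<le> e * 1" using m t by (intro mult_mono) auto
      then show ?thesis using e(2)[OF 3] by simp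
    qed simp
  qed
qed

text \<open>Both products vanish at \<open>t = s\<close> and have a derivative proportional to
  \<open>z \<bullet> T t\<close>, where \<open>z\<close> is \<open>\<nu> s\<close> or
  \<open>\<gamma> s\<close>. That factor vanishes at \<open>s\<close> too, so it is bounded linearly
  and the products quadratically.\<close>

lemma normal_component_bound:
  obtains C where "C \<ge> 0" "\<And>t. \<bar>t - s\<bar> \<le> 1/2 \<Longrightarrow> \<bar>\<nu> s \<bullet> \<gamma> t\<bar> \<le> C * (t - s)\<^sup>2"
    "\<And>t. \<bar>t - s\<bar> \<le> 1/2 \<Longrightarrow> \<bar>\<gamma> s \<bullet> \<nu> t\<bar> \<le> C * (t - s)\<^sup>2"
    "\<And>t. \<bar>t - s\<bar> \<le> 1/2 \<Longrightarrow> v t \<le> C"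
proof -
  let ?I = "{s - 1/2..s + 1/2}"
  have "\<exists>B. \<forall>x\<in>?I. \<bar>f x\<bar> \<le> B" if "continuous_on ?I f" for f :: "real \<Rightarrow> real"
    using compact_imp_bounded[OF compact_continuous_image[OF that compact_Icc]]
    by (auto simp: bounded_real)
  from this[OF continuous_frame(4)] this[OF continuous_frame(5)]
  obtain V K where V: "\<And>x. x \<in> ?I \<Longrightarrow> \<bar>v x\<bar> \<le> V" and K: "\<And>x. x \<in> ?I \<Longrightarrow> \<bar>k x\<bar> \<le> K" by blast
  have V0: "V \<ge> 0" using V[of s] by force
  have K0: "K \<ge> 0" using K[of s] by force
  have unit: "\<bar>a \<bullet> b\<bar> \<le> 1" if "a \<bullet> a = 1" "b \<bullet> b = 1" for a b :: "real^3"
    using Cauchy_Schwarz_ineq2[of a b] that by (simp add: norm_eq_sqrt_inner)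
  \<comment> \<open>For a unit vector \<open>z\<close> the derivative
    \<open>v (- (z \<bullet> \<gamma>) - k (z \<bullet> \<nu>))\<close> of
    \<open>z \<bullet> T\<close> is bounded by this number.\<close>
  define M where "M = V * (1 + K)"
  have M: "M \<ge> 0" using V0 K0 by (simp add: M_def)
  have zT: "\<bar>z \<bullet> T t\<bar> \<le> M * \<bar>t - s\<bar>" if z: "z \<bullet> z = 1" "z \<bullet> T s = 0" and t: "\<bar>t - s\<bar> \<le> 1/2" for z t
  proof -
    have "\<bar>z \<bullet> T t - z \<bullet> T s\<bar> \<le> M * \<bar>t - s\<bar>"
    proof (rule abs_diff_le_of_derivative_bound[OF derivs_inner(3) _ t])
      fix x assume "\<bar>x - s\<bar> \<le> \<bar>t - s\<bar>"
      then have x: "x \<in> ?I" using t by (auto simp: abs_if split: if_splits)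
      have "\<bar>- (z \<bullet> \<gamma> x) - k x * (z \<bullet> \<nu> x)\<bar> \<le> \<bar>z \<bullet> \<gamma> x\<bar> + \<bar>k x\<bar> * \<bar>z \<bullet> \<nu> x\<bar>"
        unfolding abs_mult[symmetric] by linarith
      also have "\<dots> \<le> 1 + K * 1"
        using K[OF x] unit[OF z(1)] orthonormal K0 by (intro add_mono mult_mono) auto
      finally show "\<bar>v x * (- (z \<bullet> \<gamma> x) - k x * (z \<bullet> \<nu> x))\<bar> \<le> M"
        using V[OF x] V0 unfolding abs_mult M_def by (intro mult_mono) auto
    qed
    then show ?thesis using z by simp
  qed
  define C where "C = V * M + V * K * M + V"
  have pos: "0 \<le> V * M" "0 \<le> V * K * M" using V0 K0 M by auto
  show ?thesis
  proof
    show "C \<ge> 0" using pos V0 by (simp add: C_def)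
    fix t assume t: "\<bar>t - s\<bar> \<le> 1/2"
    have sq: "\<bar>t - s\<bar> * \<bar>t - s\<bar> = (t - s)\<^sup>2" by (simp add: power2_eq_square)
    have "\<bar>\<nu> s \<bullet> \<gamma> t - \<nu> s \<bullet> \<gamma> s\<bar> \<le> (V * M * \<bar>t - s\<bar>) * \<bar>t - s\<bar>"
    proof (rule abs_diff_le_of_derivative_bound[OF derivs_inner(1) _ t])
      fix x assume xt: "\<bar>x - s\<bar> \<le> \<bar>t - s\<bar>"
      then have x: "x \<in> ?I" "\<bar>x - s\<bar> \<le> 1/2" using t by (auto simp: abs_if split: if_splits)
      have "\<bar>\<nu> s \<bullet> T x\<bar> \<le> M * \<bar>x - s\<bar>" using orthonormal by (intro zT x) auto
      also have "\<dots> \<le> M * \<bar>t - s\<bar>" using xt M by (intro mult_left_mono)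
      finally show "\<bar>v x * (\<nu> s \<bullet> T x)\<bar> \<le> V * M * \<bar>t - s\<bar>"
        using V[OF x(1)] V0 unfolding abs_mult mult.assoc by (intro mult_mono) auto
    qed
    then have "\<bar>\<nu> s \<bullet> \<gamma> t\<bar> \<le> V * M * (t - s)\<^sup>2"
      using orthonormal[of s] sq by (simp add: inner_commute mult.assoc)
    also have "\<dots> \<le> C * (t - s)\<^sup>2" using pos V0 by (intro mult_right_mono) (auto simp: C_def)
    finally show "\<bar>\<nu> s \<bullet> \<gamma> t\<bar> \<le> C * (t - s)\<^sup>2" .
    have "\<bar>\<gamma> s \<bullet> \<nu> t - \<gamma> s \<bullet> \<nu> s\<bar> \<le> (V * K * M * \<bar>t - s\<bar>) * \<bar>t - s\<bar>"
    proof (rule abs_diff_le_of_derivative_bound[OF derivs_inner(2) _ t])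
      fix x assume xt: "\<bar>x - s\<bar> \<le> \<bar>t - s\<bar>"
      then have x: "x \<in> ?I" "\<bar>x - s\<bar> \<le> 1/2" using t by (auto simp: abs_if split: if_splits)
      have "\<bar>\<gamma> s \<bullet> T x\<bar> \<le> M * \<bar>x - s\<bar>" using orthonormal by (intro zT x) auto
      also have "\<dots> \<le> M * \<bar>t - s\<bar>" using xt M by (intro mult_left_mono)
      finally have "\<bar>\<gamma> s \<bullet> T x\<bar> \<le> M * \<bar>t - s\<bar>" .
      then have "(\<bar>v x\<bar> * \<bar>k x\<bar>) * \<bar>\<gamma> s \<bullet> T x\<bar> \<le> (V * K) * (M * \<bar>t - s\<bar>)"
        using V[OF x(1)] K[OF x(1)] V0 K0 by (intro mult_mono) auto
      then show "\<bar>v x * k x * (\<gamma> s \<bullet> T x)\<bar> \<le> V * K * M * \<bar>t - s\<bar>"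
        unfolding abs_mult by (simp add: mult.assoc)
    qed
    then have "\<bar>\<gamma> s \<bullet> \<nu> t\<bar> \<le> V * K * M * (t - s)\<^sup>2"
      using orthonormal[of s] sq by (simp add: mult.assoc)
    also have "\<dots> \<le> C * (t - s)\<^sup>2" using pos V0 by (intro mult_right_mono) (auto simp: C_def)
    finally show "\<bar>\<gamma> s \<bullet> \<nu> t\<bar> \<le> C * (t - s)\<^sup>2" .
    have "t \<in> ?I" using t by (auto simp: abs_if split: if_splits)
    then have "v t \<le> V" using V[of t] by simp
    then show "v t \<le> C" using pos by (simp add: C_def)
  qed
qed

text \<open>The displacement along the normal contributes at least \<open>h^2 / 8\<close>, the one
  along the curve at least \<open>m^2 (t - s)^2 / 4\<close>. The cross term
  \<open>\<sigma> sin h (\<nu> s \<bullet> \<gamma> t)\<close> has no fixed sign, but it is of order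
  \<open>h (t - s)^2\<close> and is absorbed by the latter when \<open>h\<close> is small.\<close>

lemma denominator_lower_bound:
  obtains h0 c where "0 < h0" "h0 \<le> 1" "0 < c"
    "\<And>\<sigma> h t. \<bar>\<sigma>\<bar> = 1 \<Longrightarrow> 0 \<le> h \<Longrightarrow> h \<le> h0 \<Longrightarrow> \<bar>t - s\<bar> \<le> 1/2 \<Longrightarrow>
      c * (h\<^sup>2 + (t - s)\<^sup>2) \<le> 1 - pushed_point \<sigma> s h \<bullet> \<gamma> t"
proof -
  obtain m where m: "m > 0" "\<And>t. \<bar>t - s\<bar> \<le> 1/2 \<Longrightarrow> m * \<bar>t - s\<bar> \<le> norm (\<gamma> t - \<gamma> s)"
    using chord_lower_bound by blast
  obtain C where C: "C \<ge> 0" "\<And>t. \<bar>t - s\<bar> \<le> 1/2 \<Longrightarrow> \<bar>\<nu> s \<bullet> \<gamma> t\<bar> \<le> C * (t - s)\<^sup>2"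
    using normal_component_bound by metis
  \<comment> \<open>Chosen so that the cross term uses up at most half of the tangential
    contribution; \<open>C + 1\<close> avoids a zero denominator.\<close>
  define h0 where "h0 = min 1 (m\<^sup>2 / (8 * (C + 1)))"
  define c where "c = min 1 (m\<^sup>2) / 8"
  have h0: "h0 > 0" "h0 \<le> 1" using m(1) C(1) by (auto simp: h0_def)
  have c: "c > 0" using m(1) by (auto simp: c_def)
  have h0C: "h0 * C \<le> m\<^sup>2 / 8"
  proof -
    have "h0 * C \<le> (m\<^sup>2 / (8 * (C + 1))) * (C + 1)"
      using C(1) m(1) by (intro mult_mono) (auto simp: h0_def)
    also have "\<dots> = m\<^sup>2 / 8" using C(1) by (simp add: divide_simps)
    finally show ?thesis .
  qed
  show ?thesis
  proof (rule that[OF h0 c])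
    fix \<sigma> h t :: real assume a: "\<bar>\<sigma>\<bar> = 1" "0 \<le> h" "h \<le> h0" "\<bar>t - s\<bar> \<le> 1/2"
    define x where "x = (t - s)\<^sup>2"
    have x: "x \<ge> 0" by (simp add: x_def)
    have "norm (\<gamma> t - \<gamma> s) ^ 2 = 2 * (1 - \<gamma> s \<bullet> \<gamma> t)"
      using orthonormal[of s] orthonormal[of t]
      by (simp add: power2_norm_eq_inner inner_diff inner_commute)
    moreover have "(m * \<bar>t - s\<bar>)\<^sup>2 \<le> norm (\<gamma> t - \<gamma> s) ^ 2"
      using m(1) m(2)[OF a(4)] by (intro power_mono) auto
    ultimately have g: "m\<^sup>2 * x / 2 \<le> 1 - \<gamma> s \<bullet> \<gamma> t"
      by (simp add: power_mult_distrib x_def)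
    have ch: "cos h \<ge> 1 / 2" using half_le_cos[of h] a h0 by simp
    have "(1/2) * (m\<^sup>2 * x / 2) \<le> cos h * (1 - \<gamma> s \<bullet> \<gamma> t)"
      using ch g x by (intro mult_mono) auto
    moreover have "\<bar>\<sigma> * sin h * (\<nu> s \<bullet> \<gamma> t)\<bar> \<le> h0 * (C * x)"
    proof -
      have "\<bar>sin h\<bar> \<le> h0" using abs_sin_x_le_abs_x[of h] a by simp
      then have "\<bar>sin h\<bar> * \<bar>\<nu> s \<bullet> \<gamma> t\<bar> \<le> h0 * (C * x)"
        using C(2)[OF a(4)] h0 unfolding x_def by (intro mult_mono) auto
      then show ?thesis using a(1) by (simp add: abs_mult)
    qed
    moreover have "h0 * (C * x) \<le> m\<^sup>2 / 8 * x"
      using mult_right_mono[OF h0C x] by simp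
    moreover have "h\<^sup>2 / 8 \<le> 1 - cos h" using one_minus_cos_ge[of h] a h0 by simp
    moreover have "1 - pushed_point \<sigma> s h \<bullet> \<gamma> t =
        (1 - cos h) + cos h * (1 - \<gamma> s \<bullet> \<gamma> t) - \<sigma> * sin h * (\<nu> s \<bullet> \<gamma> t)"
      by (simp add: pushed_point_def inner_add_left algebra_simps)
    ultimately have "h\<^sup>2 / 8 + m\<^sup>2 / 8 * x \<le> 1 - pushed_point \<sigma> s h \<bullet> \<gamma> t"
      by (simp add: field_simps abs_le_iff)
    moreover have "c * h\<^sup>2 \<le> 1 / 8 * h\<^sup>2" "c * x \<le> m\<^sup>2 / 8 * x"
    proof -
      have "c \<le> 1 / 8" "c \<le> m\<^sup>2 / 8" by (simp_all add: c_def)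
      then show "c * h\<^sup>2 \<le> 1 / 8 * h\<^sup>2" "c * x \<le> m\<^sup>2 / 8 * x"
        using x by (auto intro!: mult_right_mono simp del: times_divide_eq_left)
    qed
    ultimately show "c * (h\<^sup>2 + (t - s)\<^sup>2) \<le> 1 - pushed_point \<sigma> s h \<bullet> \<gamma> t"
      by (simp add: x_def[symmetric] algebra_simps)
  qed
qed

section \<open>The potential and its limits from both sides of the curve\<close>

definition potential :: "real^3 \<Rightarrow> real" where
  "potential z = integral {0..1} (kernel z)"

definition total_curvature :: real where
  "total_curvature = integral {0..1} (\<lambda>t. v t * k t)"

lemma kernel_on_curve_has_integral:
  "(kernel (\<gamma> s) has_integral - total_curvature) {a..a + 1}"
proof -
  have "((\<lambda>t. v t * k t) has_integral total_curvature) {0..0 + 1}"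
    unfolding total_curvature_def
    by (simp, intro integrable_integral integrable_continuous_real continuous_intros continuous_frame)
  then have 1: "((\<lambda>t. v t * k t) has_integral total_curvature) {a..a + 1}"
    by (rule has_integral_periodic[rotated]) (simp add: periodic)
  have 2: "((\<lambda>t. v t * k t + kernel (\<gamma> s) t) has_integral 0) {a..a + 1}"
    by (rule has_integral_periodic[OF _ total_angle_on_curve]) (simp add: periodic kernel_periodic)
  show ?thesis using has_integral_diff[OF 2 1] by simp
qed

lemma measurable_frame [measurable]:
  "\<gamma> \<in> borel_measurable borel" "\<nu> \<in> borel_measurable borel" "v \<in> borel_measurable borel"
  by (intro borel_measurable_continuous_onI continuous_frame)+

lemma measurable_inner_frame [measurable]:
  "(\<lambda>t. z \<bullet> \<gamma> t) \<in> borel_measurable borel" "(\<lambda>t. z \<bullet> \<nu> t) \<in> borel_measurable borel"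
  by (intro borel_measurable_continuous_onI continuous_intros continuous_frame)+

text \<open>The part of the integrand with \<open>\<gamma> s \<bullet> \<nu> t\<close> is bounded; the part with \<open>\<nu> s \<bullet> \<nu> t\<close> becomes a
  multiple of \<open>1 / (1 + (v \<tau>)\<^sup>2)\<close> in the limit under \<open>t = s + h \<tau>\<close>.\<close>

lemma potential_jump:
  assumes \<sigma>: "\<bar>\<sigma>\<bar> = 1"
  obtains h where "\<And>n :: nat. 0 < h n" "h \<longlonglongrightarrow> 0"
    "(\<lambda>n. potential (pushed_point \<sigma> s (h n))) \<longlonglongrightarrow> - total_curvature + 2 * pi * \<sigma>"
proof -
  obtain h0 c where h0: "0 < h0" "h0 \<le> 1" and c: "0 < c"
    and Qc: "\<And>h t. 0 \<le> h \<Longrightarrow> h \<le> h0 \<Longrightarrow> \<bar>t - s\<bar> \<le> 1/2 \<Longrightarrow>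
      c * (h\<^sup>2 + (t - s)\<^sup>2) \<le> 1 - pushed_point \<sigma> s h \<bullet> \<gamma> t"
    using denominator_lower_bound[of s] \<sigma> by metis
  obtain C where C: "C \<ge> 0" "\<And>t. \<bar>t - s\<bar> \<le> 1/2 \<Longrightarrow> \<bar>\<gamma> s \<bullet> \<nu> t\<bar> \<le> C * (t - s)\<^sup>2"
    "\<And>t. \<bar>t - s\<bar> \<le> 1/2 \<Longrightarrow> v t \<le> C"
    using normal_component_bound[of s] by metis
  \<comment> \<open>Dominated convergence is applied along this sequence of heights, which stays
    within the range of the lower bound for the denominator.\<close>
  define h where "h n = h0 / real (Suc n)" for n
  have h: "0 < h n" "h n \<le> h0" for n using h0 by (auto simp: h_def field_simps)
  have h_lim: "h \<longlonglongrightarrow> 0"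
    unfolding h_def by (intro real_tendsto_divide_at_top[OF tendsto_const] filterlim_compose[OF filterlim_real_sequentially filterlim_Suc])
  \<comment> \<open>A full period centred at \<open>s\<close>, in which \<open>s\<close> is the only
    parameter of the point \<open>\<gamma> s\<close>.\<close>
  define I where "I = {s - 1/2..s + 1/2}"
  have I: "t \<in> I \<longleftrightarrow> \<bar>t - s\<bar> \<le> 1/2" for t by (auto simp: I_def abs_if field_simps)
  have I_sets [measurable]: "I \<in> sets borel" by (simp add: I_def)
  define z where "z n = pushed_point \<sigma> s (h n)" for n
  define Q where "Q n t = 1 - z n \<bullet> \<gamma> t" for n t
  have Q_ge: "c * ((h n)\<^sup>2 + (t - s)\<^sup>2) \<le> Q n t" if "t \<in> I" for n t
    using Qc[of "h n" t] h that by (simp add: Q_def z_def I less_imp_le)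
  have Q_pos: "0 < Q n t" if "t \<in> I" for n t
  proof -
    have "0 < c * ((h n)\<^sup>2 + (t - s)\<^sup>2)" using c h(1)[of n] by (simp add: add_pos_nonneg)
    then show ?thesis using Q_ge[OF that] by (rule less_le_trans)
  qed
  have meas_Q [measurable]: "Q n \<in> borel_measurable borel" for n unfolding Q_def by measurable
  have v_le: "\<bar>v t\<bar> \<le> C" if "t \<in> I" for t using C(3)[of t] speed_pos[of t] that by (simp add: I)
  have unit: "\<bar>a \<bullet> b\<bar> \<le> 1" if "a \<bullet> a = 1" "b \<bullet> b = 1" for a b :: "real^3"
    using Cauchy_Schwarz_ineq2[of a b] that by (simp add: norm_eq_sqrt_inner)
  define A where "A n t = indicator I t * (v t * (cos (h n) * (\<gamma> s \<bullet> \<nu> t)) / Q n t)" for n t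
  define B where "B n t = indicator I t * (v t * (\<sigma> * sin (h n) * (\<nu> s \<bullet> \<nu> t)) / Q n t)" for n t
  have meas [measurable]: "A n \<in> borel_measurable borel" "B n \<in> borel_measurable borel" for n
    unfolding A_def B_def by measurable
  have AB: "indicator I t * kernel (z n) t = A n t + B n t" for n t
    by (simp add: A_def B_def kernel_def Q_def z_def pushed_point_def inner_add_left
        add_divide_distrib distrib_left)
  define fA where "fA t = indicator I t * kernel (\<gamma> s) t" for t
  have [measurable]: "fA \<in> borel_measurable borel"
    unfolding fA_def kernel_def by measurable
  have z_lim: "z \<longlonglongrightarrow> \<gamma> s"
    unfolding z_def pushed_point_def by (rule tendsto_eq_intros h_lim refl | simp)+
  have A_lim: "AE t in lborel. (\<lambda>n. A n t) \<longlonglongrightarrow> fA t"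
  proof -
    have "(\<lambda>n. A n t) \<longlonglongrightarrow> fA t" if t: "t \<noteq> s" for t
    proof (cases "t \<in> I")
      case True
      have "s - t \<notin> \<int>"
      proof
        assume "s - t \<in> \<int>"
        then obtain n where n: "s - t = of_int n" by (auto elim: Ints_cases)
        have "\<bar>t - s\<bar> = \<bar>real_of_int n\<bar>" using n by (metis abs_minus_commute)
        then have "\<bar>real_of_int n\<bar> \<le> 1 / 2" using True unfolding I by simp
        moreover have "n \<noteq> 0" using n t by auto
        then have "1 \<le> \<bar>n\<bar>" by linarith
        then have "1 \<le> \<bar>real_of_int n\<bar>" by (metis of_int_1_le_iff of_int_abs)
        ultimately show False by simp
      qed
      then have ne: "1 - \<gamma> s \<bullet> \<gamma> t \<noteq> 0"
        using inner_eq_1_iff[of "\<gamma> s" t] orthonormal(1) curve_neq by auto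
      have "(\<lambda>n. v t * (cos (h n) * (\<gamma> s \<bullet> \<nu> t)) / Q n t) \<longlonglongrightarrow> v t * (cos 0 * (\<gamma> s \<bullet> \<nu> t)) / (1 - \<gamma> s \<bullet> \<gamma> t)"
        unfolding Q_def using ne by (intro tendsto_intros h_lim z_lim)
      then show ?thesis using True by (simp add: A_def fA_def kernel_def)
    qed (simp add: A_def fA_def)
    then show ?thesis using AE_lborel_singleton[of s] by (auto elim: eventually_mono)
  qed
  \<comment> \<open>The quadratic decay of \<open>\<gamma> s \<bullet> \<nu> t\<close> cancels
    against the quadratic lower bound of \<open>Q\<close>.\<close>
  have A_bound: "norm (A n t) \<le> indicator I t * (C * C / c)" for n t
  proof (cases "t \<in> I")
    case True
    have "\<bar>v t * (cos (h n) * (\<gamma> s \<bullet> \<nu> t))\<bar> \<le> C * (1 * (C * (t - s)\<^sup>2))"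
      unfolding abs_mult using C v_le[OF True] True by (intro mult_mono) (auto simp: I)
    also have "\<dots> = (C * C / c) * (c * (t - s)\<^sup>2)" using c by simp
    also have "\<dots> \<le> (C * C / c) * Q n t"
    proof -
      have "c * (t - s)\<^sup>2 \<le> c * ((h n)\<^sup>2 + (t - s)\<^sup>2)" using c by simp
      then have "c * (t - s)\<^sup>2 \<le> Q n t" using Q_ge[OF True] by (rule order_trans)
      then show ?thesis using C(1) c by (intro mult_left_mono) auto
    qed
    finally show ?thesis
      using True Q_pos[OF True, of n] by (simp add: A_def abs_divide pos_divide_le_eq)
  qed (simp add: A_def)
  have wA: "integrable lborel (\<lambda>t. indicator I t * (C * C / c))"
    by (intro integrable_mult_left) (simp add: I_def)
  note A_dct = integrable_dominated_convergence[OF _ _ wA A_lim]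
    integrable_dominated_convergence2[OF _ _ wA A_lim] integral_dominated_convergence[OF _ _ wA A_lim]
  have intfA: "integrable lborel fA" and intA: "integrable lborel (A n)"
    and limA: "(\<lambda>n. integral\<^sup>L lborel (A n)) \<longlonglongrightarrow> integral\<^sup>L lborel fA" for n
    using A_bound by (auto intro!: A_dct)
  have "integral\<^sup>L lborel fA = - total_curvature"
  proof -
    have "set_integrable lborel I (kernel (\<gamma> s))"
      using intfA unfolding set_integrable_def fA_def by simp
    from set_borel_integral_eq_integral(2)[OF this]
    have "integral\<^sup>L lborel fA = integral I (kernel (\<gamma> s))"
      unfolding set_lebesgue_integral_def fA_def by simp
    also have "\<dots> = - total_curvature"
      using kernel_on_curve_has_integral[of s "s - 1/2"] unfolding I_def by (simp add: integral_unique add.commute)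
    finally show ?thesis .
  qed
  note limA = limA[unfolded this]

  \<comment> \<open>Magnification around \<open>s\<close>: the factor \<open>h n\<close> is the
    Jacobian of \<open>t = s + h n * \<tau>\<close>, so \<open>G n\<close> and \<open>B n\<close>
    have the same integral.\<close>
  define G where "G n \<tau> = h n * B n (s + h n * \<tau>)" for n \<tau>
  \<comment> \<open>A multiple of a Cauchy density. Its integral \<open>2 pi \<sigma>\<close> does
    not depend on the speed \<open>v s\<close>, and it is half of the total jump.\<close>
  define g where "g \<tau> = \<sigma> * v s * (2 * inverse (1 + (v s * \<tau>)\<^sup>2))" for \<tau>
  have [measurable]: "G n \<in> borel_measurable borel" "g \<in> borel_measurable borel" for n
    unfolding G_def g_def by measurable
  have G_lim: "(\<lambda>n. G n \<tau>) \<longlonglongrightarrow> g \<tau>" for \<tau>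
  proof -
    have st: "(\<lambda>n. s + h n * \<tau>) \<longlonglongrightarrow> s"
      by (rule tendsto_eq_intros h_lim refl | simp)+
    have h0': "filterlim h (at 0) sequentially"
      using h_lim h(1) by (simp add: filterlim_at less_imp_neq[symmetric])
    \<comment> \<open>\<open>u x\<close> joins two points of the sphere, so half its squared length
      is the denominator \<open>Q\<close>. Its linear part at 0, with a normal and a tangential
      component, yields the limit of \<open>Q / h^2\<close>.\<close>
    define u where "u x = pushed_point \<sigma> s x - \<gamma> (s + x * \<tau>)" for x
    have u0: "u 0 = 0" by (simp add: u_def pushed_point_def)
    have u': "(u has_vector_derivative (\<sigma> *\<^sub>R \<nu> s - (\<tau> * v s) *\<^sub>R T s)) (at 0)"
    proof -
      have "((\<lambda>x. \<gamma> (s + x * \<tau>)) has_vector_derivative \<tau> *\<^sub>R (v s *\<^sub>R T s)) (at 0)"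
      proof -
        have "((\<lambda>x. s + x * \<tau>) has_vector_derivative \<tau>) (at 0)"
          unfolding has_real_derivative_iff_has_vector_derivative[symmetric]
          by (auto intro!: derivative_eq_intros)
        then show ?thesis
          using vector_diff_chain_at[of "\<lambda>x. s + x * \<tau>" \<tau> 0 \<gamma> "v s *\<^sub>R T s"] deriv_curve[of s]
          by (simp add: o_def)
      qed
      then show ?thesis unfolding u_def pushed_point_def
        by (auto intro!: derivative_eq_intros)
    qed
    have "((\<lambda>x. (u x - u 0) /\<^sub>R (x - 0)) \<longlongrightarrow> \<sigma> *\<^sub>R \<nu> s - (\<tau> * v s) *\<^sub>R T s) (at 0)"
      by (rule has_vector_derivative_imp_tendsto_quotient[OF u'])
    from filterlim_compose[OF this h0']
    have ulim: "(\<lambda>n. u (h n) /\<^sub>R h n) \<longlonglongrightarrow> \<sigma> *\<^sub>R \<nu> s - (\<tau> * v s) *\<^sub>R T s"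
      using u0 by simp
    have Qeq: "Q n (s + h n * \<tau>) / (h n)\<^sup>2 = (norm (u (h n) /\<^sub>R h n))\<^sup>2 / 2" for n
    proof -
      have "\<sigma>\<^sup>2 = 1" using \<sigma> by (metis power2_abs power_one)
      then have "(norm (u (h n)))\<^sup>2 = 2 * Q n (s + h n * \<tau>)"
        using pushed_point_unit[of \<sigma> s "h n"] orthonormal[of "s + h n * \<tau>"]
        by (simp add: u_def Q_def z_def power2_norm_eq_inner inner_diff inner_commute)
      then show ?thesis using h(1)[of n]
        by (simp add: power_mult_distrib power_inverse field_simps)
    qed
    have "(\<lambda>n. (norm (u (h n) /\<^sub>R h n))\<^sup>2 / 2) \<longlonglongrightarrow> (norm (\<sigma> *\<^sub>R \<nu> s - (\<tau> * v s) *\<^sub>R T s))\<^sup>2 / 2"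
      by (intro tendsto_intros ulim) simp
    moreover have nn: "(norm (\<sigma> *\<^sub>R \<nu> s - (\<tau> * v s) *\<^sub>R T s))\<^sup>2 = 1 + (v s * \<tau>)\<^sup>2"
    proof -
      have "\<sigma> * \<sigma> = 1" using \<sigma> by (metis abs_mult_self_eq mult_1)
      then show ?thesis using orthonormal[of s] unfolding power2_norm_eq_inner
        by (simp add: inner_diff inner_commute power2_eq_square algebra_simps)
    qed
    ultimately have Qlim: "(\<lambda>n. Q n (s + h n * \<tau>) / (h n)\<^sup>2) \<longlonglongrightarrow> (1 + (v s * \<tau>)\<^sup>2) / 2"
      by (simp only: Qeq)
    have sin_lim: "(\<lambda>n. sin (h n) / h n) \<longlonglongrightarrow> 1"
    proof -
      have "((\<lambda>x :: real. sin x / x) \<longlongrightarrow> 1) (at 0)"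
        using DERIV_sin[of "0 :: real"] unfolding DERIV_def by simp
      from filterlim_compose[OF this h0'] show ?thesis .
    qed
    have lim: "(\<lambda>n. v (s + h n * \<tau>) * (\<sigma> * (sin (h n) / h n) * (\<nu> s \<bullet> \<nu> (s + h n * \<tau>))) / (Q n (s + h n * \<tau>) / (h n)\<^sup>2))
        \<longlonglongrightarrow> v s * (\<sigma> * 1 * (\<nu> s \<bullet> \<nu> s)) / ((1 + (v s * \<tau>)\<^sup>2) / 2)"
    proof -
      have "(\<lambda>n. v (s + h n * \<tau>)) \<longlonglongrightarrow> v s" "(\<lambda>n. \<nu> (s + h n * \<tau>)) \<longlonglongrightarrow> \<nu> s"
        by (rule isCont_tendsto_compose[OF _ st], rule isCont_frame)+
      moreover have "(1 + (v s * \<tau>)\<^sup>2) / 2 \<noteq> 0" by (simp add: add_nonneg_eq_0_iff)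
      ultimately show ?thesis
        by (intro tendsto_divide[OF tendsto_mult[OF _ tendsto_mult[OF tendsto_mult[OF tendsto_const sin_lim]
            tendsto_inner[OF tendsto_const]]] Qlim])
    qed
    have "\<forall>\<^sub>F n in sequentially. \<bar>h n * \<tau>\<bar> < 1/2"
    proof -
      have "(\<lambda>n. \<bar>h n * \<tau>\<bar>) \<longlonglongrightarrow> 0" by (rule tendsto_eq_intros h_lim refl | simp)+
      then show ?thesis by (rule order_tendstoD) simp
    qed
    then have "\<forall>\<^sub>F n in sequentially.
        v (s + h n * \<tau>) * (\<sigma> * (sin (h n) / h n) * (\<nu> s \<bullet> \<nu> (s + h n * \<tau>))) / (Q n (s + h n * \<tau>) / (h n)\<^sup>2) = G n \<tau>"
    proof (rule eventually_mono)
      fix n assume "\<bar>h n * \<tau>\<bar> < 1/2"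
      then have "s + h n * \<tau> \<in> I" by (simp add: I)
      then show "v (s + h n * \<tau>) * (\<sigma> * (sin (h n) / h n) * (\<nu> s \<bullet> \<nu> (s + h n * \<tau>))) / (Q n (s + h n * \<tau>) / (h n)\<^sup>2) = G n \<tau>"
        using h(1)[of n] by (simp add: G_def B_def power2_eq_square)
    qed
    from Lim_transform_eventually[OF lim this]
    have "(\<lambda>n. G n \<tau>) \<longlonglongrightarrow> v s * (\<sigma> * 1 * (\<nu> s \<bullet> \<nu> s)) / ((1 + (v s * \<tau>)\<^sup>2) / 2)" .
    moreover have "v s * (\<sigma> * 1 * (\<nu> s \<bullet> \<nu> s)) / ((1 + (v s * \<tau>)\<^sup>2) / 2) = g \<tau>"
      by (simp add: orthonormal(2) g_def inverse_eq_divide mult.commute)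
    ultimately show ?thesis by metis
  qed
  \<comment> \<open>The Jacobian and \<open>sin h \<le> h\<close> give a factor \<open>h^2\<close>
    in the numerator, which cancels against \<open>Q \<ge> c h^2 (1 + \<tau>^2)\<close>.\<close>
  have G_bound: "norm (G n \<tau>) \<le> (C / c) * inverse (1 + \<tau>\<^sup>2)" for n \<tau>
  proof (cases "s + h n * \<tau> \<in> I")
    case True
    let ?t = "s + h n * \<tau>"
    have pos: "1 + \<tau>\<^sup>2 > 0" by (simp add: add_pos_nonneg)
    have "\<bar>h n * (v ?t * (\<sigma> * sin (h n) * (\<nu> s \<bullet> \<nu> ?t)))\<bar> \<le> h n * (C * (1 * h n * 1))"
      unfolding abs_mult using \<sigma> h(1)[of n] C(1) v_le[OF True] abs_sin_x_le_abs_x[of "h n"] unit orthonormal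
      by (intro mult_mono) auto
    also have "\<dots> = ((C / c) * inverse (1 + \<tau>\<^sup>2)) * (c * ((h n)\<^sup>2 + (?t - s)\<^sup>2))"
      using c pos by (simp add: power_mult_distrib divide_simps) (simp add: algebra_simps power2_eq_square)
    also have "\<dots> \<le> ((C / c) * inverse (1 + \<tau>\<^sup>2)) * Q n ?t"
      using C(1) c pos by (intro mult_left_mono Q_ge[OF True]) auto
    finally have "\<bar>h n * (v ?t * (\<sigma> * sin (h n) * (\<nu> s \<bullet> \<nu> ?t))) / Q n ?t\<bar> \<le> (C / c) * inverse (1 + \<tau>\<^sup>2)"
      using Q_pos[OF True, of n] by (simp add: abs_divide pos_divide_le_eq)
    then show ?thesis using True by (simp add: G_def B_def)
  next
    case False
    have "1 + \<tau>\<^sup>2 > 0" by (simp add: add_pos_nonneg)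
    then show ?thesis using False C(1) c by (simp add: G_def B_def)
  qed
  have wG: "integrable lborel (\<lambda>\<tau>. (C / c) * inverse (1 + \<tau>\<^sup>2))"
    by (intro integrable_mult_right integral_inverse_one_plus_square)
  have G_lim': "AE \<tau> in lborel. (\<lambda>n. G n \<tau>) \<longlonglongrightarrow> g \<tau>" using G_lim by simp
  note G_dct = integrable_dominated_convergence2[OF _ _ wG G_lim']
    integral_dominated_convergence[OF _ _ wG G_lim']
  have intG: "integrable lborel (G n)"
    and limG: "(\<lambda>n. integral\<^sup>L lborel (G n)) \<longlonglongrightarrow> integral\<^sup>L lborel g" for n
    using G_bound by (auto intro!: G_dct)
  have "integral\<^sup>L lborel g = \<sigma> * (2 * pi)"
  proof -
    have "pi = \<bar>v s\<bar> *\<^sub>R (\<integral>\<tau>. inverse (1 + (0 + v s * \<tau>)\<^sup>2) \<partial>lborel)"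
      using lborel_integral_real_affine[of "v s" "\<lambda>x. inverse (1 + x\<^sup>2)" 0] speed_pos[of s]
        integral_inverse_one_plus_square(2) by simp
    then have "v s * (\<integral>\<tau>. inverse (1 + (v s * \<tau>)\<^sup>2) \<partial>lborel) = pi"
      using speed_pos[of s] by simp
    then show ?thesis unfolding g_def by (simp add: mult.assoc)
  qed
  note limG = limG[unfolded this]
  have intB: "integrable lborel (B n)" and BG: "integral\<^sup>L lborel (B n) = integral\<^sup>L lborel (G n)" for n
  proof -
    have "integrable lborel (\<lambda>\<tau>. B n (s + h n * \<tau>))"
      using integrable_mult_right[OF intG, of "inverse (h n)" n] h(1)[of n]
      by (simp add: G_def mult.assoc[symmetric])
    then show "integrable lborel (B n)"
      using lborel_integrable_real_affine_iff[of "h n" "B n" s] h(1)[of n] by simp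
    show "integral\<^sup>L lborel (B n) = integral\<^sup>L lborel (G n)"
      using lborel_integral_real_affine[of "h n" "B n" s] h(1)[of n] by (simp add: G_def[abs_def])
  qed
  have pot: "potential (z n) = integral\<^sup>L lborel (A n) + integral\<^sup>L lborel (G n)" for n
  proof -
    have "set_integrable lborel I (kernel (z n))"
      unfolding set_integrable_def using AB intA intB by simp
    note * = set_borel_integral_eq_integral[OF this]
    have "(kernel (z n) has_integral integral I (kernel (z n))) {s - 1/2..s - 1/2 + 1}"
    proof -
      have "s - 1/2 + 1 = s + 1/2" by simp
      then show ?thesis using integrable_integral[OF *(1)] unfolding I_def by (simp only:)
    qed
    then have "(kernel (z n) has_integral integral I (kernel (z n))) {0..0 + 1}"
      by (rule has_integral_periodic[rotated]) (rule kernel_periodic)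
    then have "potential (z n) = integral I (kernel (z n))"
      unfolding potential_def by (simp add: integral_unique)
    also have "\<dots> = (\<integral>t. A n t + B n t \<partial>lborel)"
      unfolding *(2)[symmetric] set_lebesgue_integral_def using AB by simp
    also have "\<dots> = integral\<^sup>L lborel (A n) + integral\<^sup>L lborel (G n)"
      using intA intB BG by simp
    finally show ?thesis .
  qed
  have "(\<lambda>n. potential (pushed_point \<sigma> s (h n))) \<longlonglongrightarrow> - total_curvature + 2 * pi * \<sigma>"
    using tendsto_add[OF limA limG] unfolding pot[symmetric] z_def by (simp add: mult.commute)
  with h(1) h_lim show thesis by (rule that)
qed

end

section \<open>The kernel on the unit ball\<close>

lemma measurable_vector3:
  "(\<lambda>p. vector [fst (fst p), snd (fst p), snd p] :: real^3) \<in> borel_measurable borel"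
proof (rule borel_measurable_continuous_onI)
  have eq: "(\<lambda>p. vector [fst (fst p), snd (fst p), snd p] :: real^3) =
      (\<lambda>p. fst (fst p) *\<^sub>R axis 1 1 + snd (fst p) *\<^sub>R axis 2 1 + snd p *\<^sub>R axis 3 1)"
    by (auto simp: fun_eq_iff vec_eq_iff forall_3 axis_def)
  show "continuous_on UNIV (\<lambda>p. vector [fst (fst p), snd (fst p), snd p] :: real^3)"
    unfolding eq by (intro continuous_intros)
qed

text \<open>Boxes determine the measure. The triple is nested as \<open>((a, b), c)\<close> so that
  later its first component can be the parameter of the stereographic chart and its last one the
  radius.\<close>

lemma lborel_real3:
  "lborel = distr lborel borel (\<lambda>p. vector [fst (fst p), snd (fst p), snd p] :: real^3)"
proof (rule lborel_eqI)
  fix l u :: "real^3" assume le: "\<And>b. b \<in> Basis \<Longrightarrow> l \<bullet> b \<le> u \<bullet> b"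
  have le': "l $ i \<le> u $ i" for i
    using le[of "axis i 1"] by (simp add: inner_axis axis_in_Basis_iff)
  have "(\<lambda>p. vector [fst (fst p), snd (fst p), snd p] :: real^3) -` box l u =
      box ((l $ 1, l $ 2), l $ 3) ((u $ 1, u $ 2), u $ 3)"
    by (auto simp: mem_box_cart forall_3 mem_box Basis_prod_def ball_Un)
  then have "emeasure (distr lborel borel (\<lambda>p. vector [fst (fst p), snd (fst p), snd p] :: real^3)) (box l u)
      = emeasure lborel (box ((l $ 1, l $ 2), l $ 3) ((u $ 1, u $ 2), u $ 3))"
    by (subst emeasure_distr) (auto intro: measurable_vector3)
  also have "\<dots> = ennreal ((u $ 1 - l $ 1) * (u $ 2 - l $ 2) * (u $ 3 - l $ 3))"
    using le' by (subst emeasure_lborel_box)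
      (auto simp: Basis_prod_def prod.union_disjoint inner_Pair)
  also have "(u $ 1 - l $ 1) * (u $ 2 - l $ 2) * (u $ 3 - l $ 3) = (\<Prod>b\<in>Basis. (u - l) \<bullet> b)"
  proof -
    have B: "(Basis :: (real^3) set) = {axis 1 1, axis 2 1, axis 3 1}"
      unfolding Basis_vec_def UNIV_3 by auto
    show ?thesis unfolding B by (simp add: axis_eq_axis inner_axis mult.assoc)
  qed
  finally show "emeasure (distr lborel borel (\<lambda>p. vector [fst (fst p), snd (fst p), snd p] :: real^3)) (box l u)
      = ennreal (\<Prod>b\<in>Basis. (u - l) \<bullet> b)" .
qed simp

lemma nn_integral_real3:
  fixes f :: "real^3 \<Rightarrow> ennreal"
  assumes [measurable]: "f \<in> borel_measurable borel"
  shows "(\<integral>\<^sup>+y. f y \<partial>lborel) = (\<integral>\<^sup>+w. \<integral>\<^sup>+c. f (vector [fst w, snd w, c]) \<partial>lborel \<partial>lborel)"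
proof -
  have [measurable]: "(\<lambda>p. f (vector [fst (fst p), snd (fst p), snd p])) \<in>
      borel_measurable (lborel \<Otimes>\<^sub>M lborel)"
    using measurable_compose[OF measurable_vector3 assms] by (simp add: lborel_prod)
  have "(\<integral>\<^sup>+y. f y \<partial>lborel) =
      (\<integral>\<^sup>+p. f (vector [fst (fst p), snd (fst p), snd p]) \<partial>(lborel \<Otimes>\<^sub>M lborel))"
    by (subst lborel_real3, subst nn_integral_distr) (auto intro: measurable_vector3 simp: lborel_prod)
  also have "\<dots> = (\<integral>\<^sup>+w. \<integral>\<^sup>+c. f (vector [fst w, snd w, c]) \<partial>lborel \<partial>lborel)"
    by (subst lborel.nn_integral_fst[symmetric]) simp_all
  finally show ?thesis .
qed

lemma borel_measurable_orthogonal: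
  fixes f :: "real^'n \<Rightarrow> real^'n"
  assumes "orthogonal_transformation f"
  shows "f \<in> borel_measurable borel"
  by (intro borel_measurable_continuous_onI linear_continuous_on linear_conv_bounded_linear[THEN iffD1]
      orthogonal_transformation_linear assms)

text \<open>The preimage of a box is its image under the inverse map, which is again orthogonal and
  preserves volume; boxes determine \<open>lborel\<close>.\<close>

lemma lborel_distr_orthogonal:
  fixes f :: "real^'n::{finite,wellorder} \<Rightarrow> real^'n::_"
  assumes f: "orthogonal_transformation f"
  shows "distr lborel borel f = lborel"
proof (rule lborel_eqI[symmetric])
  fix l u :: "real^'n::_" assume le: "\<And>b. b \<in> Basis \<Longrightarrow> l \<bullet> b \<le> u \<bullet> b"
  have inv: "orthogonal_transformation (inv f)" using f by (rule orthogonal_transformation_inv)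
  have vim: "f -` box l u = inv f ` box l u"
    using bij_vimage_eq_inv_image[OF orthogonal_transformation_bij[OF f]] .
  have m: "inv f ` box l u \<in> lmeasurable"
    by (rule measurable_orthogonal_image[OF inv]) simp
  have b: "inv f ` box l u \<in> sets borel"
    using measurable_sets[OF borel_measurable_orthogonal[OF f], of "box l u"] vim by simp
  have "emeasure lborel (f -` box l u) = emeasure lebesgue (inv f ` box l u)"
    unfolding vim using b by simp
  also have "\<dots> = measure lebesgue (inv f ` box l u)"
    using m by (rule emeasure_eq_measure2)
  also have "\<dots> = measure lebesgue (box l u)"
    using measure_orthogonal_image[OF inv, of "box l u"] by simp
  finally have "emeasure lborel (f -` box l u) = measure lebesgue (box l u)" .
  then show "emeasure (distr lborel borel f) (box l u) = ennreal (\<Prod>b\<in>Basis. (u - l) \<bullet> b)"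
    using le by (subst emeasure_distr) (auto intro: borel_measurable_orthogonal[OF f] simp: inner_diff_left intro!: prod.cong)
qed simp

text \<open>This is the one-variable factor of the product that will dominate the singularity of the
  ball kernel.\<close>

lemma nn_integral_inverse_sqrt_finite:
  "(\<integral>\<^sup>+u. ennreal (\<bar>u\<bar> powr (- 1 / 2)) * indicator {- 1..1} u \<partial>lborel) < \<infinity>"
proof -
  have 1: "(\<integral>\<^sup>+u. ennreal (u powr (- 1 / 2) * indicator {0..1} u) \<partial>lborel) < \<infinity>"
  proof -
    have "((\<lambda>u::real. u powr (- 1 / 2)) has_integral 2) {0..1}"
      using has_integral_powr_from_0[of "- 1 / 2" 1] by simp
    then have "((\<lambda>u::real. u powr (- 1 / 2) * indicator {0..1} u) has_integral 2) UNIV"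
      by (subst (asm) has_integral_restrict_UNIV[symmetric])
        (auto elim!: has_integral_eq[rotated] simp: indicator_def)
    then have "(\<integral>\<^sup>+u. ennreal (u powr (- 1 / 2) * indicator {0..1} u) \<partial>lborel) = ennreal 2"
      by (intro nn_integral_has_integral_lborel) auto
    then show ?thesis by simp
  qed
  have 2: "(\<integral>\<^sup>+u. ennreal ((- u) powr (- 1 / 2) * indicator {0..1} (- u)) \<partial>lborel) < \<infinity>"
    using 1 by (subst (asm) nn_integral_real_affine[where c = "- 1" and t = 0]) auto
  have "(\<integral>\<^sup>+u. ennreal (\<bar>u\<bar> powr (- 1 / 2)) * indicator {- 1..1} u \<partial>lborel) \<le>
    (\<integral>\<^sup>+u. ennreal (u powr (- 1 / 2) * indicator {0..1} u) + ennreal ((- u) powr (- 1 / 2) * indicator {0..1} (- u)) \<partial>lborel)"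
    by (intro nn_integral_mono) (auto simp: indicator_def)
  also have "\<dots> = (\<integral>\<^sup>+u. ennreal (u powr (- 1 / 2) * indicator {0..1} u) \<partial>lborel) +
     (\<integral>\<^sup>+u. ennreal ((- u) powr (- 1 / 2) * indicator {0..1} (- u)) \<partial>lborel)"
    by (intro nn_integral_add) auto
  also have "\<dots> < \<infinity>" using 1 2 by simp
  finally show ?thesis .
qed

text \<open>For a unit vector \<open>n\<close> normal to the curve at \<open>x\<close> this is the kernel of the double layer
  potential, extended from the sphere to the ball by homogeneity of degree 0.\<close>

definition ball_kernel :: "real^3 \<Rightarrow> real^3 \<Rightarrow> real^3 \<Rightarrow> real" where
  "ball_kernel x n y = indicator (ball 0 1) y * ((y \<bullet> n) / (norm y - y \<bullet> x))"

lemma borel_measurable_ball_kernel [measurable]: "ball_kernel x n \<in> borel_measurable borel"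
  unfolding ball_kernel_def
  by (intro borel_measurable_times borel_measurable_indicator borel_measurable_divide
      borel_measurable_diff borel_measurable_norm borel_measurable_inner) auto

text \<open>For \<open>y = (a, b, c)\<close> the singular ray is \<open>a = b = 0\<close>,
  \<open>c > 0\<close>. There \<open>1 / (norm y - c) = (norm y + c) / (a^2 + b^2)\<close>, and
  \<open>\<bar>a\<bar> / (a^2 + b^2)\<close> is at most the product of
  \<open>\<bar>a\<bar> powr (- 1 / 2)\<close> and \<open>\<bar>b\<bar> powr (- 1 / 2)\<close>, to
  which Tonelli's theorem applies in Cartesian coordinates.\<close>

lemma ball_kernel_axis_finite:
  "(\<integral>\<^sup>+y. ennreal \<bar>ball_kernel (axis 3 1) (axis 1 1) y\<bar> \<partial>lborel) < \<infinity>"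
proof -
  let ?g = "\<lambda>u. ennreal (\<bar>u\<bar> powr (- 1 / 2)) * indicator {- 1..1} u"
  let ?h = "\<lambda>u :: real. indicator {- 1..1} u :: ennreal"
  have bound: "ennreal \<bar>ball_kernel (axis 3 1) (axis 1 1) y\<bar> \<le> 2 * (?g (y $ 1) * ?g (y $ 2) * ?h (y $ 3))"
    if "y $ 2 \<noteq> 0" for y
  proof (cases "y \<in> ball 0 1 \<and> y $ 1 \<noteq> 0")
    case False
    then show ?thesis by (auto simp: ball_kernel_def inner_axis)
  next
    case True
    define a b c where "a = y $ 1" and "b = y $ 2" and "c = y $ 3"
    have n1: "norm y < 1" and a0: "a \<noteq> 0" and b0: "b \<noteq> 0" using True that by (auto simp: a_def b_def)
    have n: "(norm y)\<^sup>2 = a\<^sup>2 + b\<^sup>2 + c\<^sup>2"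
      unfolding power2_norm_eq_inner by (simp add: inner_vec_def sum_3 a_def b_def c_def power2_eq_square)
    have abs: "\<bar>a\<bar> \<le> norm y" "\<bar>b\<bar> \<le> norm y" "\<bar>c\<bar> \<le> norm y"
      unfolding a_def b_def c_def by (rule component_le_norm_cart)+
    have pos: "a\<^sup>2 + b\<^sup>2 > 0" using a0 by (simp add: add_pos_nonneg)
    have prod: "(norm y - c) * (norm y + c) = a\<^sup>2 + b\<^sup>2"
      using n by (simp add: power2_eq_square algebra_simps)
    then have "norm y - c \<noteq> 0" "norm y + c \<noteq> 0" using pos by auto
    then have e: "1 / (norm y - c) = (norm y + c) / (a\<^sup>2 + b\<^sup>2)"
      by (simp add: prod[symmetric])
    have d: "norm y - c \<ge> 0" using abs by linarith
    have "\<bar>a / (norm y - c)\<bar> = \<bar>a\<bar> * (norm y + c) / (a\<^sup>2 + b\<^sup>2)"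
    proof -
      have "\<bar>a / (norm y - c)\<bar> = \<bar>a\<bar> * (1 / (norm y - c))" using d by (simp add: abs_divide)
      then show ?thesis unfolding e by simp
    qed
    also have "\<dots> \<le> \<bar>a\<bar> * 2 / (a\<^sup>2 + b\<^sup>2)"
      using pos n1 abs by (intro divide_right_mono mult_left_mono) auto
    also have "\<dots> \<le> 2 * (\<bar>a\<bar> powr (- 1 / 2) * \<bar>b\<bar> powr (- 1 / 2))"
    proof -
      \<comment> \<open>In terms of the square roots the estimate becomes
        \<open>p^3 q \<le> p^4 + q^4\<close>, which follows by comparing \<open>p\<close> with
        \<open>q\<close>.\<close>
      define p q where "p = sqrt \<bar>a\<bar>" and "q = sqrt \<bar>b\<bar>"
      have p: "p > 0" "q > 0" and ab: "\<bar>a\<bar> = p\<^sup>2" "\<bar>b\<bar> = q\<^sup>2" using a0 b0 by (auto simp: p_def q_def)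
      have "p ^ 3 * q \<le> (p\<^sup>2)\<^sup>2 + (q\<^sup>2)\<^sup>2"
      proof (cases "p \<le> q")
        case True
        then have "p ^ 3 * q \<le> q ^ 3 * q" using p by (intro mult_right_mono power_mono) auto
        also have "\<dots> = (q\<^sup>2)\<^sup>2" by (simp add: power2_eq_square power3_eq_cube)
        finally show ?thesis by (simp add: add_increasing)
      next
        case False
        then have "p ^ 3 * q \<le> p ^ 3 * p" using p by (intro mult_left_mono) auto
        also have "\<dots> = (p\<^sup>2)\<^sup>2" by (simp add: power2_eq_square power3_eq_cube)
        finally show ?thesis by (simp add: add_increasing2)
      qed
      moreover have "a\<^sup>2 + b\<^sup>2 = (p\<^sup>2)\<^sup>2 + (q\<^sup>2)\<^sup>2" using ab by (metis power2_abs)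
      ultimately have "p\<^sup>2 * (p * q) \<le> 1 * (a\<^sup>2 + b\<^sup>2)"
        by (simp add: power2_eq_square power3_eq_cube mult.assoc)
      then have "p\<^sup>2 / (a\<^sup>2 + b\<^sup>2) \<le> 1 / (p * q)"
        using p pos by (simp add: pos_divide_le_eq pos_le_divide_eq)
      then have le: "2 * (p\<^sup>2 / (a\<^sup>2 + b\<^sup>2)) \<le> 2 * (1 / (p * q))" by (rule mult_left_mono) simp
      have pw: "\<bar>x\<bar> powr (- 1 / 2) = 1 / sqrt \<bar>x\<bar>" for x :: real
      proof -
        have "\<bar>x\<bar> powr (- (1 / 2)) = 1 / sqrt \<bar>x\<bar>"
          by (simp only: powr_minus powr_half_sqrt abs_ge_zero inverse_eq_divide)
        then show ?thesis by simp
      qed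
      have "\<bar>a\<bar> * 2 / (a\<^sup>2 + b\<^sup>2) = 2 * (p\<^sup>2 / (a\<^sup>2 + b\<^sup>2))" unfolding ab(1) by simp
      also note le
      also have "2 * (1 / (p * q)) = 2 * (\<bar>a\<bar> powr (- 1 / 2) * \<bar>b\<bar> powr (- 1 / 2))"
        unfolding pw p_def q_def by simp
      finally show ?thesis .
    qed
    finally have "\<bar>ball_kernel (axis 3 1) (axis 1 1) y\<bar> \<le> 2 * (\<bar>a\<bar> powr (- 1 / 2) * \<bar>b\<bar> powr (- 1 / 2))"
      using True by (simp add: ball_kernel_def inner_axis a_def c_def)
    then have "ennreal \<bar>ball_kernel (axis 3 1) (axis 1 1) y\<bar> \<le> 2 * (ennreal (\<bar>a\<bar> powr (- 1 / 2)) * ennreal (\<bar>b\<bar> powr (- 1 / 2)))"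
      by (metis ennreal_leI ennreal_mult ennreal_mult' ennreal_numeral powr_ge_zero zero_le_numeral mult_nonneg_nonneg)
    moreover have "a \<in> {- 1..1}" "b \<in> {- 1..1}" "c \<in> {- 1..1}" using abs n1 by auto
    ultimately show ?thesis by (simp add: a_def b_def c_def)
  qed
  \<comment> \<open>On the plane \<open>y $ 2 = 0\<close> the majorant is 0, because
    \<open>0 powr x = 0\<close>, so the bound may fail there; the plane is a null set. For
    \<open>y $ 1 = 0\<close> the kernel itself vanishes.\<close>
  have null: "AE y in (lborel :: (real^3) measure). y $ 2 \<noteq> (0 :: real)"
  proof -
    have "{y :: real^3. y $ 2 = 0} \<in> null_sets lebesgue"
      using negligible_standard_hyperplane_cart[of 2] by (simp add: negligible_iff_null_sets)
    then have "AE y in (lebesgue :: (real^3) measure). y $ 2 \<noteq> (0 :: real)"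
      by (intro AE_I'[of "{y :: real^3. y $ 2 = 0}"]) auto
    then show ?thesis by (simp add: AE_completion_iff)
  qed
  have "(\<integral>\<^sup>+y. ennreal \<bar>ball_kernel (axis 3 1) (axis 1 1) y\<bar> \<partial>lborel) \<le>
      (\<integral>\<^sup>+y. 2 * (?g (y $ 1) * ?g (y $ 2) * ?h (y $ 3)) \<partial>(lborel :: (real^3) measure))"
    by (rule nn_integral_mono_AE) (use null bound in \<open>auto elim!: eventually_mono\<close>)
  also have "\<dots> = (\<integral>\<^sup>+w. \<integral>\<^sup>+c. 2 * (?g (fst w) * ?g (snd w) * ?h c) \<partial>lborel \<partial>lborel)"
    by (subst nn_integral_real3) auto
  also have "\<dots> = (\<integral>\<^sup>+w. ?g (fst w) * ?g (snd w) * 4 \<partial>lborel)"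
  proof (rule nn_integral_cong)
    fix w :: "real \<times> real"
    have "(\<integral>\<^sup>+c. 2 * (?g (fst w) * ?g (snd w) * ?h c) \<partial>lborel) =
        2 * (?g (fst w) * ?g (snd w)) * (\<integral>\<^sup>+c. ?h c \<partial>lborel)"
      by (subst nn_integral_cmult[symmetric]) (auto simp: mult.assoc)
    then show "(\<integral>\<^sup>+c. 2 * (?g (fst w) * ?g (snd w) * ?h c) \<partial>lborel) = ?g (fst w) * ?g (snd w) * 4"
      by (simp add: algebra_simps)
  qed
  also have "\<dots> = (\<integral>\<^sup>+a. \<integral>\<^sup>+b. ?g a * ?g b * 4 \<partial>lborel \<partial>lborel)"
    unfolding lborel_prod[symmetric] by (subst lborel.nn_integral_fst[symmetric]) auto
  also have "\<dots> = (\<integral>\<^sup>+a. ?g a \<partial>lborel) * (\<integral>\<^sup>+a. ?g a \<partial>lborel) * 4"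
    by (simp add: nn_integral_cmult nn_integral_multc)
  also have "\<dots> < \<infinity>"
    using nn_integral_inverse_sqrt_finite by (simp add: ennreal_mult_less_top)
  finally show ?thesis .
qed

text \<open>An orthogonal map carries the coordinate axes to the frame \<open>n\<close>,
  \<open>cross3 x n\<close>, \<open>x\<close>. The absolute integral is thus the same at every point
  of the curve, a uniformity that Fubini's theorem will call for.\<close>

lemma ball_kernel_nn_integral:
  assumes "x \<bullet> x = 1" "n \<bullet> n = 1" "x \<bullet> n = 0"
  shows "(\<integral>\<^sup>+y. ennreal \<bar>ball_kernel x n y\<bar> \<partial>lborel) =
    (\<integral>\<^sup>+y. ennreal \<bar>ball_kernel (axis 3 1) (axis 1 1) y\<bar> \<partial>lborel)"
proof -
  define m where "m = cross3 x n"
  have m: "m \<bullet> m = 1" "m \<bullet> x = 0" "m \<bullet> n = 0" "x \<bullet> m = 0" "n \<bullet> m = 0" "n \<bullet> x = 0"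
    using assms norm_cross[of x n] by (auto simp: m_def dot_cross_self power2_norm_eq_inner inner_commute)
  define g where "g a = (a $ 1) *\<^sub>R n + (a $ 2) *\<^sub>R m + (a $ 3) *\<^sub>R x" for a :: "real^3"
  have ip: "g a \<bullet> g b = a \<bullet> b" for a b
  proof -
    have "a \<bullet> b = a $ 1 * b $ 1 + a $ 2 * b $ 2 + a $ 3 * b $ 3"
      by (simp add: inner_vec_def sum_3)
    then show ?thesis using m assms by (simp add: g_def inner_add_left inner_add_right)
  qed
  have "linear g"
    by (intro linearI) (simp_all add: g_def algebra_simps)
  then have g: "orthogonal_transformation g"
    using ip by (simp add: orthogonal_transformation_def)
  have gn: "norm (g a) = norm a" for a using ip[of a a] by (simp add: norm_eq_sqrt_inner)
  have eq: "ball_kernel x n (g a) = ball_kernel (axis 3 1) (axis 1 1) a" for a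
    using m assms by (simp add: ball_kernel_def gn inner_axis indicator_def)
      (simp add: g_def inner_add_left)
  have "(\<integral>\<^sup>+y. ennreal \<bar>ball_kernel x n y\<bar> \<partial>lborel) =
      (\<integral>\<^sup>+y. ennreal \<bar>ball_kernel x n y\<bar> \<partial>(distr lborel borel g))"
    by (simp add: lborel_distr_orthogonal[OF g])
  also have "\<dots> = (\<integral>\<^sup>+a. ennreal \<bar>ball_kernel x n (g a)\<bar> \<partial>lborel)"
    using borel_measurable_orthogonal[OF g] by (subst nn_integral_distr) auto
  finally show ?thesis by (simp add: eq)
qed

lemma ball_kernel_integrable:
  assumes "x \<bullet> x = 1" "n \<bullet> n = 1" "x \<bullet> n = 0"
  shows "integrable lborel (ball_kernel x n)"
  using ball_kernel_nn_integral[OF assms] ball_kernel_axis_finite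
  by (intro integrableI_bounded) auto

text \<open>The kernel is odd under the reflection in the plane orthogonal to \<open>n\<close>.\<close>

lemma ball_kernel_integral:
  assumes "x \<bullet> x = 1" "n \<bullet> n = 1" "x \<bullet> n = 0"
  shows "(\<integral>y. ball_kernel x n y \<partial>lborel) = 0"
proof -
  define g where "g a = a - (2 * (a \<bullet> n)) *\<^sub>R n" for a :: "real^3"
  have ip: "g a \<bullet> g b = a \<bullet> b" for a b
    using assms by (simp add: g_def inner_diff_left inner_diff_right inner_commute)
  have "linear g"
    by (intro linearI) (simp_all add: g_def algebra_simps inner_add_left)
  then have g: "orthogonal_transformation g"
    using ip by (simp add: orthogonal_transformation_def)
  have gn: "norm (g a) = norm a" for a using ip[of a a] by (simp add: norm_eq_sqrt_inner)
  have "g a \<bullet> x = a \<bullet> x" "g a \<bullet> n = - (a \<bullet> n)" for a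
    using assms by (simp_all add: g_def inner_diff_left inner_commute[of n x])
  then have eq: "ball_kernel x n (g a) = - ball_kernel x n a" for a
    by (simp add: ball_kernel_def gn indicator_def)
  have "(\<integral>y. ball_kernel x n y \<partial>lborel) = (\<integral>y. ball_kernel x n y \<partial>(distr lborel borel g))"
    by (simp add: lborel_distr_orthogonal[OF g])
  also have "\<dots> = (\<integral>a. ball_kernel x n (g a) \<partial>lborel)"
    using borel_measurable_orthogonal[OF g] by (subst integral_distr) auto
  finally show ?thesis by (simp add: eq)
qed

section \<open>Gauss--Bonnet\<close>

context spherical_frame
begin

section \<open>Values of the potential at points off the curve\<close>

lemma curve_frac: "\<gamma> (frac t) = \<gamma> t"
  using periodic_add_int[of \<gamma> t "- \<lfloor>t\<rfloor>"] periodic(1) by (simp add: frac_def)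

lemma range_curve: "range \<gamma> = \<gamma> ` {0..1}"
proof -
  have "\<gamma> t \<in> \<gamma> ` {0..1}" for t
    using curve_frac[of t] frac_ge_0[of t] frac_lt_1[of t]
    by (metis atLeastAtMost_iff image_eqI less_imp_le)
  then show ?thesis by auto
qed

lemma compact_range: "compact (range \<gamma>)"
  unfolding range_curve by (intro compact_continuous_image continuous_frame compact_Icc)

lemma continuous_potential: "continuous_on {z. z \<bullet> z = 1 \<and> z \<notin> range \<gamma>} potential"
  using integral_continuous_on_param[of "{z. z \<bullet> z = 1 \<and> z \<notin> range \<gamma>}" 0 1 kernel]
    continuous_kernel[of "{0..1}"] unfolding potential_def[abs_def] by simp

lemma potential_constant_on:
  assumes "connected S" "S \<subseteq> {z. z \<bullet> z = 1 \<and> z \<notin> range \<gamma>}"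
  shows "potential constant_on S"
proof -
  have "(\<lambda>z. \<i> * complex_of_real (total_curvature + potential z)) constant_on S"
  proof (rule constant_of_exp_eq_1[OF assms(1)])
    show "continuous_on S (\<lambda>z. \<i> * complex_of_real (total_curvature + potential z))"
      by (intro continuous_intros continuous_on_subset[OF continuous_potential assms(2)])
    fix z assume "z \<in> S"
    then have z: "z \<bullet> z = 1" "z \<notin> range \<gamma>" using assms(2) by auto
    have "integral {0..1} (\<lambda>t. v t * k t + kernel z t) = total_curvature + potential z"
      unfolding total_curvature_def potential_def
      by (intro integral_add integrable_continuous_real continuous_intros continuous_frame
          continuous_kernel_snd z)
    then show "exp (\<i> * complex_of_real (total_curvature + potential z)) = 1"
      using total_angle_off_curve[OF z] by simp
  qed
  then obtain c where "\<i> * complex_of_real (total_curvature + potential z) = c" if "z \<in> S" for z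
    unfolding constant_on_def by blast
  then have "potential z = Im c - total_curvature" if "z \<in> S" for z
    using that by (force simp: complex_eq_iff)
  then show ?thesis unfolding constant_on_def by blast
qed

lemma connected_pushed: "connected (pushed_point \<sigma> s ` {0<..a})"
  unfolding pushed_point_def
  by (intro connected_continuous_image continuous_intros) (simp add: connected_iff_interval)

text \<open>The arc avoids the curve, so the potential is constant along it; the constant is the
  limit at the foot of the arc, which the jump relation gives for the side
  \<open>\<sigma>\<close>.\<close>

lemma potential_pushed:
  assumes \<sigma>: "\<bar>\<sigma>\<bar> = 1" and a: "0 < a"
    and off: "\<And>h. 0 < h \<Longrightarrow> h \<le> a \<Longrightarrow> pushed_point \<sigma> s h \<notin> range \<gamma>"
  shows "potential (pushed_point \<sigma> s a) = - total_curvature + 2 * pi * \<sigma>"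
proof -
  have "\<sigma>\<^sup>2 = 1" using \<sigma> by (metis power2_abs power_one)
  then have "potential constant_on (pushed_point \<sigma> s ` {0<..a})"
    by (intro potential_constant_on connected_pushed image_subsetI)
      (simp add: off pushed_point_unit)
  then have c: "potential (pushed_point \<sigma> s x) = potential (pushed_point \<sigma> s a)"
    if "0 < x" "x \<le> a" for x
    using that a unfolding constant_on_def by (metis greaterThanAtMost_iff imageI order_refl)
  obtain h where h: "\<And>n :: nat. 0 < h n" "h \<longlonglongrightarrow> 0"
    "(\<lambda>n. potential (pushed_point \<sigma> s (h n))) \<longlonglongrightarrow> - total_curvature + 2 * pi * \<sigma>"
    using potential_jump[OF \<sigma>] by blast
  have "\<forall>\<^sub>F n in sequentially. h n < a" using order_tendstoD(2)[OF h(2) a] .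
  then have "\<forall>\<^sub>F n in sequentially. potential (pushed_point \<sigma> s (h n)) = potential (pushed_point \<sigma> s a)"
    by (rule eventually_mono) (use c h(1) less_imp_le in blast)
  from Lim_transform_eventually[OF h(3) this] show ?thesis
    using LIMSEQ_unique tendsto_const by blast
qed

text \<open>The minimizing geodesic from a point to the curve meets the curve orthogonally and only at
  its end.\<close>

lemma pushed_from_nearest_point:
  assumes z: "z \<bullet> z = 1" "z \<notin> range \<gamma>"
  obtains s \<sigma> a where "\<bar>\<sigma>\<bar> = 1" "0 < a" "z = pushed_point \<sigma> s a"
    "\<And>h. 0 < h \<Longrightarrow> h \<le> a \<Longrightarrow> pushed_point \<sigma> s h \<notin> range \<gamma>"
proof -
  \<comment> \<open>A maximum of \<open>z \<bullet> \<gamma>\<close> is a point of the curve nearest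
    to \<open>z\<close>.\<close>
  have "\<exists>s\<in>{0..1}. \<forall>t\<in>{0..1}. z \<bullet> \<gamma> t \<le> z \<bullet> \<gamma> s"
    by (intro continuous_attains_sup continuous_intros continuous_frame) auto
  then obtain s where "\<forall>t\<in>{0..1}. z \<bullet> \<gamma> t \<le> z \<bullet> \<gamma> s" by blast
  then have max: "z \<bullet> \<gamma> t \<le> z \<bullet> \<gamma> s" for t
    using curve_frac[of t] frac_ge_0[of t] frac_lt_1[of t] by (metis atLeastAtMost_iff less_imp_le)
  have "v s * (z \<bullet> T s) = 0"
    using DERIV_local_max[OF derivs_inner(1)[of z s], of 1] max by simp
  then have zT: "z \<bullet> T s = 0" using speed_pos[of s] by simp
  define c d where "c = z \<bullet> \<gamma> s" and "d = z \<bullet> \<nu> s"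
  have zcd: "z = c *\<^sub>R \<gamma> s + d *\<^sub>R \<nu> s"
    using frame_expansion[of z s] zT by (simp add: c_def d_def)
  have cd: "c\<^sup>2 + d\<^sup>2 = 1"
    using inner_frame[of z z s] zT z(1) by (simp add: c_def d_def power2_eq_square)
  have c1: "c \<noteq> 1" using inner_eq_1_iff[OF z(1), of s] z(2) by (auto simp: c_def)
  \<comment> \<open>If the nearest point were \<open>- z\<close>, every point of the curve would be
    at the maximal distance pi, and the curve would be constant.\<close>
  have cm1: "c \<noteq> - 1"
  proof
    assume c: "c = - 1"
    have "\<gamma> t = - z" for t
    proof -
      have "z \<bullet> \<gamma> t \<le> - 1" using max[of t] c by (simp add: c_def)
      moreover have "\<bar>z \<bullet> \<gamma> t\<bar> \<le> 1"
        using Cauchy_Schwarz_ineq2[of z "\<gamma> t"] z(1) orthonormal(1)[of t] by (simp add: norm_eq_sqrt_inner)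
      ultimately have "(- z) \<bullet> \<gamma> t = 1" by simp
      then show ?thesis using inner_eq_1_iff[of "- z" t] z(1) by simp
    qed
    then have "(1/2 :: real) - 0 \<in> \<int>" using simple[of "1/2" 0] by simp
    then obtain n where "(1/2 :: real) = of_int n" by (auto elim: Ints_cases)
    then have "real_of_int (2 * n) = real_of_int 1" by simp
    then have "2 * n = 1" unfolding of_int_eq_iff .
    then show False by presburger
  qed
  have "c\<^sup>2 \<le> 1" using cd zero_le_power2[of d] by linarith
  then have "\<bar>c\<bar> \<le> 1" by (simp add: abs_square_le_1)
  then have c: "- 1 < c" "c < 1" using c1 cm1 by (auto simp: abs_le_iff)
  define a where "a = arccos c"
  have a: "0 < a" "a < pi" "cos a = c"
    using c arccos_lt_bounded[of c] by (auto simp: a_def)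
  have sa: "sin a > 0" using a by (simp add: sin_gt_zero)
  have "(sin a)\<^sup>2 = d\<^sup>2" using cd a(3) sin_cos_squared_add[of a] by simp
  then have sd: "sin a = \<bar>d\<bar>" using sa by (metis abs_of_pos power2_eq_iff abs_minus_cancel)
  \<comment> \<open>The sign of the normal component of \<open>z\<close> is the side on which the
    minimizing geodesic leaves the curve.\<close>
  define \<sigma> where "\<sigma> = sgn d"
  have d: "d \<noteq> 0" using sd sa by auto
  then have \<sigma>: "\<bar>\<sigma>\<bar> = 1" "\<sigma> * sin a = d" using sd by (auto simp: \<sigma>_def sgn_if)
  show thesis
  proof (rule that[OF \<sigma>(1) a(1)])
    show "z = pushed_point \<sigma> s a" using zcd \<sigma>(2) a(3) by (simp add: pushed_point_def)
    fix h assume h: "0 < h" "h \<le> a"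
    show "pushed_point \<sigma> s h \<notin> range \<gamma>"
    proof
      assume "pushed_point \<sigma> s h \<in> range \<gamma>"
      then obtain t where t: "\<gamma> t = pushed_point \<sigma> s h" by auto
      have "\<sigma> * d = sin a" using sd d by (simp add: \<sigma>_def sgn_if)
      \<comment> \<open>The point has distance \<open>a - h\<close> from \<open>z\<close>; on the
        curve it would be nearer than the nearest point.\<close>
      then have "z \<bullet> \<gamma> t = cos a * cos h + sin a * sin h"
        unfolding t pushed_point_def by (simp add: inner_add_right c_def[symmetric] d_def[symmetric] a(3) mult_ac)
      also have "\<dots> = cos (a - h)" by (simp add: cos_diff)
      finally have "cos (a - h) \<le> cos a" using max[of t] a(3) by (simp add: c_def)
      moreover have "cos a < cos (a - h)" using h a by (intro cos_monotone_0_pi) auto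
      ultimately show False by simp
    qed
  qed
qed

text \<open>The arc from the nearest point to \<open>z\<close> is connected and avoids the curve, so
  it lies inside \<open>\<Omega>\<close> or misses it. Since \<open>sides\<close> decides which for
  a point of the arc close to the curve, the sign \<open>\<sigma>\<close> tells whether
  \<open>z\<close> belongs to \<open>\<Omega>\<close>.\<close>

lemma potential_off_curve:
  assumes \<Omega>: "\<Omega> \<in> components (sphere 0 1 - range \<gamma>)"
    and sides: "\<And>t. \<forall>\<^sub>F h in at_right 0. cos h *\<^sub>R \<gamma> t - sin h *\<^sub>R \<nu> t \<in> \<Omega> \<and>
      cos h *\<^sub>R \<gamma> t + sin h *\<^sub>R \<nu> t \<notin> \<Omega>"
    and z: "z \<bullet> z = 1" "z \<notin> range \<gamma>"
  shows "potential z = - total_curvature + (if z \<in> \<Omega> then - 2 * pi else 2 * pi)"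
proof -
  obtain s \<sigma> a where \<sigma>: "\<bar>\<sigma>\<bar> = 1" and a: "0 < a" and za: "z = pushed_point \<sigma> s a"
    and off: "\<And>h. 0 < h \<Longrightarrow> h \<le> a \<Longrightarrow> pushed_point \<sigma> s h \<notin> range \<gamma>"
    using pushed_from_nearest_point[OF z] by metis
  have \<sigma>2: "\<sigma>\<^sup>2 = 1" using \<sigma> by (metis power2_abs power_one)
  let ?S = "pushed_point \<sigma> s ` {0<..a}"
  have sub: "?S \<subseteq> sphere 0 1 - range \<gamma>"
    by (rule image_subsetI) (simp add: off pushed_point_unit[OF \<sigma>2] norm_eq_1)
  have zS: "z \<in> ?S" using za a by auto
  have max: "?S \<subseteq> \<Omega>" if "x \<in> ?S" "x \<in> \<Omega>" for x
    using components_maximal[OF \<Omega> connected_pushed sub] that by blast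
  have "\<forall>\<^sub>F h in at_right 0. h < a" using a by (auto simp: eventually_at_right_field)
  from eventually_conj[OF eventually_conj[OF this sides[of s]] eventually_at_right_less[of 0]]
  obtain h where h: "h < a" "cos h *\<^sub>R \<gamma> s - sin h *\<^sub>R \<nu> s \<in> \<Omega>" "cos h *\<^sub>R \<gamma> s + sin h *\<^sub>R \<nu> s \<notin> \<Omega>" "0 < h"
    using eventually_happens'[OF trivial_limit_at_right_real] by (metis (no_types, lifting))
  have hS: "pushed_point \<sigma> s h \<in> ?S" using h by auto
  have P: "potential z = - total_curvature + 2 * pi * \<sigma>"
    unfolding za by (rule potential_pushed[OF \<sigma> a off])
  consider "\<sigma> = 1" | "\<sigma> = - 1" using \<sigma> by linarith
  then show ?thesis
  proof cases
    case 1
    then have "pushed_point \<sigma> s h \<notin> \<Omega>" using h by (simp add: pushed_point_def)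
    then have "z \<notin> \<Omega>" using max[OF zS] hS by blast
    then show ?thesis using P 1 by simp
  next
    case 2
    then have "pushed_point \<sigma> s h \<in> \<Omega>" using h by (simp add: pushed_point_def)
    then have "z \<in> \<Omega>" using max[OF hS] zS by blast
    then show ?thesis using P 2 by simp
  qed
qed

text \<open>The cone over the curve is contained in the image of the plane under the differentiable
  map \<open>(t, r) \<mapsto> r \<gamma> t\<close>, which is a null set in dimension three.\<close>

lemma AE_off_cone: "AE y in lborel. y \<noteq> 0 \<and> y /\<^sub>R norm y \<notin> range \<gamma>"
proof -
  let ?f = "\<lambda>p :: real \<times> real. snd p *\<^sub>R \<gamma> (fst p)"
  have "?f differentiable_on UNIV"
  proof -
    have "\<gamma> differentiable (at x within A)" for x A
      using deriv_curve[of x] by (meson differentiableI_vector differentiable_at_withinI)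
    then have "(\<lambda>p. \<gamma> (fst p)) differentiable (at p within UNIV)" for p :: "real \<times> real"
      using differentiable_chain_within[of fst p UNIV \<gamma>]
      by (simp add: bounded_linear_fst bounded_linear_imp_differentiable o_def)
    then show ?thesis
      unfolding differentiable_on_def
      by (intro ballI differentiable_scaleR)
        (simp_all add: bounded_linear_imp_differentiable bounded_linear_snd)
  qed
  then have "negligible (range ?f)"
    by (intro negligible_differentiable_image_lowdim) auto
  then have "AE y in lebesgue. y \<notin> range ?f"
    by (intro AE_I'[of "range ?f"]) (auto simp: negligible_iff_null_sets)
  then have "AE y in lborel. y \<notin> range ?f" by (simp add: AE_completion_iff)
  then show ?thesis
  proof (rule eventually_mono)
    fix y assume y: "y \<notin> range ?f"
    show "y \<noteq> 0 \<and> y /\<^sub>R norm y \<notin> range \<gamma>"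
    proof (intro conjI notI)
      assume "y = 0"
      then have "y = ?f (0, 0)" by simp
      then show False using y by blast
    next
      assume "y /\<^sub>R norm y \<in> range \<gamma>"
      then obtain t where "y /\<^sub>R norm y = \<gamma> t" by auto
      moreover have "y = norm y *\<^sub>R (y /\<^sub>R norm y)" by (cases "y = 0") auto
      ultimately have "y = ?f (t, norm y)" by simp
      then show False using y by blast
    qed
  qed
qed

text \<open>The kernel of the ball at \<open>y\<close> is that of the sphere at
  \<open>z = y / norm y\<close>. Off the cone \<open>z\<close> is off the curve, so the integral
  over \<open>t\<close> has a continuous integrand.\<close>

lemma AE_potential_ball:
  "AE y in lborel. (\<integral>t. indicator {0..1} t * v t * ball_kernel (\<gamma> t) (\<nu> t) y \<partial>lborel) =
    indicator (ball 0 1) y * potential (y /\<^sub>R norm y)"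
  using AE_off_cone
proof (rule eventually_mono)
  fix y assume y: "y \<noteq> 0 \<and> y /\<^sub>R norm y \<notin> range \<gamma>"
  define z where "z = y /\<^sub>R norm y"
  have z: "z \<bullet> z = 1" "z \<notin> range \<gamma>"
    using y by (simp_all add: z_def dot_square_norm power2_eq_square)
  have "v t * ball_kernel (\<gamma> t) (\<nu> t) y = indicator (ball 0 1) y * kernel z t" for t
  proof -
    have "1 - z \<bullet> \<gamma> t = (norm y - y \<bullet> \<gamma> t) / norm y"
      using y by (simp add: z_def field_simps)
    then show ?thesis using y by (simp add: ball_kernel_def kernel_def z_def field_simps)
  qed
  then have "indicator {0..1} t * v t * ball_kernel (\<gamma> t) (\<nu> t) y =
      indicator (ball 0 1) y * (indicator {0..1} t * kernel z t)" for t
    unfolding mult.assoc by (simp add: mult.left_commute)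
  then have "(\<integral>t. indicator {0..1} t * v t * ball_kernel (\<gamma> t) (\<nu> t) y \<partial>lborel) =
      (\<integral>t. indicator (ball 0 1) y * (indicator {0..1} t * kernel z t) \<partial>lborel)"
    by presburger
  also have "\<dots> = indicator (ball 0 1) y * (LINT t:{0..1}|lborel. kernel z t)"
    by (simp add: set_lebesgue_integral_def)
  also have "(LINT t:{0..1}|lborel. kernel z t) = potential z"
    unfolding potential_def
    by (intro set_borel_integral_eq_integral(2) borel_integrable_atLeastAtMost' continuous_kernel_snd z)
  finally show "(\<integral>t. indicator {0..1} t * v t * ball_kernel (\<gamma> t) (\<nu> t) y \<partial>lborel) =
      indicator (ball 0 1) y * potential (y /\<^sub>R norm y)" by (simp add: z_def)
qed

text \<open>Fubini's theorem applies because the absolute integral over the ball is one number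
  \<open>M\<close> for all \<open>t\<close>. In the exchanged order every inner integral vanishes by
  oddness.\<close>

lemma ball_integral_of_potential:
  shows "integrable lborel (\<lambda>y. \<integral>t. indicator {0..1} t * v t * ball_kernel (\<gamma> t) (\<nu> t) y \<partial>lborel)"
    and "(\<integral>y. (\<integral>t. indicator {0..1} t * v t * ball_kernel (\<gamma> t) (\<nu> t) y \<partial>lborel) \<partial>lborel) = 0"
proof -
  define f where "f t y = indicator {0..1} t * v t * ball_kernel (\<gamma> t) (\<nu> t) y" for t y
  define M where "M = (\<integral>y. \<bar>ball_kernel (axis 3 1) (axis 1 1) y\<bar> \<partial>lborel)"
  have on: "\<gamma> t \<bullet> \<gamma> t = 1" "\<nu> t \<bullet> \<nu> t = 1" "\<gamma> t \<bullet> \<nu> t = 0" for t using orthonormal by auto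
  have M: "(\<integral>y. \<bar>ball_kernel (\<gamma> t) (\<nu> t) y\<bar> \<partial>lborel) = M" for t
    unfolding M_def using ball_kernel_nn_integral[OF on] by (simp add: integral_eq_nn_integral)
  have m1: "(\<lambda>p. \<gamma> (fst p)) \<in> borel_measurable (lborel \<Otimes>\<^sub>M lborel)"
    "(\<lambda>p. \<nu> (fst p)) \<in> borel_measurable (lborel \<Otimes>\<^sub>M lborel)"
    "(\<lambda>p. v (fst p)) \<in> borel_measurable (lborel \<Otimes>\<^sub>M lborel)"
    by (rule measurable_compose[OF measurable_fst], simp add: measurable_frame)+
  have m4: "(\<lambda>p. indicator {0..1} (fst p :: real) :: real) \<in> borel_measurable (lborel \<Otimes>\<^sub>M lborel)"
    by (rule measurable_compose[OF measurable_fst]) measurable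
  have m2: "(\<lambda>p. indicator (ball 0 1) (snd p :: real^3) :: real) \<in> borel_measurable (lborel \<Otimes>\<^sub>M lborel)"
    by (rule measurable_compose[OF measurable_snd], rule borel_measurable_indicator) simp
  have m3: "(\<lambda>p. snd p) \<in> borel_measurable (lborel \<Otimes>\<^sub>M (lborel :: (real^3) measure))" by simp
  have m5: "(\<lambda>p. norm (snd p)) \<in> borel_measurable (lborel \<Otimes>\<^sub>M (lborel :: (real^3) measure))"
    using measurable_compose[OF m3 borel_measurable_continuous_onI[OF continuous_on_norm[OF continuous_on_id]]] .
  have meas: "case_prod f \<in> borel_measurable (lborel \<Otimes>\<^sub>M lborel)"
    unfolding f_def ball_kernel_def case_prod_beta'
    by (intro borel_measurable_times borel_measurable_divide borel_measurable_diff
        borel_measurable_inner m1 m2 m3 m4 m5)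
  have int: "integrable lborel (f t)" for t
    unfolding f_def by (intro integrable_mult_right ball_kernel_integrable on)
  have int: "integrable (lborel \<Otimes>\<^sub>M lborel) (case_prod f)"
  proof (rule lborel_pair.Fubini_integrable[OF meas])
    have "(\<integral>y. norm (case_prod f (t, y)) \<partial>lborel) = indicator {0..1} t *\<^sub>R (v t * M)" for t
      using speed_pos[of t] M[of t] by (simp add: f_def abs_mult mult.assoc)
    moreover have "integrable lborel (\<lambda>t. indicator {0..1} t *\<^sub>R (v t * M))"
      unfolding set_integrable_def[symmetric]
      by (intro borel_integrable_atLeastAtMost' continuous_intros continuous_frame)
    ultimately show "integrable lborel (\<lambda>t. \<integral>y. norm (case_prod f (t, y)) \<partial>lborel)" by simp
    show "AE t in lborel. integrable lborel (\<lambda>y. case_prod f (t, y))" using int by simp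
  qed
  show "integrable lborel (\<lambda>y. \<integral>t. indicator {0..1} t * v t * ball_kernel (\<gamma> t) (\<nu> t) y \<partial>lborel)"
    using lborel_pair.integrable_snd[OF int] by (simp add: f_def)
  from lborel_pair.Fubini_integral[OF int]
  have "(\<integral>y. (\<integral>t. f t y \<partial>lborel) \<partial>lborel) = (\<integral>t. (\<integral>y. f t y \<partial>lborel) \<partial>lborel)" .
  also have "\<dots> = 0" by (simp add: f_def ball_kernel_integral[OF on])
  finally show "(\<integral>y. (\<integral>t. indicator {0..1} t * v t * ball_kernel (\<gamma> t) (\<nu> t) y \<partial>lborel) \<partial>lborel) = 0"
    by (simp add: f_def)
qed

text \<open>Almost everywhere in the ball the averaged function is its outside value
  \<open>2 pi - total_curvature\<close>, lowered by the jump \<open>4 pi\<close> on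
  \<open>C\<close>. Its mean is 0 and the ball has volume \<open>4 pi / 3\<close>, so the jump
  relation turns into a formula for the volume of \<open>C\<close>.\<close>

theorem Gauss_Bonnet_cone:
  assumes \<Omega>: "\<Omega> \<in> components (sphere 0 1 - range \<gamma>)"
    and sides: "\<And>t. \<forall>\<^sub>F h in at_right 0. cos h *\<^sub>R \<gamma> t - sin h *\<^sub>R \<nu> t \<in> \<Omega> \<and>
      cos h *\<^sub>R \<gamma> t + sin h *\<^sub>R \<nu> t \<notin> \<Omega>"
    and C: "C = {y. y \<noteq> 0 \<and> norm y < 1 \<and> y /\<^sub>R norm y \<in> \<Omega>}" "C \<in> sets borel"
  shows "total_curvature = 2 * pi - 3 * measure lborel C"
proof -
  let ?B = "ball 0 1 :: (real^3) set"
  have CB: "C \<subseteq> ?B" using C by auto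
  have fin: "emeasure lborel ?B < \<infinity>" "emeasure lborel C < \<infinity>"
    using emeasure_bounded_finite[of ?B] emeasure_bounded_finite[of C] bounded_subset[OF bounded_ball CB]
    by auto
  have "AE y in lborel. (\<integral>t. indicator {0..1} t * v t * ball_kernel (\<gamma> t) (\<nu> t) y \<partial>lborel) =
      (- total_curvature + 2 * pi) * indicator ?B y - 4 * pi * indicator C y"
    using AE_potential_ball AE_off_cone
  proof eventually_elim
    fix y assume y: "y \<noteq> 0 \<and> y /\<^sub>R norm y \<notin> range \<gamma>" and
      eq: "(\<integral>t. indicator {0..1} t * v t * ball_kernel (\<gamma> t) (\<nu> t) y \<partial>lborel) =
        indicator ?B y * potential (y /\<^sub>R norm y)"
    have "(y /\<^sub>R norm y) \<bullet> (y /\<^sub>R norm y) = 1"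
      using y by (simp add: dot_square_norm power2_eq_square)
    from potential_off_curve[OF \<Omega> sides this] y
    have "potential (y /\<^sub>R norm y) = - total_curvature + (if y /\<^sub>R norm y \<in> \<Omega> then - 2 * pi else 2 * pi)"
      by blast
    then show "(\<integral>t. indicator {0..1} t * v t * ball_kernel (\<gamma> t) (\<nu> t) y \<partial>lborel) =
      (- total_curvature + 2 * pi) * indicator ?B y - 4 * pi * indicator C y"
      unfolding eq using y by (simp add: C(1) indicator_def)
  qed
  then have "(\<integral>y. (\<integral>t. indicator {0..1} t * v t * ball_kernel (\<gamma> t) (\<nu> t) y \<partial>lborel) \<partial>lborel) =
      (\<integral>y. (- total_curvature + 2 * pi) * indicator ?B y - 4 * pi * indicator C y \<partial>lborel)"
    using ball_integral_of_potential(1) C(2)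
    by (intro integral_cong_AE borel_measurable_diff borel_measurable_times borel_measurable_const
        borel_measurable_indicator) auto
  also have "\<dots> = (- total_curvature + 2 * pi) * measure lborel ?B - 4 * pi * measure lborel C"
    using C(2) fin by (subst Bochner_Integration.integral_diff) auto
  also have "measure lborel ?B = 4 / 3 * pi"
    by (simp add: content_ball unit_ball_vol_3)
  finally have "(- total_curvature + 2 * pi) * (4 / 3 * pi) = 4 * pi * measure lborel C"
    using ball_integral_of_potential(2) by simp
  then have "pi * (- total_curvature + 2 * pi) = pi * (3 * measure lborel C)" by simp
  then show ?thesis by (simp only: mult_cancel_left) (use pi_gt_zero in auto)
qed

end

section \<open>Area as the volume of a cone\<close>

text \<open>Polar coordinates: the first two entries of \<open>p\<close> are the chart parameter,
  the third is the radius.\<close>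

definition dilated_chart :: "real^3 \<Rightarrow> real^3" where
  "dilated_chart p = (p $ 3) *\<^sub>R stereographic_chart (p $ 1, p $ 2)"

text \<open>The partial derivative of \<open>stereographic_chart\<close> in its first parameter;
  \<open>chart_v\<close> is the one in the second.\<close>

definition chart_u :: "real \<times> real \<Rightarrow> real^3" where
  "chart_u = (\<lambda>(u, v). (2 / (1 + u\<^sup>2 + v\<^sup>2)\<^sup>2) *\<^sub>R vector [1 - u\<^sup>2 + v\<^sup>2, - 2 * u * v, 2 * u])"

definition chart_v :: "real \<times> real \<Rightarrow> real^3" where
  "chart_v = (\<lambda>(u, v). (2 / (1 + u\<^sup>2 + v\<^sup>2)\<^sup>2) *\<^sub>R vector [- 2 * u * v, 1 + u\<^sup>2 - v\<^sup>2, 2 * v])"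

lemma chart_denominator: "1 + u\<^sup>2 + v\<^sup>2 > (0 :: real)"
  by (simp add: add_pos_nonneg)

lemma stereographic_chart_component:
  "stereographic_chart (u, v) $ 1 = 2 * u / (1 + u\<^sup>2 + v\<^sup>2)"
  "stereographic_chart (u, v) $ 2 = 2 * v / (1 + u\<^sup>2 + v\<^sup>2)"
  "stereographic_chart (u, v) $ 3 = (u\<^sup>2 + v\<^sup>2 - 1) / (1 + u\<^sup>2 + v\<^sup>2)"
  by (simp_all add: stereographic_chart_def)

lemma has_derivative_stereographic_chart:
  "(stereographic_chart has_derivative (\<lambda>h. fst h *\<^sub>R chart_u (u, v) + snd h *\<^sub>R chart_v (u, v))) (at (u, v))"
proof -
  define e where "e = inverse (1 + u\<^sup>2 + v\<^sup>2)"
  have D: "1 + u\<^sup>2 + v\<^sup>2 \<noteq> 0" using chart_denominator[of u v] by simp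
  then have e: "e * (1 + u\<^sup>2 + v\<^sup>2) = 1" by (simp add: e_def)
  have coeff: "2 / (1 + u\<^sup>2 + v\<^sup>2)\<^sup>2 = 2 * e\<^sup>2" by (simp add: e_def power_inverse divide_inverse)
  have u: "(fst has_derivative fst) (at (u, v))" and v: "(snd has_derivative snd) (at (u, v))"
    for u v :: real
    by (rule bounded_linear_imp_has_derivative, rule bounded_linear_fst bounded_linear_snd)+
  have P: "((\<lambda>x. 1 + (fst x)\<^sup>2 + (snd x)\<^sup>2) has_derivative (\<lambda>h. 2 * u * fst h + 2 * v * snd h)) (at (u, v))"
    by (rule has_derivative_eq_rhs, (rule derivative_intros u v)+) (simp add: fun_eq_iff)
  have inv: "((\<lambda>x. inverse (1 + (fst x)\<^sup>2 + (snd x)\<^sup>2)) has_derivative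
      (\<lambda>h. - (e * (2 * u * fst h + 2 * v * snd h) * e))) (at (u, v))"
    using Deriv.has_derivative_inverse[OF _ P] D by (simp add: e_def)
  have c1: "((\<lambda>x. 2 * fst x) has_derivative (\<lambda>h. 2 * fst h)) (at (u, v))"
    and c2: "((\<lambda>x. 2 * snd x) has_derivative (\<lambda>h. 2 * snd h)) (at (u, v))"
    by (rule has_derivative_mult_right u v)+
  have c3: "((\<lambda>x. (fst x)\<^sup>2 + (snd x)\<^sup>2 - 1) has_derivative (\<lambda>h. 2 * u * fst h + 2 * v * snd h)) (at (u, v))"
    by (rule has_derivative_eq_rhs, (rule derivative_intros u v)+) (simp add: fun_eq_iff)
  have "((\<lambda>x. stereographic_chart x $ i) has_derivative
    (\<lambda>h. (fst h *\<^sub>R chart_u (u, v) + snd h *\<^sub>R chart_v (u, v)) $ i)) (at (u, v))" for i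
  proof -
    have eq: "(\<lambda>x. stereographic_chart x $ 1) = (\<lambda>x. 2 * fst x * inverse (1 + (fst x)\<^sup>2 + (snd x)\<^sup>2))"
      "(\<lambda>x. stereographic_chart x $ 2) = (\<lambda>x. 2 * snd x * inverse (1 + (fst x)\<^sup>2 + (snd x)\<^sup>2))"
      "(\<lambda>x. stereographic_chart x $ 3) = (\<lambda>x. ((fst x)\<^sup>2 + (snd x)\<^sup>2 - 1) * inverse (1 + (fst x)\<^sup>2 + (snd x)\<^sup>2))"
      using stereographic_chart_component by (auto simp: fun_eq_iff divide_inverse)
    have rhs: "(a *\<^sub>R chart_u (u, v) + b *\<^sub>R chart_v (u, v)) $ 1 =
          2 * u * - (e * (2 * u * a + 2 * v * b) * e) + 2 * a * e"
      "(a *\<^sub>R chart_u (u, v) + b *\<^sub>R chart_v (u, v)) $ 2 =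
          2 * v * - (e * (2 * u * a + 2 * v * b) * e) + 2 * b * e"
      "(a *\<^sub>R chart_u (u, v) + b *\<^sub>R chart_v (u, v)) $ 3 =
          (u\<^sup>2 + v\<^sup>2 - 1) * - (e * (2 * u * a + 2 * v * b) * e) + (2 * u * a + 2 * v * b) * e" for a b
    proof -
      \<comment> \<open>With \<open>e\<close> for the reciprocal of the denominator these are
        polynomial identities modulo \<open>e (1 + u^2 + v^2) = 1\<close>.\<close>
      have "a * (2 * e\<^sup>2 * (1 - u\<^sup>2 + v\<^sup>2)) + b * (2 * e\<^sup>2 * (- 2 * u * v)) =
          2 * u * - (e * (2 * u * a + 2 * v * b) * e) + 2 * a * e"
        "a * (2 * e\<^sup>2 * (- 2 * u * v)) + b * (2 * e\<^sup>2 * (1 + u\<^sup>2 - v\<^sup>2)) =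
          2 * v * - (e * (2 * u * a + 2 * v * b) * e) + 2 * b * e"
        "a * (2 * e\<^sup>2 * (2 * u)) + b * (2 * e\<^sup>2 * (2 * v)) =
          (u\<^sup>2 + v\<^sup>2 - 1) * - (e * (2 * u * a + 2 * v * b) * e) + (2 * u * a + 2 * v * b) * e"
        using e by algebra+
      then show "(a *\<^sub>R chart_u (u, v) + b *\<^sub>R chart_v (u, v)) $ 1 =
          2 * u * - (e * (2 * u * a + 2 * v * b) * e) + 2 * a * e"
        "(a *\<^sub>R chart_u (u, v) + b *\<^sub>R chart_v (u, v)) $ 2 =
          2 * v * - (e * (2 * u * a + 2 * v * b) * e) + 2 * b * e"
        "(a *\<^sub>R chart_u (u, v) + b *\<^sub>R chart_v (u, v)) $ 3 =
          (u\<^sup>2 + v\<^sup>2 - 1) * - (e * (2 * u * a + 2 * v * b) * e) + (2 * u * a + 2 * v * b) * e"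
        unfolding chart_u_def chart_v_def case_prod_conv coeff by simp_all
    qed
    consider "i = 1" | "i = 2" | "i = 3" using exhaust_3 by blast
    then show ?thesis
    proof cases
      case 1
      show ?thesis unfolding 1 eq rhs
        using has_derivative_mult[OF c1 inv] by (simp add: e_def)
    next
      case 2
      show ?thesis unfolding 2 eq rhs
        using has_derivative_mult[OF c2 inv] by (simp add: e_def)
    next
      case 3
      show ?thesis unfolding 3 eq rhs
        using has_derivative_mult[OF c3 inv] by (simp add: e_def)
    qed
  qed
  then have "\<forall>b\<in>Basis. ((\<lambda>x. stereographic_chart x \<bullet> b) has_derivative
      (\<lambda>h. (fst h *\<^sub>R chart_u (u, v) + snd h *\<^sub>R chart_v (u, v)) \<bullet> b)) (at (u, v))"
    unfolding Basis_vec_def by (auto simp only: inner_axis Basis_real_def inner_real_def mult_1_right)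
  then show ?thesis unfolding has_derivative_componentwise_within[of stereographic_chart] .
qed

text \<open>The cross product of the partial derivatives is \<open>- 4 / D^2\<close> times the
  position vector, which has length 1.\<close>

lemma area_element_stereographic:
  "area_element stereographic_chart (u, v) = 4 / (1 + u\<^sup>2 + v\<^sup>2)\<^sup>2"
proof -
  define D where "D = 1 + u\<^sup>2 + v\<^sup>2"
  have D: "D > 0" using chart_denominator by (simp add: D_def)
  have 1: "((\<lambda>a. stereographic_chart (a, v)) has_vector_derivative chart_u (u, v)) (at u)"
    unfolding has_vector_derivative_def
    using has_derivative_compose[OF has_derivative_Pair[OF has_derivative_ident has_derivative_const[of v]]
        has_derivative_stereographic_chart[of u v]]
    by simp
  have 2: "((\<lambda>b. stereographic_chart (u, b)) has_vector_derivative chart_v (u, v)) (at v)"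
    unfolding has_vector_derivative_def
    using has_derivative_compose[OF has_derivative_Pair[OF has_derivative_const[of u] has_derivative_ident]
        has_derivative_stereographic_chart[of u v]]
    by simp
  have uv: "chart_u (u, v) = (2 / D\<^sup>2) *\<^sub>R vector [1 - u\<^sup>2 + v\<^sup>2, - 2 * u * v, 2 * u]"
    "chart_v (u, v) = (2 / D\<^sup>2) *\<^sub>R vector [- 2 * u * v, 1 + u\<^sup>2 - v\<^sup>2, 2 * v]"
    by (simp_all add: chart_u_def chart_v_def D_def)
  have "cross3 (vector [1 - u\<^sup>2 + v\<^sup>2, - 2 * u * v, 2 * u]) (vector [- 2 * u * v, 1 + u\<^sup>2 - v\<^sup>2, 2 * v])
      = D *\<^sub>R vector [- 2 * u, - 2 * v, 1 - u\<^sup>2 - v\<^sup>2]"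
    by (simp add: cross3_def vec_eq_iff forall_3 D_def power2_eq_square algebra_simps)
  moreover have "norm (vector [- 2 * u, - 2 * v, 1 - u\<^sup>2 - v\<^sup>2] :: real^3) = D"
  proof -
    have "(vector [- 2 * u, - 2 * v, 1 - u\<^sup>2 - v\<^sup>2] :: real^3) \<bullet> vector [- 2 * u, - 2 * v, 1 - u\<^sup>2 - v\<^sup>2] = D\<^sup>2"
      by (simp add: inner_vec_def sum_3 D_def power2_eq_square algebra_simps)
    then show ?thesis using D by (simp add: norm_eq_sqrt_inner)
  qed
  ultimately have "norm (cross3 (chart_u (u, v)) (chart_v (u, v))) = (2 / D\<^sup>2) * (2 / D\<^sup>2) * (D * D)"
    using D unfolding uv by (simp add: cross_mult_left cross_mult_right)
  also have "\<dots> = 4 / D\<^sup>2" using D by (simp add: power2_eq_square)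
  finally show ?thesis
    unfolding area_element_def using vector_derivative_at[OF 1] vector_derivative_at[OF 2]
    by (simp add: D_def)
qed

lemma has_derivative_dilated_chart:
  "(dilated_chart has_derivative (\<lambda>h. (h $ 3) *\<^sub>R stereographic_chart (p $ 1, p $ 2) +
     (p $ 3) *\<^sub>R ((h $ 1) *\<^sub>R chart_u (p $ 1, p $ 2) + (h $ 2) *\<^sub>R chart_v (p $ 1, p $ 2)))) (at p)"
proof -
  have "((\<lambda>p. stereographic_chart (p $ 1, p $ 2)) has_derivative
      (\<lambda>h. (h $ 1) *\<^sub>R chart_u (p $ 1, p $ 2) + (h $ 2) *\<^sub>R chart_v (p $ 1, p $ 2))) (at p)"
    using has_derivative_compose[OF has_derivative_Pair[OF
        bounded_linear_imp_has_derivative[OF bounded_linear_vec_nth]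
        bounded_linear_imp_has_derivative[OF bounded_linear_vec_nth]]
        has_derivative_stereographic_chart[of "p $ 1" "p $ 2"]]
    by simp
  from has_derivative_scaleR[OF bounded_linear_imp_has_derivative[OF bounded_linear_vec_nth] this, of 3]
  show ?thesis unfolding dilated_chart_def[abs_def] by (simp add: add.commute)
qed

text \<open>The columns are \<open>r\<close> times the two partial derivatives and the position
  vector, the unit normal of the sphere. Up to sign their triple product is \<open>r^2\<close> times
  the length of the cross product of the partial derivatives.\<close>

lemma det_dilated_chart:
  "\<bar>det (matrix (\<lambda>h. (h $ 3) *\<^sub>R stereographic_chart (u, v) +
     r *\<^sub>R ((h $ 1) *\<^sub>R chart_u (u, v) + (h $ 2) *\<^sub>R chart_v (u, v))))\<bar> =
     r\<^sup>2 * area_element stereographic_chart (u, v)"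
proof -
  define D where "D = 1 + u\<^sup>2 + v\<^sup>2"
  have D: "D > 0" using chart_denominator by (simp add: D_def)
  define e where "e = 1 / D"
  have chart: "stereographic_chart (u, v) = e *\<^sub>R vector [2 * u, 2 * v, u\<^sup>2 + v\<^sup>2 - 1]"
    "chart_u (u, v) = (2 * e\<^sup>2) *\<^sub>R vector [1 - u\<^sup>2 + v\<^sup>2, - 2 * u * v, 2 * u]"
    "chart_v (u, v) = (2 * e\<^sup>2) *\<^sub>R vector [- 2 * u * v, 1 + u\<^sup>2 - v\<^sup>2, 2 * v]"
    by (simp_all add: chart_u_def chart_v_def stereographic_chart_def D_def e_def power_divide)
  have "det (matrix (\<lambda>h :: real^3. (h $ 3) *\<^sub>R stereographic_chart (u, v) +
     r *\<^sub>R ((h $ 1) *\<^sub>R chart_u (u, v) + (h $ 2) *\<^sub>R chart_v (u, v)))) = - (r\<^sup>2 * (4 * e ^ 5) * D ^ 3)"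
    unfolding chart by (simp add: det_3 matrix_def axis_def D_def)
      (simp add: power2_eq_square power3_eq_cube eval_nat_numeral algebra_simps)
  also have "\<dots> = - (r\<^sup>2 * (4 / D\<^sup>2))"
    using D by (simp add: e_def power_divide eval_nat_numeral)
  finally show ?thesis
    unfolding area_element_stereographic using D by (simp add: D_def[symmetric])
qed

lemma norm_stereographic_chart: "norm (stereographic_chart w) = 1"
proof -
  obtain u v where w: "w = (u, v)" by (cases w)
  define D where "D = 1 + u\<^sup>2 + v\<^sup>2"
  have D: "D > 0" using chart_denominator by (simp add: D_def)
  have "vector [2 * u, 2 * v, u\<^sup>2 + v\<^sup>2 - 1] \<bullet> (vector [2 * u, 2 * v, u\<^sup>2 + v\<^sup>2 - 1] :: real^3) = D\<^sup>2"
    by (simp add: inner_vec_def sum_3 D_def power2_eq_square algebra_simps)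
  then have "norm (vector [2 * u, 2 * v, u\<^sup>2 + v\<^sup>2 - 1] :: real^3) = D"
    using D by (simp add: norm_eq_sqrt_inner)
  then show ?thesis using D by (simp add: w stereographic_chart_def D_def)
qed

text \<open>These are the formulas for projecting back from the north pole; they supply injectivity
  of the chart.\<close>

lemma stereographic_chart_inverse:
  "stereographic_chart (u, v) $ 3 \<noteq> 1"
  "u = stereographic_chart (u, v) $ 1 / (1 - stereographic_chart (u, v) $ 3)"
  "v = stereographic_chart (u, v) $ 2 / (1 - stereographic_chart (u, v) $ 3)"
proof -
  have D: "1 + u\<^sup>2 + v\<^sup>2 \<noteq> 0" using chart_denominator[of u v] by simp
  have 3: "1 - stereographic_chart (u, v) $ 3 = 2 / (1 + u\<^sup>2 + v\<^sup>2)"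
    using D unfolding stereographic_chart_component by (simp add: field_simps)
  then show "stereographic_chart (u, v) $ 3 \<noteq> 1" using D by auto
  show "u = stereographic_chart (u, v) $ 1 / (1 - stereographic_chart (u, v) $ 3)"
    "v = stereographic_chart (u, v) $ 2 / (1 - stereographic_chart (u, v) $ 3)"
    unfolding 3 unfolding stereographic_chart_component using D by simp_all
qed

lemma stereographic_chart_surj:
  assumes "norm x = 1" "x $ 3 \<noteq> 1"
  shows "stereographic_chart (x $ 1 / (1 - x $ 3), x $ 2 / (1 - x $ 3)) = x"
proof -
  define a b c where "a = x $ 1" and "b = x $ 2" and "c = x $ 3"
  have abc: "a\<^sup>2 + b\<^sup>2 + c\<^sup>2 = 1"
    using assms(1) by (simp add: norm_eq_1 inner_vec_def sum_3 a_def b_def c_def power2_eq_square)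
  have c: "1 - c \<noteq> 0" using assms(2) by (simp add: c_def)
  have ab: "(a / (1 - c))\<^sup>2 + (b / (1 - c))\<^sup>2 = (1 + c) / (1 - c)"
  proof -
    have "a\<^sup>2 + b\<^sup>2 = (1 - c) * (1 + c)" using abc by (simp add: power2_eq_square algebra_simps)
    then show ?thesis using c
      by (simp add: power_divide add_divide_distrib[symmetric] power2_eq_square)
  qed
  then have D: "1 + (a / (1 - c))\<^sup>2 + (b / (1 - c))\<^sup>2 = 2 / (1 - c)"
    "(a / (1 - c))\<^sup>2 + (b / (1 - c))\<^sup>2 - 1 = 2 * c / (1 - c)"
  proof -
    have "1 + (1 + c) / (1 - c) = 2 / (1 - c)" "(1 + c) / (1 - c) - 1 = 2 * c / (1 - c)"
      using c by (simp_all add: field_simps)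
    then show "1 + (a / (1 - c))\<^sup>2 + (b / (1 - c))\<^sup>2 = 2 / (1 - c)"
      "(a / (1 - c))\<^sup>2 + (b / (1 - c))\<^sup>2 - 1 = 2 * c / (1 - c)"
      unfolding add.assoc ab by simp_all
  qed
  show ?thesis
    unfolding a_def[symmetric] b_def[symmetric] c_def[symmetric] vec_eq_iff forall_3
      stereographic_chart_component D
    using c by (simp add: a_def b_def c_def)
qed

text \<open>Change of variables by the dilated chart on \<open>W \<times> (0, 1)\<close>: the
  Jacobian is \<open>r^2\<close> times the area element, and \<open>r^2\<close> has integral 1/3,
  whence the factor 3.\<close>

lemma sphere_area_cone:
  assumes "openin (top_of_set (sphere 0 1)) \<Omega>"
    and C: "C = {y. y \<noteq> 0 \<and> norm y < 1 \<and> y /\<^sub>R norm y \<in> \<Omega>}"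
  shows "C \<in> sets borel" "sphere_area \<Omega> = 3 * measure lborel C"
proof -
  obtain U where U: "open U" "\<Omega> = sphere 0 1 \<inter> U"
    using assms(1) by (auto simp: openin_open)
  have Cball: "C \<subseteq> ball 0 1" by (auto simp: C)
  have "open C"
  proof -
    have "C = (\<lambda>y. y /\<^sub>R norm y) -` U \<inter> (ball 0 1 - {0})"
      by (auto simp: C U(2))
    moreover have "open ((\<lambda>y. y /\<^sub>R norm y) -` U \<inter> (ball 0 1 - {0 :: real^3}))"
      by (subst Int_commute, rule continuous_open_preimage)
        (auto intro!: continuous_intros U(1))
    ultimately show ?thesis by simp
  qed
  then show Cb: "C \<in> sets borel" by simp
  have contX: "continuous_on UNIV stereographic_chart"
  proof (intro continuous_at_imp_continuous_on ballI)
    fix w :: "real \<times> real"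
    show "isCont stereographic_chart w"
      using has_derivative_continuous[OF has_derivative_stereographic_chart[of "fst w" "snd w"]] by simp
  qed
  define W where "W = stereographic_chart -` \<Omega>"
  have W: "W = stereographic_chart -` U"
    using norm_stereographic_chart by (auto simp: W_def U(2))
  have "open W" unfolding W by (intro open_vimage U contX)
  then have Wb [measurable]: "W \<in> sets borel" by simp
  define S where "S = {p :: real^3. 0 < p $ 3 \<and> p $ 3 < 1 \<and> (p $ 1, p $ 2) \<in> W}"
  define J where "J p = (p $ 3)\<^sup>2 * area_element stereographic_chart (p $ 1, p $ 2)" for p :: "real^3"
  have meas12: "(\<lambda>p :: real^3. (p $ 1, p $ 2)) \<in> borel_measurable borel"
    by (intro borel_measurable_continuous_onI continuous_intros)
  have Sb [measurable]: "S \<in> sets borel"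
  proof -
    have "(\<lambda>p :: real^3. (p $ 1, p $ 2)) -` W \<in> sets borel"
      using measurable_sets[OF meas12 Wb] by simp
    moreover have "{p :: real^3. 0 < p $ 3 \<and> p $ 3 < 1} \<in> sets borel" by measurable
    moreover have "S = {p. 0 < p $ 3 \<and> p $ 3 < 1} \<inter> (\<lambda>p. (p $ 1, p $ 2)) -` W"
      by (auto simp: S_def)
    ultimately show ?thesis by auto
  qed
  have ae_meas: "area_element stereographic_chart \<in> borel_measurable borel"
  proof -
    have "area_element stereographic_chart = (\<lambda>w. 4 / (1 + (fst w)\<^sup>2 + (snd w)\<^sup>2)\<^sup>2)"
      using area_element_stereographic by (auto simp: fun_eq_iff)
    moreover have "continuous_on UNIV (\<lambda>w :: real \<times> real. 4 / (1 + (fst w)\<^sup>2 + (snd w)\<^sup>2)\<^sup>2)"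
    proof -
      have "1 + (fst w)\<^sup>2 + (snd w)\<^sup>2 \<noteq> 0" for w :: "real \<times> real"
        using chart_denominator[of "fst w" "snd w"] by simp
      then show ?thesis by (intro continuous_intros) simp
    qed
    ultimately show ?thesis by (simp add: borel_measurable_continuous_onI)
  qed
  have ae_nonneg: "0 \<le> area_element stereographic_chart w" for w
    using area_element_stereographic by (cases w) simp
  have Jb [measurable]: "J \<in> borel_measurable borel"
    unfolding J_def by (intro borel_measurable_times borel_measurable_power measurable_compose[OF meas12 ae_meas])
      (auto intro!: borel_measurable_continuous_onI continuous_intros)
  \<comment> \<open>The chart misses only the north pole, so the image lacks only a ray, which lies
    in a coordinate plane and is therefore null.\<close>
  have img: "dilated_chart ` S = C - {y. y /\<^sub>R norm y = axis 3 1}"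
  proof (intro set_eqI iffI)
    fix y assume "y \<in> dilated_chart ` S"
    then obtain p where p: "p \<in> S" "y = dilated_chart p" by auto
    have n: "norm y = p $ 3" using p by (simp add: dilated_chart_def norm_stereographic_chart S_def)
    have y: "y /\<^sub>R norm y = stereographic_chart (p $ 1, p $ 2)"
      unfolding n using p by (auto simp: dilated_chart_def S_def)
    have "stereographic_chart (p $ 1, p $ 2) \<noteq> axis 3 1"
      using stereographic_chart_inverse(1)[of "p $ 1" "p $ 2"] by (auto simp: axis_def)
    moreover have "y \<noteq> 0" using n p by (auto simp: S_def)
    ultimately show "y \<in> C - {y. y /\<^sub>R norm y = axis 3 1}"
      using p y n by (auto simp: C S_def W_def)
  next
    fix y assume y: "y \<in> C - {y. y /\<^sub>R norm y = axis 3 1}"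
    define x where "x = y /\<^sub>R norm y"
    have x: "norm x = 1" "x \<in> \<Omega>" "x \<noteq> axis 3 1" using y by (auto simp: x_def C)
    have x3: "x $ 3 \<noteq> 1"
    proof
      assume "x $ 3 = 1"
      then have "x \<bullet> axis 3 1 = 1" by (simp add: inner_axis)
      moreover have "x \<bullet> x = 1" using x(1) by (simp add: norm_eq_1)
      ultimately have "(x - axis 3 1) \<bullet> (x - axis 3 1) = 0"
        by (simp add: inner_diff inner_commute inner_axis_axis)
      then show False using x(3) by simp
    qed
    define p :: "real^3" where "p = vector [x $ 1 / (1 - x $ 3), x $ 2 / (1 - x $ 3), norm y]"
    have "dilated_chart p = norm y *\<^sub>R x"
      using stereographic_chart_surj[OF x(1) x3] by (simp add: dilated_chart_def p_def)
    then have "y = dilated_chart p" using y by (simp add: x_def C)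
    moreover have "p \<in> S"
      using y x stereographic_chart_surj[OF x(1) x3] by (simp add: S_def p_def C W_def)
    ultimately show "y \<in> dilated_chart ` S" by blast
  qed
  have inj: "inj_on dilated_chart S"
  proof (rule inj_onI)
    fix p q assume pq: "p \<in> S" "q \<in> S" "dilated_chart p = dilated_chart q"
    have "norm (dilated_chart p) = p $ 3" "norm (dilated_chart q) = q $ 3"
      using pq(1,2) by (simp_all add: dilated_chart_def norm_stereographic_chart S_def)
    then have 3: "p $ 3 = q $ 3" using pq(3) by metis
    then have "stereographic_chart (p $ 1, p $ 2) = stereographic_chart (q $ 1, q $ 2)"
      using pq by (simp add: dilated_chart_def S_def)
    then have "p $ 1 = q $ 1" "p $ 2 = q $ 2"
      using stereographic_chart_inverse(2,3)[where u = "p $ 1" and v = "p $ 2"]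
        stereographic_chart_inverse(2,3)[where u = "q $ 1" and v = "q $ 2"] by metis+
    then show "p = q" using 3 by (simp add: vec_eq_iff forall_3)
  qed
  have neg: "negligible {y :: real^3. y /\<^sub>R norm y = axis 3 1}"
  proof (rule negligible_subset[OF negligible_standard_hyperplane_cart[of 1]])
    show "{y :: real^3. y /\<^sub>R norm y = axis 3 1} \<subseteq> {y. y $ 1 = 0}"
    proof
      fix y :: "real^3" assume "y \<in> {y. y /\<^sub>R norm y = axis 3 1}"
      then have "(y /\<^sub>R norm y) $ 1 = (axis 3 1 :: real^3) $ 1" by simp
      then show "y \<in> {y. y $ 1 = 0}" by (auto simp: axis_def)
    qed
  qed
  have Clm: "C \<in> lmeasurable"
    using bounded_subset[OF bounded_ball Cball] Cb by (intro bounded_set_imp_lmeasurable) auto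
  have lm: "dilated_chart ` S \<in> lmeasurable" "measure lebesgue (dilated_chart ` S) = measure lebesgue C"
    unfolding img
    using fmeasurable_Diff[OF Clm negligible_imp_sets[OF neg]]
      measure_Diff_null_set[OF fmeasurableD[OF Clm] neg[unfolded negligible_iff_null_sets]]
    by simp_all
  have "((\<lambda>p. \<bar>det (matrix (\<lambda>h. (h $ 3) *\<^sub>R stereographic_chart (p $ 1, p $ 2) +
     (p $ 3) *\<^sub>R ((h $ 1) *\<^sub>R chart_u (p $ 1, p $ 2) + (h $ 2) *\<^sub>R chart_v (p $ 1, p $ 2))))\<bar>)
     has_integral measure lebesgue C) S"
  proof -
    have "S \<in> sets lebesgue" using Sb by simp
    from has_measure_differentiable_image[OF this has_derivative_at_withinI[OF has_derivative_dilated_chart] inj]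
    show ?thesis using lm by blast
  qed
  then have "(J has_integral measure lebesgue C) S"
    unfolding det_dilated_chart J_def .
  moreover have "(\<lambda>p. indicator S p * J p) = (\<lambda>p. if p \<in> S then J p else 0)"
    by (auto simp: indicator_def)
  ultimately have "((\<lambda>p. indicator S p * J p) has_integral measure lebesgue C) UNIV"
    by (simp only: has_integral_restrict_UNIV)
  then have "(\<integral>\<^sup>+p. ennreal (indicator S p * J p) \<partial>lborel) = ennreal (measure lebesgue C)"
    by (intro nn_integral_has_integral_lborel borel_measurable_times borel_measurable_indicator Jb)
      (use Sb ae_nonneg in \<open>simp_all add: J_def indicator_def\<close>)
  also have "(\<integral>\<^sup>+p. ennreal (indicator S p * J p) \<partial>lborel) =
    (\<integral>\<^sup>+w. \<integral>\<^sup>+c. ennreal (indicator S (vector [fst w, snd w, c]) * J (vector [fst w, snd w, c])) \<partial>lborel \<partial>lborel)"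
    by (rule nn_integral_real3) measurable
  also have "\<dots> = (\<integral>\<^sup>+w. ennreal (1 / 3) * ennreal (indicator W w * area_element stereographic_chart w) \<partial>lborel)"
  proof (rule nn_integral_cong)
    fix w :: "real \<times> real"
    let ?a = "indicator W w * area_element stereographic_chart w"
    have "(\<integral>\<^sup>+c. ennreal (indicator S (vector [fst w, snd w, c]) * J (vector [fst w, snd w, c])) \<partial>lborel)
        = (\<integral>\<^sup>+c. ennreal ?a * ennreal (c\<^sup>2 * indicator {0<..<1} c) \<partial>lborel)"
      using ae_nonneg[of w] by (intro nn_integral_cong) (auto simp: S_def J_def indicator_def ennreal_mult'[symmetric] mult_ac)
    also have "\<dots> = ennreal ?a * (\<integral>\<^sup>+c. ennreal (c\<^sup>2 * indicator {0<..<1} c) \<partial>lborel)"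
      by (rule nn_integral_cmult) measurable
    also have "(\<integral>\<^sup>+c. ennreal (c\<^sup>2 * indicator {0<..<1} c) \<partial>lborel) = ennreal (1 / 3)"
    proof (rule nn_integral_has_integral_lborel)
      have "((\<lambda>c :: real. c\<^sup>2) has_integral (1 ^ 3 / 3 - 0 ^ 3 / 3)) {0..1}"
        by (rule fundamental_theorem_of_calculus)
          (auto intro!: derivative_eq_intros simp: has_real_derivative_iff_has_vector_derivative[symmetric])
      then have "((\<lambda>c :: real. c\<^sup>2) has_integral 1 / 3) {0<..<1}"
        by (simp add: has_integral_Icc_iff_Ioo)
      moreover have "(\<lambda>c :: real. c\<^sup>2 * indicator {0<..<1} c) = (\<lambda>c. if c \<in> {0<..<1} then c\<^sup>2 else 0)"
        by (auto simp: indicator_def)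
      ultimately show "((\<lambda>c :: real. c\<^sup>2 * indicator {0<..<1} c) has_integral 1 / 3) UNIV"
        by (simp only: has_integral_restrict_UNIV)
    qed auto
    finally show "(\<integral>\<^sup>+c. ennreal (indicator S (vector [fst w, snd w, c]) * J (vector [fst w, snd w, c])) \<partial>lborel)
        = ennreal (1 / 3) * ennreal ?a" by (simp add: mult.commute)
  qed
  also have "\<dots> = ennreal (1 / 3) * (\<integral>\<^sup>+w. ennreal (indicator W w * area_element stereographic_chart w) \<partial>lborel)"
    by (rule nn_integral_cmult) (use ae_meas in measurable)
  finally have nn: "ennreal (1 / 3) * (\<integral>\<^sup>+w. ennreal (indicator W w * area_element stereographic_chart w) \<partial>lborel)
      = ennreal (measure lebesgue C)" .
  have "sphere_area \<Omega> = (\<integral>w. indicator W w * area_element stereographic_chart w \<partial>lborel)"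
    by (simp add: sphere_area_def set_lebesgue_integral_def W_def)
  also have "\<dots> = enn2real (\<integral>\<^sup>+w. ennreal (indicator W w * area_element stereographic_chart w) \<partial>lborel)"
    by (rule integral_eq_nn_integral) (use ae_meas ae_nonneg in \<open>auto intro!: borel_measurable_times\<close>)
  also have "\<dots> = 3 * enn2real (ennreal (1 / 3) * (\<integral>\<^sup>+w. ennreal (indicator W w * area_element stereographic_chart w) \<partial>lborel))"
    by (simp add: enn2real_mult)
  also have "\<dots> = 3 * measure lebesgue C" unfolding nn by simp
  also have "measure lebesgue C = measure lborel C"
    using Cb by simp
  finally show "sphere_area \<Omega> = 3 * measure lborel C" .
qed

section \<open>Geodesic circles and the deficit\<close>

text \<open>For \<open>0 < r < pi\<close> the ball is the set \<open>cos r < p \<bullet> x\<close>.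
  A point with equality is a limit of ball points along the great circle from it towards
  \<open>p\<close>.\<close>

lemma frontier_geodesic_ball:
  assumes p: "p \<in> sphere 0 1" and r: "0 < r" "r < pi"
  shows "(top_of_set (sphere 0 1)) frontier_of (geodesic_ball p r) = {x \<in> sphere 0 1. p \<bullet> x = cos r}"
proof -
  let ?X = "top_of_set (sphere 0 1 :: (real^3) set)"
  have p1: "p \<bullet> p = 1" using p by (simp add: norm_eq_1)
  have ball: "geodesic_ball p r = {x \<in> sphere 0 1. cos r < p \<bullet> x}"
  proof -
    have "arccos (p \<bullet> x) < r \<longleftrightarrow> cos r < p \<bullet> x" if "x \<in> sphere 0 1" for x
    proof -
      have "\<bar>p \<bullet> x\<bar> \<le> 1" using Cauchy_Schwarz_ineq2[of p x] p that by simp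
      then have a: "0 \<le> arccos (p \<bullet> x)" "arccos (p \<bullet> x) \<le> pi" "cos (arccos (p \<bullet> x)) = p \<bullet> x"
        using arccos_bounded[of "p \<bullet> x"] by (auto simp: abs_le_iff)
      show ?thesis
        using cos_mono_less_eq[of r "arccos (p \<bullet> x)"] a r by simp
    qed
    then show ?thesis by (auto simp: geodesic_ball_def)
  qed
  have op: "openin ?X (geodesic_ball p r)"
  proof -
    have "geodesic_ball p r = sphere 0 1 \<inter> {x. cos r < p \<bullet> x}" by (auto simp: ball)
    then show ?thesis
      by (auto intro!: openin_open_Int open_Collect_less continuous_intros)
  qed
  have "closedin ?X {x \<in> sphere 0 1. cos r \<le> p \<bullet> x}"
  proof -
    have "{x \<in> sphere 0 1. cos r \<le> p \<bullet> x} = sphere 0 1 \<inter> {x. cos r \<le> p \<bullet> x}" by auto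
    then show ?thesis
      by (auto intro!: closedin_closed_Int closed_Collect_le continuous_intros)
  qed
  then have sub: "?X closure_of (geodesic_ball p r) \<subseteq> {x \<in> sphere 0 1. cos r \<le> p \<bullet> x}"
    by (intro closure_of_minimal) (auto simp: ball)
  have sup: "x \<in> ?X closure_of (geodesic_ball p r)" if x: "x \<in> sphere 0 1" "p \<bullet> x = cos r" for x
    unfolding in_closure_of
  proof (intro conjI allI impI)
    show "x \<in> topspace ?X" using x by simp
    fix V assume V: "x \<in> V \<and> openin ?X V"
    then obtain U where U: "open U" "V = sphere 0 1 \<inter> U" by (auto simp: openin_open)
    have sr: "sin r > 0" using r by (simp add: sin_gt_zero)
    have x1: "x \<bullet> x = 1" using x by (simp add: norm_eq_1)
    \<comment> \<open>The unit tangent at \<open>x\<close> of the geodesic towards \<open>p\<close>;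
      moving along it by \<open>h < r\<close> shortens the distance to \<open>p\<close> from
      \<open>r\<close> to \<open>r - h\<close>.\<close>
    define n where "n = (p - cos r *\<^sub>R x) /\<^sub>R sin r"
    have xn: "x \<bullet> n = 0" using x x1 by (simp add: n_def inner_diff_right inner_commute)
    have pn: "p \<bullet> n = sin r"
    proof -
      have "p \<bullet> n = (1 - cos r * cos r) / sin r"
        using x p1 by (simp add: n_def inner_diff_right divide_inverse mult.commute)
      also have "1 - cos r * cos r = sin r * sin r"
        using sin_cos_squared_add[of r] by (simp add: power2_eq_square)
      finally show ?thesis using sr by simp
    qed
    have nn: "n \<bullet> n = 1"
    proof -
      have "n \<bullet> n = (p \<bullet> n - cos r * (x \<bullet> n)) / sin r"
        by (subst n_def) (simp add: inner_diff_left divide_inverse mult.commute)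
      then show ?thesis using xn pn sr by simp
    qed
    define y where "y h = cos h *\<^sub>R x + sin h *\<^sub>R n" for h
    have y1: "norm (y h) = 1" for h
    proof -
      have "y h \<bullet> y h = cos h * cos h + sin h * sin h"
        using xn nn x1
        by (simp add: y_def inner_add_left inner_add_right inner_commute del: sin_cos_squared_add3)
      then show ?thesis by (simp add: norm_eq_1)
    qed
    have py: "p \<bullet> y h = cos (r - h)" for h
      using x pn by (simp add: y_def inner_add_right cos_diff mult.commute)
    have "(y \<longlongrightarrow> y 0) (at_right 0)"
      unfolding y_def by (intro tendsto_intros)
    then have "\<forall>\<^sub>F h in at_right 0. y h \<in> U"
      by (rule topological_tendstoD) (use U V in \<open>auto simp: y_def\<close>)
    moreover have "\<forall>\<^sub>F h in at_right 0. h < r" using r by (auto simp: eventually_at_right_field)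
    ultimately have "\<forall>\<^sub>F h in at_right 0. y h \<in> U \<and> h < r \<and> 0 < h"
      using eventually_at_right_less[of "0 :: real"] by eventually_elim simp
    then obtain h where h: "y h \<in> U" "h < r" "0 < h"
      using eventually_happens'[OF trivial_limit_at_right_real] by blast
    have "cos r < cos (r - h)" using h r by (intro cos_monotone_0_pi) auto
    then have "y h \<in> geodesic_ball p r" using y1 by (simp add: ball py)
    moreover have "y h \<in> V" using h(1) y1 by (simp add: U(2))
    ultimately show "\<exists>y. y \<in> geodesic_ball p r \<and> y \<in> V" by blast
  qed
  have "?X frontier_of (geodesic_ball p r) = ?X closure_of (geodesic_ball p r) - geodesic_ball p r"
    unfolding frontier_of_def interior_of_openin[OF op] ..
  also have "\<dots> = {x \<in> sphere 0 1. p \<bullet> x = cos r}"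
    using sub sup unfolding ball by fastforce
  finally show ?thesis .
qed

text \<open>With \<open>s\<close> for the product of the roots,
  \<open>(s - 1 - a b) (s + 1 + a b) = s^2 - (1 + a b)^2 = (a - b)^2\<close>. The second factor is
  positive because \<open>s \<ge> \<bar>a b\<bar>\<close>, so the quotient inherits sign and zeros
  from the square.\<close>

lemma deficit_integrand:
  fixes a b :: real
  shows "(a - b)\<^sup>2 / (sqrt ((1 + a\<^sup>2) * (1 + b\<^sup>2)) + 1 + a * b) =
    sqrt (1 + a\<^sup>2) * sqrt (1 + b\<^sup>2) - 1 - a * b" (is ?eq)
    and "sqrt (1 + a\<^sup>2) * sqrt (1 + b\<^sup>2) - 1 - a * b \<ge> 0" (is ?nonneg)
    and "sqrt (1 + a\<^sup>2) * sqrt (1 + b\<^sup>2) - 1 - a * b = 0 \<longleftrightarrow> a = b" (is ?zero)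
proof -
  define s where "s = sqrt (1 + a\<^sup>2) * sqrt (1 + b\<^sup>2)"
  have s: "s = sqrt ((1 + a\<^sup>2) * (1 + b\<^sup>2))" by (simp add: s_def real_sqrt_mult)
  have "\<bar>a * b\<bar> \<le> s"
  proof -
    have "\<bar>a\<bar> \<le> sqrt (1 + a\<^sup>2)" "\<bar>b\<bar> \<le> sqrt (1 + b\<^sup>2)"
      by (auto intro!: real_le_rsqrt)
    then show ?thesis unfolding s_def abs_mult by (intro mult_mono) auto
  qed
  then have pos: "s + 1 + a * b > 0" by (simp add: abs_le_iff)
  have "s\<^sup>2 = (1 + a\<^sup>2) * (1 + b\<^sup>2)" unfolding s by (simp add: add_nonneg_nonneg)
  then have prod: "(s - 1 - a * b) * (s + 1 + a * b) = (a - b)\<^sup>2"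
    by (simp add: power2_eq_square algebra_simps)
  then have eq: "(a - b)\<^sup>2 / (s + 1 + a * b) = s - 1 - a * b"
    using pos by (simp add: divide_eq_eq)
  then show ?eq unfolding s s_def[symmetric] by (simp add: s)
  show ?nonneg unfolding s_def[symmetric] eq[symmetric] using pos by simp
  show ?zero unfolding s_def[symmetric] eq[symmetric] using pos by simp
qed

context spherical_frame
begin

lemma curvature_frac: "k (frac t) = k t"
  using periodic_add_int[of k t "- \<lfloor>t\<rfloor>"] periodic(5) by (simp add: frac_def)

text \<open>Differentiating \<open>p \<bullet> \<gamma> = q\<close> twice gives
  \<open>p \<bullet> T = 0\<close> and \<open>k (p \<bullet> \<nu>) = - q\<close>. The factor
  \<open>p \<bullet> \<nu>\<close> is constant, and it is nonzero because its square is
  \<open>1 - q^2\<close>.\<close>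

lemma curvature_constant_of_circle:
  assumes p: "p \<bullet> p = 1" and q: "\<And>t. p \<bullet> \<gamma> t = q" "\<bar>q\<bar> < 1"
  shows "k s = k t"
proof -
  have T: "p \<bullet> T t = 0" for t
  proof -
    have "((\<lambda>t. p \<bullet> \<gamma> t) has_real_derivative 0) (at t)" by (simp add: q(1))
    from DERIV_unique[OF derivs_inner(1) this] show ?thesis using speed_pos[of t] by simp
  qed
  have n: "- q - k t * (p \<bullet> \<nu> t) = 0" for t
  proof -
    have "((\<lambda>t. p \<bullet> T t) has_real_derivative 0) (at t)" by (simp add: T)
    from DERIV_unique[OF derivs_inner(3) this] show ?thesis using speed_pos[of t] by (simp add: q(1))
  qed
  have "((\<lambda>t. p \<bullet> \<nu> t) has_real_derivative 0) (at t)" for t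
    using derivs_inner(2)[of p t] by (simp add: T)
  then have m: "p \<bullet> \<nu> s = p \<bullet> \<nu> t" by (intro DERIV_isconst_all) simp
  have "1 = q * q + (p \<bullet> \<nu> t) * (p \<bullet> \<nu> t)"
    using inner_frame[of p p t] p by (simp add: T q(1))
  moreover have "q * q < 1" using q(2) by (metis abs_square_less_1 power2_eq_square)
  ultimately have "p \<bullet> \<nu> t \<noteq> 0" by auto
  then show ?thesis using n[of s] n[of t] m by (metis eq_iff_diff_eq_0 mult_right_cancel)
qed

text \<open>If a point of the circle were missed, the stereographic projection of the circle from that
  point would map the curve to a line, where Rolle's theorem yields a point of zero speed.\<close>

lemma range_eq_circle:
  assumes p: "p \<bullet> p = 1" and q: "\<And>t. p \<bullet> \<gamma> t = q" "\<bar>q\<bar> < 1"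
  shows "range \<gamma> = {x \<in> sphere 0 1. p \<bullet> x = q}"
proof
  show "range \<gamma> \<subseteq> {x \<in> sphere 0 1. p \<bullet> x = q}"
    using orthonormal(1) q(1) by (auto simp: norm_eq_1)
  show "{x \<in> sphere 0 1. p \<bullet> x = q} \<subseteq> range \<gamma>"
  proof (rule ccontr)
    assume "\<not> ?thesis"
    then obtain x where x: "norm x = 1" "p \<bullet> x = q" "x \<notin> range \<gamma>" by auto
    have x1: "x \<bullet> x = 1" using x(1) by (simp add: norm_eq_1)
    define \<rho> where "\<rho> = sqrt (1 - q\<^sup>2)"
    have q2: "q\<^sup>2 < 1" using q(2) by (simp add: abs_square_less_1)
    have \<rho>: "\<rho> > 0" "\<rho>\<^sup>2 = 1 - q\<^sup>2" using q2 by (simp_all add: \<rho>_def)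
    \<comment> \<open>The circle has centre \<open>q p\<close> and radius \<open>\<rho>\<close>, and
      \<open>f\<close>, \<open>g\<close> span its plane, with the missed point \<open>x\<close> in
      the direction \<open>f\<close>.\<close>
    define f where "f = (x - q *\<^sub>R p) /\<^sub>R \<rho>"
    define g where "g = cross3 p f"
    have xf: "x = q *\<^sub>R p + \<rho> *\<^sub>R f" using \<rho> by (simp add: f_def)
    have pf: "p \<bullet> f = 0" using p x by (simp add: f_def inner_diff_right)
    have ff: "f \<bullet> f = 1"
    proof -
      have "\<rho>\<^sup>2 * (f \<bullet> f) = 1 - q\<^sup>2"
        using x1 xf pf p by (simp add: inner_add_left inner_add_right inner_commute power2_eq_square)
      then show ?thesis using \<rho> q2 by auto
    qed
    have g: "g \<bullet> g = 1" "p \<bullet> g = 0" "f \<bullet> g = 0"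
      using norm_cross[of p f] p ff pf by (simp_all add: g_def power2_norm_eq_inner dot_cross_self)
    have cr: "cross3 f g = p" using Lagrange[of f p f] ff pf by (simp add: g_def inner_commute)
    have ex: "y = (y \<bullet> p) *\<^sub>R p + (y \<bullet> f) *\<^sub>R f + (y \<bullet> g) *\<^sub>R g" for y
      by (rule orthonormal_frame_expansion) (use p g ff pf cr in \<open>simp_all add: inner_commute\<close>)
    have ip: "y \<bullet> z = (y \<bullet> p) * (z \<bullet> p) + (y \<bullet> f) * (z \<bullet> f) + (y \<bullet> g) * (z \<bullet> g)" for y z
    proof -
      have "y \<bullet> z = ((y \<bullet> p) *\<^sub>R p + (y \<bullet> f) *\<^sub>R f + (y \<bullet> g) *\<^sub>R g) \<bullet> z"
        by (rule arg_cong[where f = "\<lambda>x. x \<bullet> z", OF ex])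
      also have "\<dots> = (y \<bullet> p) * (p \<bullet> z) + (y \<bullet> f) * (f \<bullet> z) + (y \<bullet> g) * (g \<bullet> z)"
        by (simp only: inner_add_left inner_scaleR_left)
      finally show ?thesis by (simp add: inner_commute)
    qed
    have T: "p \<bullet> T t = 0" for t
    proof -
      have "((\<lambda>t. p \<bullet> \<gamma> t) has_real_derivative 0) (at t)" by (simp add: q(1))
      from DERIV_unique[OF derivs_inner(1) this] show ?thesis using speed_pos[of t] by simp
    qed
    have circ: "(f \<bullet> \<gamma> t)\<^sup>2 + (g \<bullet> \<gamma> t)\<^sup>2 = \<rho>\<^sup>2" for t
      using ip[of "\<gamma> t" "\<gamma> t"] orthonormal(1)[of t] q(1)[of t] \<rho>(2)
      by (simp add: inner_commute power2_eq_square)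
    have ne: "\<rho> - f \<bullet> \<gamma> t \<noteq> 0" for t
    proof
      assume "\<rho> - f \<bullet> \<gamma> t = 0"
      then have fr: "f \<bullet> \<gamma> t = \<rho>" by simp
      then have "g \<bullet> \<gamma> t = 0" using circ[of t] by simp
      then have "\<gamma> t = x"
        using ex[of "\<gamma> t"] q(1)[of t] fr xf by (metis add.right_neutral inner_commute scaleR_zero_left)
      then show False using x(3) by auto
    qed
    \<comment> \<open>The quotient is the stereographic coordinate of \<open>\<gamma> t\<close> for
      projection from \<open>x\<close>.\<close>
    have der: "((\<lambda>t. (g \<bullet> \<gamma> t) / (\<rho> - f \<bullet> \<gamma> t)) has_real_derivative
        v t * ((g \<bullet> T t) * (\<rho> - f \<bullet> \<gamma> t) + (g \<bullet> \<gamma> t) * (f \<bullet> T t)) / (\<rho> - f \<bullet> \<gamma> t)\<^sup>2) (at t)" for t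
      using ne[of t]
      by (auto intro!: derivative_eq_intros derivs_inner simp: power2_eq_square algebra_simps)
    have "\<exists>z>0. z < 1 \<and> (\<lambda>h. h * (v z * ((g \<bullet> T z) * (\<rho> - f \<bullet> \<gamma> z) + (g \<bullet> \<gamma> z) * (f \<bullet> T z)) / (\<rho> - f \<bullet> \<gamma> z)\<^sup>2)) = (\<lambda>v. 0)"
    proof (rule Rolle_deriv)
      show "(g \<bullet> \<gamma> 0) / (\<rho> - f \<bullet> \<gamma> 0) = (g \<bullet> \<gamma> 1) / (\<rho> - f \<bullet> \<gamma> 1)"
        using periodic(1)[of 0] by simp
      show "continuous_on {0..1} (\<lambda>t. (g \<bullet> \<gamma> t) / (\<rho> - f \<bullet> \<gamma> t))"
        using der by (meson DERIV_isCont continuous_at_imp_continuous_on)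
      fix t :: real
      show "((\<lambda>t. (g \<bullet> \<gamma> t) / (\<rho> - f \<bullet> \<gamma> t)) has_derivative
          (\<lambda>h. h * (v t * ((g \<bullet> T t) * (\<rho> - f \<bullet> \<gamma> t) + (g \<bullet> \<gamma> t) * (f \<bullet> T t)) / (\<rho> - f \<bullet> \<gamma> t)\<^sup>2))) (at t)"
        using der[of t] unfolding has_field_derivative_def by (rule has_derivative_eq_rhs) (simp add: fun_eq_iff)
    qed simp
    then obtain t where "v t * ((g \<bullet> T t) * (\<rho> - f \<bullet> \<gamma> t) + (g \<bullet> \<gamma> t) * (f \<bullet> T t)) / (\<rho> - f \<bullet> \<gamma> t)\<^sup>2 = 0"
      by (metis mult_1)
    then have z: "(g \<bullet> T t) * (\<rho> - f \<bullet> \<gamma> t) + (g \<bullet> \<gamma> t) * (f \<bullet> T t) = 0"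
      using ne[of t] speed_pos[of t] by simp
    define X Y a b where "X = f \<bullet> \<gamma> t" and "Y = g \<bullet> \<gamma> t" and "a = f \<bullet> T t" and "b = g \<bullet> T t"
    have 1: "X * a + Y * b = 0"
      using ip[of "\<gamma> t" "T t"] orthonormal(5)[of t] T[of t] by (simp add: X_def Y_def a_def b_def inner_commute)
    have 2: "a\<^sup>2 + b\<^sup>2 = 1"
      using ip[of "T t" "T t"] orthonormal(3)[of t] T[of t] by (simp add: a_def b_def inner_commute power2_eq_square)
    have 3: "X\<^sup>2 + Y\<^sup>2 = \<rho>\<^sup>2" using circ[of t] by (simp add: X_def Y_def)
    have 4: "b * (\<rho> - X) + Y * a = 0" using z by (simp add: X_def Y_def a_def b_def)
    \<comment> \<open>A unit tangent \<open>(a, b)\<close> orthogonal to \<open>(X, Y)\<close> can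
      annihilate the derivative only if \<open>X = \<rho>\<close>, which is the missed
      point.\<close>
    have "b * \<rho> * (\<rho> - X) = 0" using 1 3 4 by algebra
    then have b: "b = 0" using \<rho> ne[of t] by (simp add: X_def)
    then have "a \<noteq> 0" using 2 by auto
    then have "X = 0" "Y = 0" using 1 4 b by auto
    then show False using 3 \<rho>(1) by simp
  qed
qed

text \<open>If \<open>k\<close> is a constant \<open>\<kappa>\<close>, the frame equations make
  \<open>\<nu> - \<kappa> \<gamma>\<close> a constant vector. Normalised, it is the centre up to
  sign, and the radius is determined by \<open>cot r = \<kappa>\<close>. Conversely, on a circle the
  product of position and centre is constant.\<close>

lemma geodesic_circle_iff_constant_curvature:
  "geodesic_circle (range \<gamma>) \<longleftrightarrow> (\<forall>s t. k s = k t)"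
proof
  assume "geodesic_circle (range \<gamma>)"
  then obtain p r where p: "p \<in> sphere 0 1" and r: "0 < r" "r < pi"
    and eq: "range \<gamma> = (top_of_set (sphere 0 1)) frontier_of (geodesic_ball p r)"
    unfolding geodesic_circle_def by blast
  have "p \<bullet> \<gamma> t = cos r" for t
    using eq unfolding frontier_geodesic_ball[OF p r] by blast
  moreover have "\<bar>cos r\<bar> < 1"
  proof -
    have "(sin r)\<^sup>2 > 0" using r by (simp add: sin_gt_zero less_imp_neq[symmetric])
    then have "(cos r)\<^sup>2 < 1" using sin_cos_squared_add[of r] by linarith
    then show ?thesis by (simp add: abs_square_less_1)
  qed
  ultimately show "\<forall>s t. k s = k t"
    using curvature_constant_of_circle[of p "cos r"] p by (simp add: norm_eq_1)
next
  assume const: "\<forall>s t. k s = k t"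
  define \<kappa> where "\<kappa> = k 0"
  have k: "k t = \<kappa>" for t using const by (simp add: \<kappa>_def)
  define c where "c t = \<nu> t - \<kappa> *\<^sub>R \<gamma> t" for t
  have "(c has_vector_derivative (v t * k t) *\<^sub>R T t - \<kappa> *\<^sub>R (v t *\<^sub>R T t)) (at t)" for t
    unfolding c_def by (intro has_vector_derivative_diff deriv_normal
        bounded_linear.has_vector_derivative[OF bounded_linear_scaleR_right] deriv_curve)
  then have "(c has_vector_derivative 0) (at t within UNIV)" for t by (simp add: k mult.commute)
  then obtain c0 where c0: "\<And>t. c t = c0"
    using has_vector_derivative_zero_constant[of UNIV c] by auto
  define w where "w = sqrt (1 + \<kappa>\<^sup>2)"
  have w: "w > 0" "w\<^sup>2 = 1 + \<kappa>\<^sup>2" by (simp_all add: w_def add_pos_nonneg)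
  have c0g: "c0 \<bullet> \<gamma> t = - \<kappa>" for t
  proof -
    have "c t \<bullet> \<gamma> t = - \<kappa>"
      by (simp add: c_def inner_diff_left orthonormal inner_commute[of "\<nu> t"])
    then show ?thesis by (simp add: c0)
  qed
  have cc: "c0 \<bullet> c0 = w\<^sup>2"
    using orthonormal[of 0] unfolding c0[of 0, symmetric] w(2)
    by (simp add: c_def inner_diff_left inner_diff_right inner_commute power2_eq_square)
  \<comment> \<open>The sign places the centre on the side of \<open>- \<nu>\<close>, opposite to
    the outward normal, so that \<open>p \<bullet> \<gamma>\<close> has the sign of
    \<open>\<kappa>\<close>.\<close>
  define p where "p = (- 1 / w) *\<^sub>R c0"
  have p: "p \<bullet> p = 1" using cc w(1) by (simp add: p_def power2_eq_square)
  have pg: "p \<bullet> \<gamma> t = \<kappa> / w" for t by (simp add: p_def c0g)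
  have q: "\<bar>\<kappa> / w\<bar> < 1"
  proof -
    have "(\<kappa> / w)\<^sup>2 < 1" using w by (simp add: power_divide add_pos_nonneg)
    then show ?thesis by (simp add: abs_square_less_1)
  qed
  define r where "r = arccos (\<kappa> / w)"
  have r: "0 < r" "r < pi" "cos r = \<kappa> / w"
  proof -
    have "- 1 < \<kappa> / w" "\<kappa> / w < 1" using q unfolding abs_less_iff by linarith+
    then show "0 < r" "r < pi" "cos r = \<kappa> / w"
      using arccos_lt_bounded[of "\<kappa> / w"] by (simp_all add: r_def)
  qed
  have "range \<gamma> = {x \<in> sphere 0 1. p \<bullet> x = cos r}"
    unfolding r(3) by (rule range_eq_circle[OF p pg q])
  then show "geodesic_circle (range \<gamma>)"
    unfolding geodesic_circle_def using p r frontier_geodesic_ball[of p r]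
    by (intro exI[of _ p] exI[of _ r]) (simp add: norm_eq_1)
qed

section \<open>The double integral of the deficit and its vanishing\<close>

definition euclidean_curvature :: "real \<Rightarrow> real" where
  "euclidean_curvature t = sqrt (1 + (k t)\<^sup>2)"

definition inner_deficit :: "real \<Rightarrow> real" where
  "inner_deficit s = integral {0..1} (\<lambda>t. (k s - k t)\<^sup>2 /
     (sqrt ((1 + (k s)\<^sup>2) * (1 + (k t)\<^sup>2)) + 1 + k s * k t) * v t)"

lemma continuous_euclidean_curvature: "continuous_on S euclidean_curvature"
  unfolding euclidean_curvature_def by (intro continuous_intros continuous_frame)

lemma inner_deficit_eq:
  "inner_deficit s = euclidean_curvature s * integral {0..1} (\<lambda>t. euclidean_curvature t * v t)
     - integral {0..1} v - k s * total_curvature"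
proof -
  note int = integrable_continuous_real continuous_intros continuous_frame continuous_euclidean_curvature
  have "inner_deficit s = integral {0..1} (\<lambda>t. (euclidean_curvature s * (euclidean_curvature t * v t) - v t)
      - k s * (v t * k t))"
    unfolding inner_deficit_def deficit_integrand(1) euclidean_curvature_def
    by (intro arg_cong2[where f = integral] refl ext) (simp add: algebra_simps)
  also have "\<dots> = integral {0..1} (\<lambda>t. euclidean_curvature s * (euclidean_curvature t * v t) - v t)
      - integral {0..1} (\<lambda>t. k s * (v t * k t))"
    by (intro integral_diff int)
  also have "integral {0..1} (\<lambda>t. euclidean_curvature s * (euclidean_curvature t * v t) - v t) =
      integral {0..1} (\<lambda>t. euclidean_curvature s * (euclidean_curvature t * v t)) - integral {0..1} v"
    by (intro integral_diff int)
  finally show ?thesis by (simp add: total_curvature_def)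
qed

lemma inner_deficit_nonneg: "0 \<le> inner_deficit s"
  and inner_deficit_eq_0_iff: "inner_deficit s = 0 \<longleftrightarrow> (\<forall>t\<in>{0..1}. k s = k t)"
proof -
  let ?f = "\<lambda>t. (sqrt (1 + (k s)\<^sup>2) * sqrt (1 + (k t)\<^sup>2) - 1 - k s * k t) * v t"
  have f: "inner_deficit s = integral {0..1} ?f"
    unfolding inner_deficit_def deficit_integrand(1) ..
  have c: "continuous_on {0..1} ?f" by (intro continuous_intros continuous_frame)
  have n: "?f t \<ge> 0" for t
    using deficit_integrand(2)[of "k s" "k t"] speed_pos[of t] by simp
  show "0 \<le> inner_deficit s"
    unfolding f by (intro integral_nonneg integrable_continuous_real c n)
  show "inner_deficit s = 0 \<longleftrightarrow> (\<forall>t\<in>{0..1}. k s = k t)"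
  proof -
    have "integral {0..1} ?f = 0 \<longleftrightarrow> (\<forall>t\<in>{0..1}. ?f t = 0)"
      by (rule integral_eq_0_iff[OF c _ n]) simp
    also have "\<dots> \<longleftrightarrow> (\<forall>t\<in>{0..1}. k s = k t)"
      unfolding mult_eq_0_iff deficit_integrand(3) using speed_pos by (simp add: less_imp_neq[symmetric])
    finally show ?thesis unfolding f .
  qed
qed

lemma continuous_inner_deficit: "continuous_on S inner_deficit"
  unfolding inner_deficit_eq[abs_def]
  by (intro continuous_intros continuous_euclidean_curvature continuous_frame)

text \<open>In its polynomial form the integrand is a sum of products of a function of
  \<open>s\<close> and the same function of \<open>t\<close>, so the double integral is a
  combination of three squares.\<close>

lemma deficit_eq:
  "integral {0..1} (\<lambda>s. inner_deficit s * v s) =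
    (integral {0..1} (\<lambda>t. euclidean_curvature t * v t))\<^sup>2 - (integral {0..1} v)\<^sup>2 - total_curvature\<^sup>2"
proof -
  note int = integrable_continuous_real continuous_intros continuous_frame continuous_euclidean_curvature
  let ?E = "integral {0..1} (\<lambda>t. euclidean_curvature t * v t)" and ?L = "integral {0..1} v"
  have "integral {0..1} (\<lambda>s. inner_deficit s * v s) =
      integral {0..1} (\<lambda>s. (?E * (euclidean_curvature s * v s) - ?L * v s) - total_curvature * (v s * k s))"
    unfolding inner_deficit_eq
    by (intro arg_cong2[where f = integral] refl ext) (simp add: algebra_simps)
  also have "\<dots> = integral {0..1} (\<lambda>s. ?E * (euclidean_curvature s * v s) - ?L * v s)
      - integral {0..1} (\<lambda>s. total_curvature * (v s * k s))"
    by (intro integral_diff int)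
  also have "integral {0..1} (\<lambda>s. ?E * (euclidean_curvature s * v s) - ?L * v s) =
      integral {0..1} (\<lambda>s. ?E * (euclidean_curvature s * v s)) - integral {0..1} (\<lambda>s. ?L * v s)"
    by (intro integral_diff int)
  finally show ?thesis by (simp add: total_curvature_def power2_eq_square)
qed

lemma deficit_nonneg: "0 \<le> integral {0..1} (\<lambda>s. inner_deficit s * v s)"
  using inner_deficit_nonneg speed_pos
  by (intro integral_nonneg integrable_continuous_real continuous_intros continuous_inner_deficit continuous_frame)
    (simp add: less_imp_le)

lemma deficit_eq_0_iff:
  "integral {0..1} (\<lambda>s. inner_deficit s * v s) = 0 \<longleftrightarrow> (\<forall>s t. k s = k t)"
proof -
  have "continuous_on {0..1} (\<lambda>s. inner_deficit s * v s)"
    by (intro continuous_intros continuous_inner_deficit continuous_frame)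
  then have "integral {0..1} (\<lambda>s. inner_deficit s * v s) = 0 \<longleftrightarrow> (\<forall>s\<in>{0..1}. inner_deficit s * v s = 0)"
    using inner_deficit_nonneg speed_pos by (intro integral_eq_0_iff) (auto simp: less_imp_le)
  also have "\<dots> \<longleftrightarrow> (\<forall>s\<in>{0..1}. \<forall>t\<in>{0..1}. k s = k t)"
    using speed_pos by (simp add: inner_deficit_eq_0_iff less_imp_neq[symmetric])
  also have "\<dots> \<longleftrightarrow> (\<forall>s t. k s = k t)"
  proof
    assume *: "\<forall>s\<in>{0..1}. \<forall>t\<in>{0..1}. k s = k t"
    have "frac s \<in> {0..1}" for s :: real using frac_ge_0[of s] frac_lt_1[of s] by simp
    then show "\<forall>s t. k s = k t" using * curvature_frac by metis
  qed blast
  finally show ?thesis .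
qed

end

theorem theorem4:
  fixes \<gamma> \<nu> :: "real \<Rightarrow> real^3" and \<Omega> :: "(real^3) set"
    and L A :: real and k_g k_E :: "real \<Rightarrow> real"
  assumes "smooth_simple_closed_spherical_curve \<gamma>"
    and "positively_enclosed_domain \<gamma> \<Omega> \<nu>"
    and "L = curve_length \<gamma>"
    and "A = sphere_area \<Omega>"
    and "k_g = geodesic_curvature \<gamma> \<nu>"
    and "k_E = space_curvature \<gamma>"
  shows "L\<^sup>2 - A * (4 * pi - A) \<le> (arclength_integral \<gamma> k_E)\<^sup>2 - 4 * pi\<^sup>2 \<and>
    L\<^sup>2 - A * (4 * pi - A) =
      (arclength_integral \<gamma> k_E)\<^sup>2 - 4 * pi\<^sup>2 - curvature_deficit \<gamma> k_g \<and>
    curvature_deficit \<gamma> k_g \<ge> 0 \<and>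
    (L\<^sup>2 - A * (4 * pi - A) = (arclength_integral \<gamma> k_E)\<^sup>2 - 4 * pi\<^sup>2 \<longleftrightarrow>
      geodesic_circle (range \<gamma>))"
proof -
  have \<Omega>: "\<Omega> \<in> components (sphere 0 1 - range \<gamma>)" and out: "outward_unit_normal \<gamma> \<Omega> \<nu>"
    and ori: "induces_orientation \<nu> \<gamma>"
    using assms(2) unfolding positively_enclosed_domain_def by auto
  interpret spherical_frame \<gamma> \<nu> "unit_tangent \<gamma>" "speed \<gamma>" k_g
    unfolding assms(5) by (rule spherical_frame_of_curve(1)[OF assms(1) out ori])
  have kE: "k_E = euclidean_curvature"
  proof
    fix t
    show "k_E t = euclidean_curvature t"
      unfolding euclidean_curvature_def assms(6)
      by (simp add: assms(5) spherical_frame_of_curve(2)[OF assms(1) out ori])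
  qed
  have E: "arclength_integral \<gamma> k_E = integral {0..1} (\<lambda>t. euclidean_curvature t * speed \<gamma> t)"
    by (simp add: arclength_integral_def kE)
  have R: "curvature_deficit \<gamma> k_g = integral {0..1} (\<lambda>s. inner_deficit s * speed \<gamma> s)"
    by (simp add: curvature_deficit_def arclength_integral_def inner_deficit_def)
  have L: "L = integral {0..1} (speed \<gamma>)"
    by (simp add: assms(3) curve_length_def)
  define C where "C = {y. y \<noteq> 0 \<and> norm y < 1 \<and> y /\<^sub>R norm y \<in> \<Omega>}"
  \<comment> \<open>The sphere is locally connected and the complement of the compact curve is open
    in it, so the components of this complement are open.\<close>
  have "openin (top_of_set (sphere 0 1)) \<Omega>"
  proof -
    have op: "openin (top_of_set (sphere 0 1)) (sphere 0 1 - range \<gamma>)"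
    proof (intro openin_diff closed_subset)
      show "closed (range \<gamma>)" using compact_range by (rule compact_imp_closed)
      show "range \<gamma> \<subseteq> sphere 0 1" using orthonormal(1) by (auto simp: norm_eq_1)
    qed simp
    have "locally connected (sphere 0 1 :: (real^3) set)"
      by (intro locally_path_connected_imp_locally_connected locally_path_connected_sphere)
    then have "locally connected (sphere 0 1 - range \<gamma>)"
      using op by (rule locally_open_subset)
    then show ?thesis
      using \<Omega> op by (meson openin_components_locally_connected openin_trans)
  qed
  from sphere_area_cone[OF this C_def]
  have "C \<in> sets borel" and A: "A = 3 * measure lborel C" by (simp_all add: assms(4))
  then have K: "total_curvature = 2 * pi - A"
    using out unfolding outward_unit_normal_def
    by (subst Gauss_Bonnet_cone[OF \<Omega> _ C_def]) auto
  \<comment> \<open>Completing the square: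
    \<open>A (4 pi - A) = 4 pi^2 - (2 pi - A)^2\<close>.\<close>
  have "A * (4 * pi - A) = 4 * pi\<^sup>2 - total_curvature\<^sup>2"
    unfolding K by (simp add: power2_eq_square algebra_simps)
  then show ?thesis
    using deficit_eq deficit_nonneg deficit_eq_0_iff geodesic_circle_iff_constant_curvature
    unfolding E R L by auto
qed

end
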